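(* There exists a fixed-parameter (dynamic programming) algorithm for \textsc{Distinct approximate Kemeny Ranking Aggregation} parameterized by both $\lambda$ and $d$ which runs in time $O^*(16^{\lambda d})$, where $\lambda$ is the approximation factor and $d$ is the average Kendall-Tau distance of the input rankings.
   Context: Let $\mathcal{C}$ be a set of candidates and $\Pi$ a multiset of $n\ge2$ rankings (complete linear orders) of $\mathcal{C}$. The Kendall-Tau distance $d_{KT}(v,w)$ is the number of pairs of candidates that two rankings order differently, and $d=\frac{\sum_{v\in\Pi}\sum_{w\in\Pi}d_{KT}(v,w)}{n(n-1)}$. The Kemeny score of a ranking $Q$ is $\sum_{v\in\Pi}d_{KT}(Q,v)$; its minimum is $k_{OPT}(\Pi)$. $K(\Pi,k)$ is the set of rankings of Kemeny score at most $k$. A ranking respects the unanimity order of $\Pi$ if it places $x$ before $y$ whenever all rankings in $\Pi$ do. \textsc{Distinct approximate Kemeny Ranking Aggregation}: given $(\mathcal{C},\Pi,\lambda,r)$ with real $\lambda\ge1$ and integer $r$, output $\min\{r,|K(\Pi,\lambda\cdot k_{OPT}(\Pi))|\}$ distinct rankings, each respecting the unanimity order and with Kemeny score at most $\lambda\cdot k_{OPT}(\Pi)$. $O^*(g)$ denotes $O(g\cdot \mathrm{poly}(\text{input size}))$.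
   Formalization: Some instances have fewer than min{r,|K|} unanimity-respecting rankings (votes abc, acb, λ=3, r=3); there all admissible rankings must be output. The input size counts r in unary, so the hidden factor may be polynomial in r; with r in binary the bound fails. *)

theory Defs
  imports Complex_Main
    "HOL-Library.Multiset"
    "HOL-Combinatorics.Multiset_Permutations"
    "HOL-Computational_Algebra.Polynomial"
begin

section \<open>Rankings and Kemeny scores\<close>

text \<open>
  A ranking of a finite set \<open>C\<close> is the list of its elements from first to last place, that is, a
  member of \<^term>\<open>permutations_of_set C\<close>.
\<close>

definition before :: "'a list \<Rightarrow> 'a \<Rightarrow> 'a \<Rightarrow> bool" where
  "before v x y \<longleftrightarrow> (\<exists>i j. i < j \<and> j < length v \<and> v ! i = x \<and> v ! j = y)"

text \<open>Every unordered pair on which \<open>v\<close> and \<open>w\<close> disagree is counted once, listed as \<open>v\<close> orders it.\<close>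

definition d_KT :: "'a list \<Rightarrow> 'a list \<Rightarrow> nat" where
  "d_KT v w = card {(x, y). before v x y \<and> before w y x}"

definition avg_KT :: "'a list multiset \<Rightarrow> real" where
  "avg_KT V = real (\<Sum>v\<in>#V. \<Sum>w\<in>#V. d_KT v w) / (real (size V) * (real (size V) - 1))"

definition kemeny_score :: "'a list multiset \<Rightarrow> 'a list \<Rightarrow> nat" where
  "kemeny_score V Q = (\<Sum>v\<in>#V. d_KT Q v)"

definition k_OPT :: "'a set \<Rightarrow> 'a list multiset \<Rightarrow> nat" where
  "k_OPT C V = Min (kemeny_score V ` permutations_of_set C)"

definition K :: "'a set \<Rightarrow> 'a list multiset \<Rightarrow> real \<Rightarrow> 'a list set" where
  "K C V k = {Q \<in> permutations_of_set C. real (kemeny_score V Q) \<le> k}"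

definition respects_unanimity :: "'a list multiset \<Rightarrow> 'a list \<Rightarrow> bool" where
  "respects_unanimity V Q \<longleftrightarrow> (\<forall>x y. (\<forall>v\<in>#V. before v x y) \<longrightarrow> before Q x y)"


section \<open>Distinct approximate Kemeny Ranking Aggregation\<close>

definition kemeny_instance :: "'a set \<Rightarrow> 'a list multiset \<Rightarrow> real \<Rightarrow> nat \<Rightarrow> bool" where
  "kemeny_instance C V lam r \<longleftrightarrow>
     finite C \<and> set_mset V \<subseteq> permutations_of_set C \<and> size V \<ge> 2 \<and> lam \<ge> 1"

definition kemeny_solution ::
    "'a set \<Rightarrow> 'a list multiset \<Rightarrow> real \<Rightarrow> nat \<Rightarrow> 'a list list \<Rightarrow> bool" where
  "kemeny_solution C V lam r L \<longleftrightarrow>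
     distinct L \<and> length L = min r (card (K C V (lam * real (k_OPT C V)))) \<and>
     (\<forall>Q\<in>set L. Q \<in> K C V (lam * real (k_OPT C V)) \<and> respects_unanimity V Q)"

text \<open>
  \<^const>\<open>K\<close> also contains rankings that violate the unanimity order, so that for large \<open>lam\<close> and \<open>r\<close>
  there may be fewer than \<open>min r (card K)\<close> admissible rankings and hence no solution: for the votes
  \<open>abc\<close>, \<open>acb\<close> and \<open>lam = 3\<close>, the ranking \<open>bac\<close> is in \<^const>\<open>K\<close>, but only the two votes respect the
  unanimity order.  On such an instance all admissible rankings have to be output.
  Lemma \<open>correct_output_iff\<close> gives a uniform description of both cases.
\<close>

definition correct_output ::
    "'a set \<Rightarrow> 'a list multiset \<Rightarrow> real \<Rightarrow> nat \<Rightarrow> 'a list list \<Rightarrow> bool" where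
  "correct_output C V lam r L \<longleftrightarrow>
     (if \<exists>L'. kemeny_solution C V lam r L' then kemeny_solution C V lam r L
      else distinct L \<and> set L = {Q \<in> K C V (lam * real (k_OPT C V)). respects_unanimity V Q})"

lemma finite_K: "finite (K C V k)"
  unfolding K_def by simp

lemma correct_output_iff:
  fixes C :: "'a set" and V lam r
  defines "A \<equiv> {Q \<in> K C V (lam * real (k_OPT C V)). respects_unanimity V Q}"
  shows "correct_output C V lam r L \<longleftrightarrow> distinct L \<and> length L = min r (card A) \<and> set L \<subseteq> A"
proof -
  let ?K = "K C V (lam * real (k_OPT C V))"
  have finA: "finite A" and le: "card A \<le> card ?K"
    unfolding A_def by (auto simp: finite_K intro!: card_mono)
  have sol: "kemeny_solution C V lam r L \<longleftrightarrow> distinct L \<and> length L = min r (card ?K) \<and> set L \<subseteq> A" for L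
    unfolding kemeny_solution_def A_def by auto
  have ex: "(\<exists>L'. kemeny_solution C V lam r L') \<longleftrightarrow> min r (card ?K) \<le> card A"
  proof
    assume "\<exists>L'. kemeny_solution C V lam r L'"
    then show "min r (card ?K) \<le> card A"
      unfolding sol by (metis card_mono distinct_card finA)
  next
    assume "min r (card ?K) \<le> card A"
    then obtain B where B: "B \<subseteq> A" "card B = min r (card ?K)" "finite B"
      by (meson finA obtain_subset_with_card_n)
    then obtain L' where "set L' = B" "distinct L'"
      using finite_distinct_list by blast
    with B show "\<exists>L'. kemeny_solution C V lam r L'"
      unfolding sol by (metis distinct_card)
  qed
  show ?thesis
  proof (cases "min r (card ?K) \<le> card A")
    case True
    then have "min r (card ?K) = min r (card A)"
      using le by auto
    then show ?thesis
      using True ex sol[of L] unfolding correct_output_def by (simp only: if_True simp_thms)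
  next
    case False
    then have m: "min r (card A) = card A"
      using le by auto
    have "set L = A \<longleftrightarrow> length L = card A \<and> set L \<subseteq> A" if "distinct L"
      using card_subset_eq[OF finA, of "set L"] distinct_card[OF that] by auto
    moreover have "correct_output C V lam r L \<longleftrightarrow> distinct L \<and> set L = A"
      using False ex unfolding correct_output_def A_def by (simp only: if_False simp_thms)
    ultimately show ?thesis
      unfolding m by blast
  qed
qed


section \<open>The machine model\<close>

text \<open>
  Algorithms are programs for a random access machine that is extended by exact real numbers, as the
  input \<open>lam\<close> is an arbitrary real.  The memory consists of arrays of natural numbers and arrays of
  reals, with indirect addressing by naturals.  Arithmetic is limited to addition and (on naturals:
  truncated) subtraction: multiplication or rounding at unit cost would make the machine
  unreasonably powerful.  Real constants other than naturals are excluded because a program could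
  hide infinitely much information in them.
\<close>

datatype aexp =
    Num nat
  | Cell nat aexp  \<comment> \<open>array name and index\<close>
  | Plus aexp aexp
  | Monus aexp aexp

datatype rexp =
    RNat aexp
  | RCell nat aexp
  | RPlus rexp rexp
  | RMinus rexp rexp

datatype bexp =
    Less aexp aexp
  | RLess rexp rexp
  | BNot bexp
  | BAnd bexp bexp

datatype com =
    Skip
  | Assign nat aexp aexp  \<comment> \<open>array name, index, value\<close>
  | RAssign nat aexp rexp
  | Seq com com
  | If bexp com com
  | While bexp com

record state =
  nats :: "nat \<Rightarrow> nat \<Rightarrow> nat"
  reals :: "nat \<Rightarrow> nat \<Rightarrow> real"

primrec aval :: "aexp \<Rightarrow> state \<Rightarrow> nat" where
  "aval (Num k) s = k"
| "aval (Cell a e) s = nats s a (aval e s)"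
| "aval (Plus e f) s = aval e s + aval f s"
| "aval (Monus e f) s = aval e s - aval f s"

primrec rval :: "rexp \<Rightarrow> state \<Rightarrow> real" where
  "rval (RNat e) s = real (aval e s)"
| "rval (RCell a e) s = reals s a (aval e s)"
| "rval (RPlus e f) s = rval e s + rval f s"
| "rval (RMinus e f) s = rval e s - rval f s"

primrec bval :: "bexp \<Rightarrow> state \<Rightarrow> bool" where
  "bval (Less e f) s \<longleftrightarrow> aval e s < aval f s"
| "bval (RLess e f) s \<longleftrightarrow> rval e s < rval f s"
| "bval (BNot b) s \<longleftrightarrow> \<not> bval b s"
| "bval (BAnd b c) s \<longleftrightarrow> bval b s \<and> bval c s"

text \<open>Every operation, memory access and test costs one time unit.\<close>

primrec acost :: "aexp \<Rightarrow> nat" where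
  "acost (Num k) = 1"
| "acost (Cell a e) = acost e + 1"
| "acost (Plus e f) = acost e + acost f + 1"
| "acost (Monus e f) = acost e + acost f + 1"

primrec rcost :: "rexp \<Rightarrow> nat" where
  "rcost (RNat e) = acost e + 1"
| "rcost (RCell a e) = acost e + 1"
| "rcost (RPlus e f) = rcost e + rcost f + 1"
| "rcost (RMinus e f) = rcost e + rcost f + 1"

primrec bcost :: "bexp \<Rightarrow> nat" where
  "bcost (Less e f) = acost e + acost f + 1"
| "bcost (RLess e f) = rcost e + rcost f + 1"
| "bcost (BNot b) = bcost b + 1"
| "bcost (BAnd b c) = bcost b + bcost c + 1"

definition upd :: "(nat \<Rightarrow> nat \<Rightarrow> 'v) \<Rightarrow> nat \<Rightarrow> nat \<Rightarrow> 'v \<Rightarrow> (nat \<Rightarrow> nat \<Rightarrow> 'v)" where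
  "upd m a i v = m(a := (m a)(i := v))"

text \<open>\<open>exec c s t s'\<close>: started in \<open>s\<close>, the program \<open>c\<close> halts after time \<open>t\<close> in \<open>s'\<close>.\<close>

inductive exec :: "com \<Rightarrow> state \<Rightarrow> nat \<Rightarrow> state \<Rightarrow> bool" where
  Skip: "exec Skip s 1 s"
| Assign: "exec (Assign a e f) s (acost e + acost f + 1)
     (s\<lparr>nats := upd (nats s) a (aval e s) (aval f s)\<rparr>)"
| RAssign: "exec (RAssign a e f) s (acost e + rcost f + 1)
     (s\<lparr>reals := upd (reals s) a (aval e s) (rval f s)\<rparr>)"
| Seq: "exec c s t s' \<Longrightarrow> exec d s' u s'' \<Longrightarrow> exec (Seq c d) s (t + u) s''"
| IfTrue: "bval b s \<Longrightarrow> exec c s t s' \<Longrightarrow> exec (If b c d) s (bcost b + t + 1) s'"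
| IfFalse: "\<not> bval b s \<Longrightarrow> exec d s t s' \<Longrightarrow> exec (If b c d) s (bcost b + t + 1) s'"
| WhileFalse: "\<not> bval b s \<Longrightarrow> exec (While b c) s (bcost b + 1) s"
| WhileTrue: "bval b s \<Longrightarrow> exec c s t s' \<Longrightarrow> exec (While b c) s' u s'' \<Longrightarrow>
     exec (While b c) s (bcost b + t + u + 1) s''"

inductive_cases exec_SkipE: "exec Skip s t s'"
inductive_cases exec_AssignE: "exec (Assign a e f) s t s'"
inductive_cases exec_RAssignE: "exec (RAssign a e f) s t s'"
inductive_cases exec_SeqE: "exec (Seq c d) s t s'"
inductive_cases exec_IfE: "exec (If b c d) s t s'"
inductive_cases exec_WhileE: "exec (While b c) s t s'"

lemma exec_deterministic:
  "exec c s t s' \<Longrightarrow> exec c s u s'' \<Longrightarrow> t = u \<and> s' = s''"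
proof (induction arbitrary: u s'' rule: exec.induct)
  case (Skip s) then show ?case by (auto elim: exec_SkipE)
next
  case (Assign a e f s) then show ?case by (auto elim: exec_AssignE)
next
  case (RAssign a e f s) then show ?case by (auto elim: exec_RAssignE)
next
  case (Seq c s t s' d v s'')
  from Seq.prems show ?case
    by (rule exec_SeqE) (metis Seq.IH)
next
  case (IfTrue b s c t s' d)
  from IfTrue.prems show ?case
    by (rule exec_IfE) (use IfTrue.IH IfTrue.hyps in fastforce)+
next
  case (IfFalse b s d t s' c)
  from IfFalse.prems show ?case
    by (rule exec_IfE) (use IfFalse.IH IfFalse.hyps in fastforce)+
next
  case (WhileFalse b s c)
  from WhileFalse.prems show ?case
    by (rule exec_WhileE) (use WhileFalse.hyps in simp_all)
next
  case (WhileTrue b s c t s' v s'')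
  from WhileTrue.prems show ?case
    by (rule exec_WhileE) (use WhileTrue.IH WhileTrue.hyps in fastforce)+
qed


section \<open>Input and output conventions\<close>

text \<open>
  Candidates are natural numbers, each stored in one cell.  The input consists of the numbers of
  candidates and votes, the candidates and the votes (both in any order), and \<open>r\<close> in unary.
  With \<open>r\<close> in binary the time bound would fail, since up to \<open>r\<close> rankings have to be written:
  let \<open>n\<close> votes arise from one ranking of \<open>2n\<close> candidates by exchanging one of the \<open>n\<close> disjoint
  pairs of neighbours each.  Then \<open>d = 2\<close> and \<open>k_OPT = n\<close> for \<open>n \<ge> 3\<close>, and exchanging any \<open>j \<le> lam - 1\<close>
  pairs yields an admissible ranking.  For \<open>lam = j + 1\<close> and \<open>n = j\<^sup>2\<close> there are more than \<open>j ^ j\<close>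
  of these, which exceeds every polynomial in \<open>j\<close> times \<open>16 powr (lam * d)\<close>.
\<close>

definition input_word :: "nat list \<Rightarrow> nat list list \<Rightarrow> nat \<Rightarrow> nat list" where
  "input_word cs vs r = [length cs, length vs] @ cs @ concat vs @ replicate r 1"

text \<open>Natural array 0 holds the input word, and entry 0 of real array 0 holds \<open>lam\<close>.\<close>

definition input_state :: "nat list \<Rightarrow> nat list list \<Rightarrow> real \<Rightarrow> nat \<Rightarrow> state" where
  "input_state cs vs lam r =
     \<lparr>nats = (\<lambda>a i. if a = 0 \<and> i < length (input_word cs vs r) then input_word cs vs r ! i else 0),
      reals = (\<lambda>a i. if a = 0 \<and> i = 0 then lam else 0)\<rparr>"

text \<open>The length of the input word and one more cell for \<open>lam\<close>.\<close>

definition input_size :: "nat list \<Rightarrow> nat list list \<Rightarrow> nat \<Rightarrow> nat" where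
  "input_size cs vs r = length (input_word cs vs r) + 1"

text \<open>The result is expected in natural array 1: the number of rankings, then the rankings.\<close>

definition has_output :: "state \<Rightarrow> nat list list \<Rightarrow> bool" where
  "has_output s L \<longleftrightarrow>
     (\<forall>i < length (length L # concat L). nats s 1 i = (length L # concat L) ! i)"

end

theory Submission
  imports Defs "HOL-Library.Nat_Bijection"
begin

text \<open>
  The cost of a prefix \<open>P\<close> counts the disagreements caused by placing each \<open>x\<close> of \<open>P\<close> before everything
  that is not before \<open>x\<close> in \<open>P\<close>.  It never exceeds the score of a ranking that starts with \<open>P\<close>, it is the
  score if \<open>P\<close> is complete, and the cost of appending a candidate depends only on the set of \<open>P\<close>.  So a
  search that creates prefixes in the order of their costs may drop a prefix as soon as \<open>r\<close> prefixes of
  the same set exist.  The first complete prefix costs \<open>k_OPT\<close>, because an optimal ranking respects the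
  unanimity order: exchanging a pair that violates it would lower the score.  The search stops when the
  cost exceeds \<open>lam * k_OPT\<close>.

  If a prefix of cost at most \<open>lam * k_OPT \<le> lam * d * (n - 1)\<close> has the set \<open>S\<close>, then for some vote at most
  \<open>lam * d\<close> pairs have their first element outside \<open>S\<close> and their second one in \<open>S\<close>.  Reading membership in
  \<open>S\<close> along this vote yields a binary word with at most \<open>lam * d\<close> inversions, and only
  \<open>2 * (m + 1) * 3 ^ D\<close> words of length \<open>m\<close> have at most \<open>D\<close> inversions.  There are at most
  \<open>n * (lam * d + 1)\<close> costs, and at each of them every prefix found is compared with every other one.
  This takes time \<open>(lam * d + 1) * 9 powr (lam * d)\<close> up to a polynomial factor.
\<close>

section \<open>Orders and inversions\<close>

text \<open>The bound \<open>k_OPT <= d * (n - 1)\<close> holds because the votes are rankings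
  themselves, and the minimal score is at most the average of their scores. The passage to a single
  vote is a pigeonhole argument: with \<open>D\<close> the integer part of \<open>lam * d\<close>, a
  cost below \<open>n * (D + 1)\<close> pays in every vote at least for the inversions between
  \<open>S\<close> and its complement, so some vote has at most \<open>D\<close> of them.

  Working in the order of costs has two benefits: \<open>k_OPT\<close> need not be known at the
  start, and no stored prefix ever has to be replaced by a cheaper one of the same set. The obstacle
  is that appending a candidate may cost nothing. Hence the pass for cost \<open>k\<close> must also
  extend the prefixes that it finds itself.

  The base 9 is \<open>3 * 3\<close>, from the comparison of prefixes in pairs. The gap up to 16
  absorbs the linear factor for the number of costs, as
  \<open>x + 1 <= 2 * (16 / 9) powr x\<close>.\<close>

lemma before_Nil [simp]: "\<not> before [] x y"
  by (simp add: before_def)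

lemma before_Cons [simp]: "before (a # v) x y \<longleftrightarrow> x = a \<and> y \<in> set v \<or> before v x y"
proof
  assume "before (a # v) x y"
  then obtain i j where *: "i < j" "j < Suc (length v)" "(a # v) ! i = x" "(a # v) ! j = y"
    by (auto simp: before_def)
  then obtain j' where j: "j = Suc j'" by (cases j) auto
  show "x = a \<and> y \<in> set v \<or> before v x y"
  proof (cases i)
    case 0
    then show ?thesis using * j by auto
  next
    case (Suc i')
    then show ?thesis using * j unfolding before_def by auto
  qed
next
  assume "x = a \<and> y \<in> set v \<or> before v x y"
  then show "before (a # v) x y"
  proof
    assume "x = a \<and> y \<in> set v"
    then obtain j where "j < length v" "v ! j = y" "x = a" by (auto simp: in_set_conv_nth)
    then show ?thesis unfolding before_def by (intro exI[of _ 0] exI[of _ "Suc j"]) auto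
  next
    assume "before v x y"
    then obtain i j where "i < j" "j < length v" "v ! i = x" "v ! j = y" by (auto simp: before_def)
    then show ?thesis unfolding before_def by (intro exI[of _ "Suc i"] exI[of _ "Suc j"]) auto
  qed
qed

lemma before_append [simp]:
  "before (v @ w) x y \<longleftrightarrow> before v x y \<or> before w x y \<or> x \<in> set v \<and> y \<in> set w"
  by (induction v) auto

lemma before_in_set: "before v x y \<Longrightarrow> x \<in> set v \<and> y \<in> set v"
  by (induction v) auto

lemma before_asym: "distinct v \<Longrightarrow> before v x y \<Longrightarrow> \<not> before v y x"
  by (induction v) (auto dest: before_in_set)

lemma before_irrefl: "distinct v \<Longrightarrow> \<not> before v x x"
  using before_asym by metis

lemma before_trans: "distinct v \<Longrightarrow> before v x y \<Longrightarrow> before v y z \<Longrightarrow> before v x z"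
  by (induction v) (auto dest: before_in_set)

lemma before_total: "x \<in> set v \<Longrightarrow> y \<in> set v \<Longrightarrow> x \<noteq> y \<Longrightarrow> before v x y \<or> before v y x"
  by (induction v) auto

lemma finite_before_pairs [simp]: "finite {(x, y). before v x y \<and> R x y}"
  by (rule finite_subset[of _ "set v \<times> set v"]) (auto dest: before_in_set)

text \<open>A disagreement of \<open>Q'\<close> with \<open>v\<close> between \<open>x\<close> and
  some \<open>b\<close> in \<open>B\<close> becomes one of \<open>Q\<close> between \<open>y\<close>
  and \<open>b\<close>: if \<open>v\<close> places \<open>b\<close> before \<open>x\<close>, then
  also before \<open>y\<close>. Pairs of \<open>y\<close> with \<open>B\<close> are treated
  symmetrically, all other disagreements persist, and \<open>(y, x)\<close> is a disagreement of
  \<open>Q\<close> that is not hit.\<close>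

lemma d_KT_swap_less:
  fixes Q :: "'a list" and B xs ys :: "'a list" and x y :: 'a
  defines "Q \<equiv> xs @ [y] @ B @ [x] @ ys" and "Q' \<equiv> xs @ [x] @ B @ [y] @ ys"
  assumes dQ: "distinct Q" and v: "distinct v" "before v x y"
  shows "d_KT Q' v < d_KT Q v"
proof -
  let ?D = "{(a, b). before Q a b \<and> before v b a}"
  let ?D' = "{(a, b). before Q' a b \<and> before v b a}"
  define f where "f = (\<lambda>(a, b). if a = x \<and> b \<in> set B then (y, b)
    else if b = y \<and> a \<in> set B then (a, x) else (a, b))"
  have nyx: "\<not> before v y x" using before_asym v by fast
  have tr1: "before v b x \<Longrightarrow> before v b y" and tr2: "before v y b \<Longrightarrow> before v x b" for b
    using v before_trans by fast+
  have "x \<noteq> y" using v before_irrefl by fast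
  have inQ: "f p \<in> ?D - {(y, x)}" if "p \<in> ?D'" for p
    using that dQ nyx tr1 tr2 \<open>x \<noteq> y\<close>
    unfolding f_def Q_def Q'_def
    by (cases p) (auto split: if_splits dest: before_in_set)
  \<comment> \<open>No images collide: \<open>Q'\<close> has each \<open>b\<close> of
    \<open>B\<close> between \<open>x\<close> and \<open>y\<close>, so \<open>?D'\<close> contains
    neither \<open>(y, b)\<close> nor \<open>(b, x)\<close>, and \<open>f\<close> can be
    undone.\<close>
  define h where "h = (\<lambda>(a, b). if a = y \<and> b \<in> set B then (x, b)
    else if b = x \<and> a \<in> set B then (a, y) else (a, b))"
  have "h (f p) = p" if "p \<in> ?D'" for p
    using that dQ \<open>x \<noteq> y\<close> unfolding f_def h_def Q_def Q'_def
    by (cases p) (auto dest: before_in_set)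
  then have "inj_on f ?D'"
    by (rule inj_on_inverseI)
  then have "card ?D' = card (f ` ?D')"
    by (simp add: card_image)
  also have "\<dots> \<le> card (?D - {(y, x)})"
    using inQ by (intro card_mono image_subsetI) auto
  also have "\<dots> < card ?D"
    using v finite_before_pairs[of Q "\<lambda>a b. before v b a"]
    by (intro psubset_card_mono) (auto simp: Q_def)
  finally show ?thesis unfolding d_KT_def .
qed

text \<open>
  Reading \<open>v\<close> from the left with \<open>z\<close> elements outside \<open>S\<close> already seen, every element of \<open>S\<close> pays for
  the elements outside \<open>S\<close> before it.
\<close>

fun inversions :: "nat \<Rightarrow> 'a list \<Rightarrow> 'a set \<Rightarrow> nat" where
  "inversions z [] S = 0"
| "inversions z (x # v) S = (if x \<in> S then z + inversions z v S else inversions (Suc z) v S)"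

lemma inversions_eq:
  "distinct v \<Longrightarrow> inversions z v S =
     z * card (set v \<inter> S) + card {(y, x). before v y x \<and> y \<notin> S \<and> x \<in> S}"
proof (induction v arbitrary: z)
  case (Cons a v)
  let ?P = "{(y, x). before v y x \<and> y \<notin> S \<and> x \<in> S}"
  show ?case
  proof (cases "a \<in> S")
    case True
    then have "{(y, x). before (a # v) y x \<and> y \<notin> S \<and> x \<in> S} = ?P" by auto
    then show ?thesis using True Cons by (simp add: insert_absorb Int_insert_left)
  next
    case False
    have "{(y, x). before (a # v) y x \<and> y \<notin> S \<and> x \<in> S} = Pair a ` (set v \<inter> S) \<union> ?P"
      using False by auto
    moreover have "card (Pair a ` (set v \<inter> S) \<union> ?P) = card (Pair a ` (set v \<inter> S)) + card ?P"
      using Cons.prems by (intro card_Un_disjoint) (auto dest: before_in_set)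
    moreover have "card (Pair a ` (set v \<inter> S)) = card (set v \<inter> S)"
      by (intro card_image inj_onI) auto
    ultimately show ?thesis using False Cons by simp
  qed
qed simp

section \<open>Counting the sets with few inversions\<close>

lemma subsets_Cons_card_le:
  assumes "x \<notin> set v"
  shows "card {S. S \<subseteq> set (x # v) \<and> R S} \<le>
    card {S. S \<subseteq> set v \<and> R (insert x S)} + card {S. S \<subseteq> set v \<and> R S}"
proof -
  have "{S. S \<subseteq> set (x # v) \<and> R S} \<subseteq>
      insert x ` {S. S \<subseteq> set v \<and> R (insert x S)} \<union> {S. S \<subseteq> set v \<and> R S}"
  proof
    fix S assume S: "S \<in> {S. S \<subseteq> set (x # v) \<and> R S}"
    show "S \<in> insert x ` {S. S \<subseteq> set v \<and> R (insert x S)} \<union> {S. S \<subseteq> set v \<and> R S}"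
    proof (cases "x \<in> S")
      case True
      then have "S = insert x (S - {x})" by auto
      then show ?thesis using S by (intro UnI1 image_eqI[of _ _ "S - {x}"]) auto
    qed (use S in auto)
  qed
  then have "card {S. S \<subseteq> set (x # v) \<and> R S} \<le>
      card (insert x ` {S. S \<subseteq> set v \<and> R (insert x S)} \<union> {S. S \<subseteq> set v \<and> R S})"
    by (intro card_mono) auto
  also have "\<dots> \<le> card (insert x ` {S. S \<subseteq> set v \<and> R (insert x S)}) + card {S. S \<subseteq> set v \<and> R S}"
    by (rule card_Un_le)
  also have "card (insert x ` {S. S \<subseteq> set v \<and> R (insert x S)}) \<le> card {S. S \<subseteq> set v \<and> R (insert x S)}"
    by (rule card_image_le) auto
  finally show ?thesis by simp
qed

lemma inversions_insert_notin: "x \<notin> set v \<Longrightarrow> inversions z v (insert x S) = inversions z v S"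
  by (induction v arbitrary: z) auto

text \<open>
  The factor \<open>f z = 1 + 3 / 3 ^ z\<close> is chosen such that \<open>f (z + 1) + f z / 3 ^ z \<le> f z\<close>, where the summands
  stem from the first element of \<open>v\<close> being outside or inside \<open>S\<close>.
\<close>

lemma card_few_inversions_pos:
  "distinct v \<Longrightarrow> z \<ge> 1 \<Longrightarrow>
    real (card {S. S \<subseteq> set v \<and> inversions z v S \<le> D}) \<le> 3 ^ D * (1 + 3 / 3 ^ z)"
proof (induction v arbitrary: z D)
  case Nil
  have "{S::'a set. S \<subseteq> {}} = {{}}" by auto
  moreover have "(1::real) * 1 \<le> 3 ^ D * (1 + 3 / 3 ^ z)" by (intro mult_mono) auto
  ultimately show ?case by simp
next
  case (Cons x v)
  have x: "x \<notin> set v" "distinct v" using Cons.prems by auto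
  let ?A = "{S. S \<subseteq> set v \<and> inversions z (x # v) (insert x S) \<le> D}"
  let ?B = "{S. S \<subseteq> set v \<and> inversions z (x # v) S \<le> D}"
  have B: "?B = {S. S \<subseteq> set v \<and> inversions (Suc z) v S \<le> D}" using x by auto
  have cB: "real (card ?B) \<le> 3 ^ D * (1 + 3 / 3 ^ Suc z)"
    unfolding B by (rule Cons.IH) (use x in auto)
  \<comment> \<open>As \<open>z\<close> is at least 1, the factor in the induction hypothesis is at
    most 2. Together with \<open>1 + 1 / 3 ^ z\<close> from \<open>cB\<close> this gives exactly
    \<open>1 + 3 / 3 ^ z\<close>.\<close>
  have cA: "real (card ?A) \<le> 3 ^ D * (2 / 3 ^ z)"
  proof (cases "z \<le> D")
    case True
    then have "?A = {S. S \<subseteq> set v \<and> inversions z v S \<le> D - z}"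
      using x by (auto simp: inversions_insert_notin)
    then have "real (card ?A) \<le> 3 ^ (D - z) * (1 + 3 / 3 ^ z)"
      using Cons.IH[of z "D - z"] x Cons.prems by simp
    also have "\<dots> \<le> 3 ^ (D - z) * (1 + 3 / 3 ^ 1)"
      using Cons.prems
      by (intro mult_left_mono add_left_mono divide_left_mono power_increasing) auto
    also have "\<dots> = 3 ^ D * (2 / 3 ^ z)" using True by (simp add: power_diff)
    finally show ?thesis .
  next
    case False
    then have "?A = {}" using x by auto
    then show ?thesis by (simp only: card.empty) simp
  qed
  have "real (card {S. S \<subseteq> set (x # v) \<and> inversions z (x # v) S \<le> D}) \<le> real (card ?A + card ?B)"
    using subsets_Cons_card_le[OF x(1), of "\<lambda>S. inversions z (x # v) S \<le> D"]
    by (simp only: of_nat_le_iff)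
  also have "\<dots> \<le> 3 ^ D * (1 + 3 / 3 ^ z)" using cA cB by (simp add: field_simps)
  finally show ?case .
qed

text \<open>For \<open>z = 0\<close> an element inside \<open>S\<close> is free of charge, so the
  previous recursion gains nothing there. Instead the place of the first element outside
  \<open>S\<close> is summed over: from there on \<open>z = 1\<close>, where the count is at most
  \<open>2 * 3 ^ D\<close>.\<close>

lemma card_few_inversions:
  "distinct v \<Longrightarrow> card {S. S \<subseteq> set v \<and> inversions 0 v S \<le> D} \<le> 2 * (length v + 1) * 3 ^ D"
proof (induction v)
  case Nil
  have "{S::'a set. S \<subseteq> {}} = {{}}" by auto
  then show ?case by simp
next
  case (Cons x v)
  have x: "x \<notin> set v" "distinct v" using Cons.prems by auto
  let ?A = "{S. S \<subseteq> set v \<and> inversions 0 (x # v) (insert x S) \<le> D}"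
  let ?B = "{S. S \<subseteq> set v \<and> inversions 0 (x # v) S \<le> D}"
  have A: "?A = {S. S \<subseteq> set v \<and> inversions 0 v S \<le> D}"
    using x by (auto simp: inversions_insert_notin)
  have B: "?B = {S. S \<subseteq> set v \<and> inversions (Suc 0) v S \<le> D}" using x by auto
  have "real (card ?B) \<le> real (2 * 3 ^ D)"
    unfolding B using card_few_inversions_pos[OF x(2), of "Suc 0" D] by simp
  then have cB: "card ?B \<le> 2 * 3 ^ D" by (simp only: of_nat_le_iff)
  have "card {S. S \<subseteq> set (x # v) \<and> inversions 0 (x # v) S \<le> D} \<le> card ?A + card ?B"
    by (rule subsets_Cons_card_le[OF x(1)])
  also have "\<dots> \<le> 2 * (length (x # v) + 1) * 3 ^ D"
    using cB Cons.IH[OF x(2)] unfolding A by (simp add: algebra_simps)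
  finally show ?case .
qed

section \<open>Costs of prefixes\<close>

locale election =
  fixes C :: "'a set" and V :: "'a list multiset"
  assumes finite_C: "finite C" and votes: "set_mset V \<subseteq> permutations_of_set C" and V_ne: "V \<noteq> {#}"
begin

lemma voteD: "v \<in># V \<Longrightarrow> distinct v \<and> set v = C"
  using votes by (auto simp: permutations_of_set_def)

definition pref :: "'a \<Rightarrow> 'a \<Rightarrow> nat" where
  "pref y x = size {#v \<in># V. before v y x#}"

definition gain :: "'a set \<Rightarrow> 'a \<Rightarrow> nat" where
  "gain S c = (\<Sum>y\<in>C - S - {c}. pref y c)"

text \<open>Phrased by counts of votes, so that a single run over the remaining candidates yields
  both \<open>gain\<close> and this test.\<close>

definition free :: "'a set \<Rightarrow> 'a \<Rightarrow> bool" where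
  "free S c \<longleftrightarrow> c \<in> C \<and> c \<notin> S \<and> (\<forall>y\<in>C - S - {c}. pref y c < size V)"

definition cost :: "'a list \<Rightarrow> nat" where
  "cost P = (\<Sum>i<length P. gain (set (take i P)) (P ! i))"

definition valid :: "'a list \<Rightarrow> bool" where
  "valid P \<longleftrightarrow> (\<forall>i<length P. free (set (take i P)) (P ! i))"

lemma cost_Nil [simp]: "cost [] = 0" and valid_Nil [simp]: "valid []"
  by (auto simp: cost_def valid_def)

lemma cost_snoc [simp]: "cost (P @ [c]) = cost P + gain (set P) c"
  by (simp add: cost_def nth_append)

lemma valid_snoc [simp]: "valid (P @ [c]) \<longleftrightarrow> valid P \<and> free (set P) c"
  by (auto simp: valid_def nth_append less_Suc_eq)

lemma valid_distinct: "valid P \<Longrightarrow> distinct P \<and> set P \<subseteq> C"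
  by (induction P rule: rev_induct) (auto simp: free_def)

text \<open>The incremental definition suits the search. This form, in which all candidates outside
  \<open>P\<close> count as coming after \<open>P\<close>, suits the comparison with the score and
  with the inversions of the votes.\<close>

lemma cost_eq:
  "distinct P \<Longrightarrow> set P \<subseteq> C \<Longrightarrow>
    cost P = (\<Sum>x\<in>set P. \<Sum>y\<in>{y\<in>C. y \<noteq> x \<and> \<not> before P y x}. pref y x)"
proof (induction P rule: rev_induct)
  case (snoc c P)
  have "(\<Sum>x\<in>set (P @ [c]). \<Sum>y\<in>{y\<in>C. y \<noteq> x \<and> \<not> before (P @ [c]) y x}. pref y x) =
    (\<Sum>y\<in>{y\<in>C. y \<noteq> c \<and> \<not> before (P @ [c]) y c}. pref y c) +
    (\<Sum>x\<in>set P. \<Sum>y\<in>{y\<in>C. y \<noteq> x \<and> \<not> before (P @ [c]) y x}. pref y x)"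
    using snoc.prems by simp
  also have "{y\<in>C. y \<noteq> c \<and> \<not> before (P @ [c]) y c} = C - set P - {c}"
    using snoc.prems by (auto dest: before_in_set)
  also have "(\<Sum>x\<in>set P. \<Sum>y\<in>{y\<in>C. y \<noteq> x \<and> \<not> before (P @ [c]) y x}. pref y x) = cost P"
    using snoc by (auto intro!: sum.cong)
  finally show ?case by (simp add: gain_def)
qed simp

lemma valid_iff:
  "distinct P \<Longrightarrow> set P \<subseteq> C \<Longrightarrow>
    valid P \<longleftrightarrow> (\<forall>x\<in>set P. \<forall>y\<in>C. y \<noteq> x \<longrightarrow> \<not> before P y x \<longrightarrow> pref y x < size V)"
proof (induction P rule: rev_induct)
  case (snoc c P)
  then show ?case by (auto simp: free_def dest: before_in_set)
qed simp

lemma pref_unanimous: "pref y x < size V \<longleftrightarrow> (\<exists>v\<in>#V. \<not> before v y x)"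
proof -
  have "size {#v \<in># W. P v#} < size W \<longleftrightarrow> (\<exists>v\<in>#W. \<not> P v)" for W :: "'a list multiset" and P
  proof (induction W)
    case (add v W)
    then show ?case by (auto simp: less_Suc_eq_le)
  qed simp
  then show ?thesis unfolding pref_def .
qed

lemma valid_ranking_iff:
  assumes "Q \<in> permutations_of_set C"
  shows "valid Q \<longleftrightarrow> respects_unanimity V Q"
proof -
  have Q: "distinct Q" "set Q = C" using assms by (auto simp: permutations_of_set_def)
  obtain v where v: "v \<in># V" using V_ne by blast
  \<comment> \<open>Without any vote every pair would be unanimous; this is what the vote
    \<open>v\<close> is for.\<close>
  have mem: "x \<in> C \<and> y \<in> C \<and> x \<noteq> y" if "\<forall>v\<in>#V. before v x y" for x y
    using that v voteD[OF v] by (metis before_in_set before_irrefl)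
  show ?thesis
    unfolding valid_iff[OF Q(1) eq_refl[OF Q(2)]] pref_unanimous respects_unanimity_def
    using mem Q by metis
qed

text \<open>The index set no longer depends on the vote, so that summing over the votes can be
  exchanged with summing over the pairs.\<close>

lemma d_KT_eq_sum:
  assumes "set Q \<subseteq> C"
  shows "d_KT Q v = (\<Sum>(x, y)\<in>C \<times> C. of_bool (before Q x y \<and> before v y x))"
proof -
  have "(\<Sum>(x, y)\<in>C \<times> C. of_bool (before Q x y \<and> before v y x)) =
    (\<Sum>p\<in>C \<times> C. of_bool (p \<in> {(x, y). before Q x y \<and> before v y x}))"
    by (intro sum.cong) auto
  also have "\<dots> = card (C \<times> C \<inter> {(x, y). before Q x y \<and> before v y x})"
    using finite_C by (simp add: sum_of_bool_eq)
  also have "C \<times> C \<inter> {(x, y). before Q x y \<and> before v y x} = {(x, y). before Q x y \<and> before v y x}"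
    using assms by (auto dest: before_in_set)
  finally show ?thesis unfolding d_KT_def by simp
qed

lemma kemeny_score_eq_sum:
  assumes "set Q \<subseteq> C"
  shows "kemeny_score W Q =
    (\<Sum>(x, y)\<in>C \<times> C. of_bool (before Q x y) * size {#v \<in># W. before v y x#})"
proof (induction W)
  case (add v W)
  have "kemeny_score (add_mset v W) Q = d_KT Q v + kemeny_score W Q"
    by (simp add: kemeny_score_def)
  also have "\<dots> = (\<Sum>(x, y)\<in>C \<times> C. of_bool (before Q x y \<and> before v y x) +
      of_bool (before Q x y) * size {#v \<in># W. before v y x#})"
    unfolding add d_KT_eq_sum[OF assms] by (simp add: sum.distrib[symmetric] split_def)
  also have "\<dots> = (\<Sum>(x, y)\<in>C \<times> C. of_bool (before Q x y) * size {#v \<in># add_mset v W. before v y x#})"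
    by (intro sum.cong) auto
  finally show ?case .
qed (simp add: kemeny_score_def)

lemma cost_ranking:
  assumes "Q \<in> permutations_of_set C"
  shows "cost Q = kemeny_score V Q"
proof -
  have Q: "distinct Q" "set Q = C" using assms by (auto simp: permutations_of_set_def)
  have "cost Q = (\<Sum>x\<in>C. \<Sum>y\<in>{y\<in>C. y \<noteq> x \<and> \<not> before Q y x}. pref y x)"
    using cost_eq[of Q] Q by simp
  also have "\<dots> = (\<Sum>x\<in>C. \<Sum>y\<in>C. of_bool (before Q x y) * pref y x)"
  proof (rule sum.cong[OF refl])
    fix x assume "x \<in> C"
    then have "{y\<in>C. y \<noteq> x \<and> \<not> before Q y x} = {y\<in>C. before Q x y}"
      using Q before_total[of x Q] before_asym[of Q] before_irrefl[of Q] by blast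
    then have "(\<Sum>y\<in>{y\<in>C. y \<noteq> x \<and> \<not> before Q y x}. pref y x) =
        (\<Sum>y\<in>C. if before Q x y then pref y x else 0)"
      using finite_C by (simp only: sum.inter_filter)
    then show "(\<Sum>y\<in>{y\<in>C. y \<noteq> x \<and> \<not> before Q y x}. pref y x) =
        (\<Sum>y\<in>C. of_bool (before Q x y) * pref y x)"
      by (simp only:) (auto intro!: sum.cong)
  qed
  finally show ?thesis
    using Q by (simp add: kemeny_score_eq_sum pref_def sum.cartesian_product)
qed

lemma kemeny_score_ge: "Q \<in> permutations_of_set C \<Longrightarrow> k_OPT C V \<le> kemeny_score V Q"
  unfolding k_OPT_def by (rule Min_le) auto

lemma ex_optimal_valid: "\<exists>Q\<in>permutations_of_set C. valid Q \<and> cost Q = k_OPT C V"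
proof -
  have "k_OPT C V \<in> kemeny_score V ` permutations_of_set C"
    unfolding k_OPT_def using finite_C by (intro Min_in) auto
  then obtain Q where Q: "Q \<in> permutations_of_set C" "k_OPT C V = kemeny_score V Q" by auto
  have dQ: "distinct Q" "set Q = C" using Q by (auto simp: permutations_of_set_def)
  have "respects_unanimity V Q"
    unfolding respects_unanimity_def
  proof (intro allI impI, rule ccontr)
    fix x y assume xy: "\<forall>v\<in>#V. before v x y" and "\<not> before Q x y"
    obtain v where v: "v \<in># V" using V_ne by blast
    have "x \<in> C" "y \<in> C" "x \<noteq> y"
      using xy v voteD[OF v] by (metis before_in_set before_irrefl)+
    then have "before Q y x" using \<open>\<not> before Q x y\<close> dQ before_total by metis
    then obtain i j where ij: "i < j" "j < length Q" "Q ! i = y" "Q ! j = x"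
      by (auto simp: before_def)
    define xs B ys where "xs = take i Q" and "B = take (j - Suc i) (drop (Suc i) Q)"
      and "ys = drop (Suc j) Q"
    have "Q = xs @ y # drop (Suc i) Q"
      unfolding xs_def using ij by (metis id_take_nth_drop less_trans)
    moreover have "drop (Suc i) Q = B @ x # ys"
      using id_take_nth_drop[of "j - Suc i" "drop (Suc i) Q"] ij unfolding B_def ys_def by simp
    ultimately have Qs: "Q = xs @ [y] @ B @ [x] @ ys" by simp
    define Q' where "Q' = xs @ [x] @ B @ [y] @ ys"
    have perm: "Q' \<in> permutations_of_set C"
      using dQ unfolding Qs Q'_def by (auto simp: permutations_of_set_def)
    have less: "d_KT Q' v < d_KT Q v" if "v \<in># V" for v
      using d_KT_swap_less[of xs y B x ys v] dQ that xy voteD unfolding Qs Q'_def by auto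
    have "kemeny_score V Q' < kemeny_score V Q"
    proof -
      have "d_KT Q' v + kemeny_score (V - {#v#}) Q' < d_KT Q v + kemeny_score (V - {#v#}) Q"
        unfolding kemeny_score_def using v less
        by (intro add_less_le_mono sum_mset_mono) (auto dest: in_diffD less_imp_le)
      moreover have "kemeny_score V R = d_KT R v + kemeny_score (V - {#v#}) R" for R
        unfolding kemeny_score_def using v by (metis image_mset_add_mset insert_DiffM sum_mset.add_mset)
      ultimately show ?thesis by simp
    qed
    then show False using kemeny_score_ge[OF perm] Q by simp
  qed
  then show ?thesis using Q valid_ranking_iff cost_ranking by auto
qed

section \<open>Bounds in terms of the average distance and of cuts\<close>

lemma k_OPT_le_avg: "size V \<ge> 2 \<Longrightarrow> real (k_OPT C V) \<le> avg_KT V * (real (size V) - 1)"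
proof -
  assume n: "size V \<ge> 2"
  have "size V * k_OPT C V = (\<Sum>v\<in>#V. k_OPT C V)" by simp
  also have "\<dots> \<le> (\<Sum>v\<in>#V. kemeny_score V v)"
    using votes by (intro sum_mset_mono kemeny_score_ge) auto
  finally have "real (size V) * real (k_OPT C V) \<le> real (\<Sum>v\<in>#V. \<Sum>w\<in>#V. d_KT v w)"
    unfolding kemeny_score_def by (metis of_nat_le_iff of_nat_mult)
  moreover have "avg_KT V * (real (size V) - 1) = real (\<Sum>v\<in>#V. \<Sum>w\<in>#V. d_KT v w) / real (size V)"
    using n unfolding avg_KT_def by simp
  ultimately show ?thesis using n by (simp only:) (simp add: pos_le_divide_eq mult.commute)
qed

text \<open>A candidate outside \<open>P\<close> precedes no element of \<open>P\<close> in
  \<open>P\<close>, so the sum in \<open>cost_eq\<close> contains every pair that a vote inverts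
  across the cut.\<close>

lemma cut_le_cost:
  assumes "valid P"
  shows "(\<Sum>v\<in>#V. inversions 0 v (set P)) \<le> cost P"
proof -
  have P: "distinct P" "set P \<subseteq> C" using valid_distinct assms by auto
  \<comment> \<open>Restricting the induction to submultisets of \<open>V\<close> preserves the fact
    that all entries are votes.\<close>
  have gen: "(\<Sum>v\<in>#W. inversions 0 v (set P)) =
    (\<Sum>x\<in>set P. \<Sum>y\<in>C - set P. size {#v \<in># W. before v y x#})" if "W \<subseteq># V" for W
    using that
  proof (induction W)
    case (add v W)
    then have v: "distinct v" "set v = C" and W: "W \<subseteq># V"
      using voteD[of v] by (auto dest: mset_subset_eqD subset_mset.order_trans[rotated] mset_subset_eq_insertD)
    have "inversions 0 v (set P) = card {(y, x). before v y x \<and> y \<notin> set P \<and> x \<in> set P}"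
      using inversions_eq[OF v(1)] by simp
    also have "\<dots> = card {(x, y). (x, y) \<in> set P \<times> (C - set P) \<and> before v y x}"
      by (rule bij_betw_same_card[of prod.swap])
        (auto simp: bij_betw_def inj_on_def image_iff v(2)[symmetric] dest: before_in_set)
    also have "{(x, y). (x, y) \<in> set P \<times> (C - set P) \<and> before v y x} =
        (set P \<times> (C - set P)) \<inter> {p. before v (snd p) (fst p)}" by auto
    also have "card \<dots> = (\<Sum>(x, y)\<in>set P \<times> (C - set P). of_bool (before v y x))"
      using finite_C by (simp add: split_def sum_of_bool_eq)
    also have "\<dots> = (\<Sum>x\<in>set P. \<Sum>y\<in>C - set P. of_bool (before v y x))"
      by (simp add: sum.cartesian_product)
    finally show ?case using add.IH[OF W]
      by (simp add: sum.distrib[symmetric]) (auto intro!: sum.cong)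
  qed simp
  have "(\<Sum>v\<in>#V. inversions 0 v (set P)) = (\<Sum>x\<in>set P. \<Sum>y\<in>C - set P. pref y x)"
    using gen[of V] by (simp add: pref_def)
  also have "\<dots> \<le> cost P"
    unfolding cost_eq[OF P] using finite_C
    by (intro sum_mono sum_mono2) (auto dest: before_in_set)
  finally show ?thesis .
qed


lemma card_cheap_sets:
  assumes "\<And>P. P \<in> A \<Longrightarrow> valid P \<and> cost P < size V * Suc D"
  shows "card (set ` A) \<le> size V * (2 * (card C + 1) * 3 ^ D)"
proof -
  let ?F = "\<lambda>v. {S. S \<subseteq> set v \<and> inversions 0 v S \<le> D}"
  have sub: "set ` A \<subseteq> (\<Union>v\<in>set_mset V. ?F v)"
  proof
    fix S assume "S \<in> set ` A"
    then obtain P where P: "P \<in> A" "S = set P" by auto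
    have "\<exists>v\<in>#V. inversions 0 v (set P) \<le> D"
    proof (rule ccontr)
      assume "\<not> ?thesis"
      then have "(\<Sum>v\<in>#V. Suc D) \<le> (\<Sum>v\<in>#V. inversions 0 v (set P))"
        by (intro sum_mset_mono) auto
      then show False using cut_le_cost[of P] assms[OF P(1)] by simp
    qed
    then show "S \<in> (\<Union>v\<in>set_mset V. ?F v)"
      using valid_distinct[of P] assms[OF P(1)] voteD P by auto
  qed
  have "card (set ` A) \<le> card (\<Union>v\<in>set_mset V. ?F v)"
    using sub by (rule card_mono[rotated]) auto
  also have "\<dots> \<le> (\<Sum>v\<in>set_mset V. card (?F v))" by (rule card_UN_le) auto
  also have "\<dots> \<le> (\<Sum>v\<in>set_mset V. 2 * (card C + 1) * 3 ^ D)"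
  proof (rule sum_mono)
    fix v assume "v \<in> set_mset V"
    then have "distinct v" "length v = card C" using voteD distinct_card by metis+
    then show "card (?F v) \<le> 2 * (card C + 1) * 3 ^ D" using card_few_inversions[of v D] by simp
  qed
  also have "\<dots> = card (set_mset V) * (2 * (card C + 1) * 3 ^ D)" by simp
  also have "\<dots> \<le> size V * (2 * (card C + 1) * 3 ^ D)"
  proof (rule mult_right_mono)
    show "card (set_mset V) \<le> size V" by (induction V) (auto simp: card_insert_if)
  qed simp
  finally show ?thesis .
qed

end

section \<open>The search\<close>

locale search = election +
  fixes cs :: "'a list" and r :: nat
  assumes cs: "set cs = C" "distinct cs" and r_pos: "0 < r"
begin

definition saturated :: "'a list list \<Rightarrow> 'a list \<Rightarrow> bool" where
  "saturated E Q \<longleftrightarrow> r \<le> card {P \<in> set E. set P = set Q \<and> cost P \<le> cost Q}"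

definition settled :: "'a list list \<Rightarrow> 'a list \<Rightarrow> bool" where
  "settled E Q \<longleftrightarrow> Q \<in> set E \<or> saturated E Q"

definition extensions :: "'a list list \<Rightarrow> nat \<Rightarrow> nat \<Rightarrow> 'a list set" where
  "extensions E e i = (\<Union>j<e. (\<lambda>c. E ! j @ [c]) ` C) \<union> (\<lambda>c. E ! e @ [c]) ` set (take i cs)"

text \<open>
  The state of the search for prefixes of cost \<open>k\<close>, when the extensions of the first \<open>e\<close> prefixes and
  those of prefix \<open>e\<close> by the first \<open>i\<close> candidates have been tried.
\<close>

definition search_inv :: "'a list list \<Rightarrow> nat \<Rightarrow> nat \<Rightarrow> nat \<Rightarrow> bool" where
  "search_inv E k e i \<longleftrightarrow>
     distinct E \<and> [] \<in> set E \<and> (\<forall>P\<in>set E. valid P \<and> cost P \<le> k) \<and>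
     (\<forall>S. card {P \<in> set E. set P = S} \<le> r) \<and>
     (\<forall>Q\<in>set E. Q = [] \<or> cost Q < k \<or> Q \<in> extensions E e i) \<and>
     (\<forall>Q\<in>extensions E e i. valid Q \<longrightarrow> cost Q \<le> k \<longrightarrow> settled E Q) \<and>
     (\<forall>P\<in>set E. \<forall>c. valid (P @ [c]) \<longrightarrow> cost (P @ [c]) < k \<longrightarrow> settled E (P @ [c]))"

text \<open>Cheaper extensions were dealt with in earlier passes and more expensive ones wait for
  theirs. Thus prefixes of the same set enter in the order of their costs.\<close>

definition try_append :: "'a list list \<Rightarrow> nat \<Rightarrow> 'a list \<Rightarrow> 'a list list" where
  "try_append E k Q =
     (if valid Q \<and> cost Q = k \<and> card {P \<in> set E. set P = set Q} < r then E @ [Q] else E)"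

lemma saturated_mono:
  assumes "saturated E P" "set E \<subseteq> set E'" "set P = set Q" "cost P \<le> cost Q"
  shows "saturated E' Q"
proof -
  have "card {R \<in> set E. set R = set P \<and> cost R \<le> cost P} \<le> card {R \<in> set E'. set R = set Q \<and> cost R \<le> cost Q}"
    using assms by (intro card_mono) auto
  then show ?thesis using assms(1) unfolding saturated_def by simp
qed

lemma settled_mono: "settled E Q \<Longrightarrow> set E \<subseteq> set E' \<Longrightarrow> settled E' Q"
  unfolding settled_def using saturated_mono by blast

text \<open>
  If the prefix of \<open>Q\<close> is missing from \<open>E\<close>, it is outnumbered by \<open>r\<close> prefixes of the same set that are
  no more expensive, and appending the last candidate of \<open>Q\<close> to these costs the same for all of them.
\<close>

lemma all_settled:
  assumes E: "[] \<in> set E" "\<And>P. P \<in> set E \<Longrightarrow> valid P"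
    "\<And>P c. P \<in> set E \<Longrightarrow> valid (P @ [c]) \<Longrightarrow> cost (P @ [c]) < k \<Longrightarrow> settled E (P @ [c])"
  shows "valid Q \<Longrightarrow> cost Q < k \<Longrightarrow> settled E Q"
proof (induction Q rule: rev_induct)
  case Nil
  then show ?case using E(1) by (simp add: settled_def)
next
  case (snoc c P)
  from snoc have "settled E P" by simp
  then consider "P \<in> set E" | "saturated E P" unfolding settled_def by blast
  then show ?case
  proof cases
    case 1
    then show ?thesis using E(3) snoc.prems by blast
  next
    case 2
    let ?A = "{P' \<in> set E. set P' = set P \<and> cost P' \<le> cost P}"
    have A: "settled E (P' @ [c]) \<and> set (P' @ [c]) = set (P @ [c]) \<and> cost (P' @ [c]) \<le> cost (P @ [c])"
      if "P' \<in> ?A" for P'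
      using that snoc.prems E(2) by (auto intro!: E(3))
    \<comment> \<open>If some competitor \<open>P' @ [c]\<close> is saturated, its rivals also
      outnumber \<open>P @ [c]\<close>. Otherwise all competitors have been stored, and being
      distinct they number at least \<open>r\<close>.\<close>
    show ?thesis
    proof (cases "\<exists>P'\<in>?A. saturated E (P' @ [c])")
      case True
      then show ?thesis using A saturated_mono unfolding settled_def by blast
    next
      case False
      have "r \<le> card ?A" using 2 unfolding saturated_def .
      also have "\<dots> = card ((\<lambda>P'. P' @ [c]) ` ?A)" by (simp add: card_image inj_on_def)
      also have "\<dots> \<le> card {R \<in> set E. set R = set (P @ [c]) \<and> cost R \<le> cost (P @ [c])}"
        using A False unfolding settled_def by (intro card_mono) auto
      finally show ?thesis unfolding settled_def saturated_def by blast
    qed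
  qed
qed

lemma search_inv_init: "search_inv [[]] 0 0 0"
proof -
  have "card {P \<in> set [[]]. set P = S} \<le> r" for S :: "'a set"
  proof -
    have "card {P \<in> set [[]]. set P = S} \<le> card {[] :: 'a list}" by (rule card_mono) auto
    then show ?thesis using r_pos by simp
  qed
  then show ?thesis unfolding search_inv_def by (simp add: extensions_def)
qed

lemma extensions_append: "e < length E \<Longrightarrow> extensions (E @ F) e i = extensions E e i"
  unfolding extensions_def
  by (intro arg_cong2[where f = "(\<union>)"] SUP_cong image_cong) (auto simp: nth_append)

lemma extensions_Suc:
  "i < length cs \<Longrightarrow> extensions E e (Suc i) = insert (E ! e @ [cs ! i]) (extensions E e i)"
  unfolding extensions_def by (auto simp: take_Suc_conv_app_nth)

lemma extensions_next: "extensions E (Suc e) 0 = extensions E e (length cs)"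
  unfolding extensions_def by (simp add: cs lessThan_Suc Un_commute)

text \<open>Stored prefixes of cost \<open>k\<close> other than \<open>[]\<close> are extensions
  tried in the current pass. Hence no new one can be a duplicate, and the program never compares
  prefixes as lists.\<close>

lemma extension_fresh:
  assumes "distinct E" "e < length E" "i < length cs"
  shows "E ! e @ [cs ! i] \<notin> extensions E e i"
  using assms cs(2) unfolding extensions_def
  by (auto simp: nth_eq_iff_index_eq in_set_conv_nth)

lemma search_inv_next: "search_inv E k e (length cs) \<Longrightarrow> search_inv E k (Suc e) 0"
  unfolding search_inv_def extensions_next .

text \<open>The scan has reached the end of a list that grew meanwhile, so the extensions of
  prefixes found in this very pass are settled up to cost \<open>k\<close>, too.\<close>

lemma search_inv_pass:
  assumes "search_inv E k (length E) 0"
  shows "search_inv E (Suc k) 0 0"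
proof -
  have "P @ [c] \<in> extensions E (length E) 0" if "P \<in> set E" "valid (P @ [c])" for P c
    using that unfolding extensions_def by (auto simp: in_set_conv_nth free_def)
  then have "\<forall>P\<in>set E. \<forall>c. valid (P @ [c]) \<longrightarrow> cost (P @ [c]) < Suc k \<longrightarrow> settled E (P @ [c])"
    using assms unfolding search_inv_def less_Suc_eq_le by blast
  moreover have "extensions E 0 0 = {}" by (simp add: extensions_def)
  moreover have "\<forall>P\<in>set E. P = [] \<or> cost P < Suc k \<or> P \<in> extensions E 0 0"
    "\<forall>P\<in>set E. valid P \<and> cost P \<le> Suc k"
    using assms unfolding search_inv_def by (auto simp: less_Suc_eq_le le_Suc_eq)
  moreover have "distinct E" "[] \<in> set E" "\<forall>S. card {P \<in> set E. set P = S} \<le> r"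
    using assms unfolding search_inv_def by (simp_all only: simp_thms)
  ultimately show ?thesis unfolding search_inv_def by (simp only: ball_empty simp_thms)
qed

lemma search_inv_step:
  assumes inv: "search_inv E k e i" and e: "e < length E" and i: "i < length cs"
  defines "Q \<equiv> E ! e @ [cs ! i]"
  shows "search_inv (try_append E k Q) k e (Suc i)"
proof -
  let ?E = "try_append E k Q"
  have sub: "set E \<subseteq> set ?E" and ext: "extensions ?E e i = extensions E e i"
    using e by (auto simp: try_append_def extensions_append)
  note I = inv[unfolded search_inv_def]
  have Pe: "E ! e \<in> set E" using e by simp
  have QE: "Q \<notin> set E" if "cost Q = k"
    using that I extension_fresh[OF _ e i] unfolding Q_def by auto
  have Q_le: "cost Q \<le> k \<Longrightarrow> valid Q \<Longrightarrow> settled ?E Q"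
  proof -
    assume "cost Q \<le> k" "valid Q"
    then consider "cost Q < k" | "cost Q = k" "card {P \<in> set E. set P = set Q} < r"
      | "cost Q = k" "r \<le> card {P \<in> set E. set P = set Q}" by linarith
    then show ?thesis
    proof cases
      case 1
      then have "settled E Q" using I Pe \<open>valid Q\<close> unfolding Q_def by blast
      then show ?thesis using sub settled_mono by blast
    next
      case 2
      then show ?thesis using \<open>valid Q\<close> by (simp add: try_append_def settled_def)
    next
      case 3
      \<comment> \<open>No stored prefix costs more than \<open>k\<close>, so the cost condition in
        \<open>saturated\<close> is automatic and counting the prefixes with the same set is
        enough.\<close>
      have "{P \<in> set E. set P = set Q} = {P \<in> set E. set P = set Q \<and> cost P \<le> cost Q}"
        using I 3 by auto
      then have "saturated E Q" using 3 unfolding saturated_def by simp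
      then show ?thesis using sub settled_mono unfolding settled_def by blast
    qed
  qed
  \<comment> \<open>A new \<open>Q\<close> has cost \<open>k\<close>, so none of its extensions is
    cheaper than \<open>k\<close>.\<close>
  have Q_ge: "settled ?E (Q @ [c])" if "Q \<in> set ?E - set E" "cost (Q @ [c]) < k" for c
    using that by (auto simp: try_append_def split: if_splits)
  have cnt: "card {P \<in> set ?E. set P = S} \<le> r" for S
  proof (cases "valid Q \<and> cost Q = k \<and> card {P \<in> set E. set P = set Q} < r \<and> set Q = S")
    case True
    then have "{P \<in> set ?E. set P = S} = insert Q {P \<in> set E. set P = S}"
      by (auto simp: try_append_def)
    then show ?thesis using True by (auto simp: card_insert_if)
  next
    case False
    then have "{P \<in> set ?E. set P = S} = {P \<in> set E. set P = S}"
      by (auto simp: try_append_def)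
    then show ?thesis using I by simp
  qed
  have dist: "distinct ?E" using I QE by (auto simp: try_append_def)
  have vc: "\<forall>P\<in>set ?E. valid P \<and> cost P \<le> k" using I by (auto simp: try_append_def)
  have new: "\<forall>R\<in>set ?E. R = [] \<or> cost R < k \<or> R \<in> insert Q (extensions E e i)"
    using I by (auto simp: try_append_def)
  have done1: "\<forall>R\<in>insert Q (extensions E e i). valid R \<longrightarrow> cost R \<le> k \<longrightarrow> settled ?E R"
    using I Q_le sub settled_mono by blast
  have done2: "\<forall>P\<in>set ?E. \<forall>c. valid (P @ [c]) \<longrightarrow> cost (P @ [c]) < k \<longrightarrow> settled ?E (P @ [c])"
  proof (intro ballI allI impI)
    fix P c assume P: "P \<in> set ?E" "valid (P @ [c])" "cost (P @ [c]) < k"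
    show "settled ?E (P @ [c])"
    proof (cases "P \<in> set E")
      case True
      then show ?thesis using I P sub settled_mono by blast
    next
      case False
      then have "P = Q" using P(1) by (auto simp: try_append_def split: if_splits)
      then show ?thesis using P False Q_ge by blast
    qed
  qed
  have "extensions ?E e (Suc i) = insert Q (extensions E e i)"
    using extensions_Suc[OF i, of ?E e] e ext unfolding Q_def
    by (auto simp: try_append_def nth_append)
  moreover have "[] \<in> set ?E" using I sub by blast
  ultimately show ?thesis
    unfolding search_inv_def
    by (simp only:) (intro conjI dist vc new done1 done2 allI cnt TrueI)
qed

lemma length_search_le:
  assumes "search_inv E k e i" "k < size V * Suc D"
  shows "length E \<le> r * (size V * (2 * (card C + 1) * 3 ^ D))"
proof -
  note I = assms(1)[unfolded search_inv_def]
  have "set E = (\<Union>S\<in>set ` set E. {P \<in> set E. set P = S})" by auto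
  then have "card (set E) \<le> (\<Sum>S\<in>set ` set E. card {P \<in> set E. set P = S})"
    using card_UN_le[of "set ` set E" "\<lambda>S. {P \<in> set E. set P = S}"] by simp
  also have "\<dots> \<le> (\<Sum>S\<in>set ` set E. r)" using I by (intro sum_mono) blast
  also have "\<dots> = r * card (set ` set E)" by simp
  also have "\<dots> \<le> r * (size V * (2 * (card C + 1) * 3 ^ D))"
  proof (rule mult_left_mono)
    show "card (set ` set E) \<le> size V * (2 * (card C + 1) * 3 ^ D)"
      using I assms(2) by (intro card_cheap_sets) (auto intro: le_less_trans)
  qed simp
  finally show ?thesis using I by (simp add: distinct_card)
qed

lemma full_iff:
  assumes "valid P"
  shows "length P = card C \<longleftrightarrow> P \<in> permutations_of_set C"
proof -
  have "distinct P" "set P \<subseteq> C" using valid_distinct assms by auto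
  then show ?thesis
    using finite_C card_subset_eq[of C "set P"] distinct_card[of P]
    by (auto simp: permutations_of_set_def)
qed

lemma search_settled:
  assumes "search_inv E k 0 0" "valid Q" "cost Q < k"
  shows "settled E Q"
  using assms all_settled[of E k Q] unfolding search_inv_def by blast

lemma settled_ex: "settled E Q \<Longrightarrow> \<exists>P\<in>set E. set P = set Q"
proof -
  assume "settled E Q"
  moreover have "\<not> saturated E Q" if "\<And>P. P \<in> set E \<Longrightarrow> set P \<noteq> set Q"
  proof -
    have "{P \<in> set E. set P = set Q \<and> cost P \<le> cost Q} = {}" using that by auto
    then show ?thesis unfolding saturated_def using r_pos by (simp only: card.empty)
  qed
  ultimately show ?thesis unfolding settled_def by blast
qed

text \<open>A complete prefix in \<open>E\<close> is a ranking of score at most \<open>k\<close>.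
  Conversely an optimal valid ranking is settled; as \<open>r\<close> is positive, this exhibits
  some stored prefix with the same set, though not necessarily that ranking.\<close>

lemma search_found_iff:
  assumes inv: "search_inv E (Suc k) 0 0"
  shows "(\<exists>P\<in>set E. length P = card C) \<longleftrightarrow> k_OPT C V \<le> k"
proof
  assume "\<exists>P\<in>set E. length P = card C"
  then obtain P where P: "P \<in> set E" "length P = card C" by blast
  then have v: "valid P" and "P = [] \<or> cost P < Suc k"
    using inv unfolding search_inv_def extensions_def by auto
  then have "cost P \<le> k" by auto
  moreover have "P \<in> permutations_of_set C" using full_iff v P by blast
  ultimately show "k_OPT C V \<le> k" using kemeny_score_ge cost_ranking by fastforce
next
  assume "k_OPT C V \<le> k"
  then obtain Q where Q: "Q \<in> permutations_of_set C" "valid Q" "cost Q < Suc k"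
    using ex_optimal_valid by auto
  then obtain P where P: "P \<in> set E" "set P = set Q"
    using settled_ex search_settled[OF inv] by blast
  then have "distinct P" using inv valid_distinct unfolding search_inv_def by blast
  then have "length P = card C" using P Q by (metis distinct_card permutations_of_setD(1))
  then show "\<exists>P\<in>set E. length P = card C" using P by blast
qed

text \<open>By \<open>lo\<close> and \<open>hi\<close>, \<open>k\<close> is the first integer above
  \<open>lam * k_OPT\<close>, so costs below \<open>k\<close> are exactly the admissible
  ones.\<close>

lemma search_correct:
  assumes inv: "search_inv E k 0 0" and lo: "k \<le> Suc (nat \<lfloor>lam * real (k_OPT C V)\<rfloor>)"
    and hi: "lam * real (k_OPT C V) < real k" and lam: "0 \<le> lam"
  shows "correct_output C V lam r (filter (\<lambda>P. length P = card C) E)"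
proof -
  let ?L = "filter (\<lambda>P. length P = card C) E"
  let ?A = "{Q \<in> K C V (lam * real (k_OPT C V)). respects_unanimity V Q}"
  note I = inv[unfolded search_inv_def]
  have le: "real c \<le> lam * real (k_OPT C V)" if "c < k" for c
  proof -
    have "int c \<le> \<lfloor>lam * real (k_OPT C V)\<rfloor>" using that lo lam by (simp add: le_nat_iff[symmetric])
    then show ?thesis by linarith
  qed
  have A: "Q \<in> ?A \<longleftrightarrow> Q \<in> permutations_of_set C \<and> valid Q \<and> cost Q < k" for Q
    using le hi unfolding K_def by (auto simp: valid_ranking_iff cost_ranking)
  have L: "set ?L \<subseteq> ?A"
  proof
    fix P assume "P \<in> set ?L"
    then have P: "P \<in> set E" "length P = card C" by auto
    then have "valid P" "P = [] \<or> cost P < k" using I unfolding extensions_def by auto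
    \<comment> \<open>This covers the empty prefix, which the invariant exempts from
      \<open>cost P < k\<close>.\<close>
    moreover have "0 < k" using hi lam by (metis mult_nonneg_nonneg of_nat_0_le_iff of_nat_0_less_iff order_le_less_trans)
    ultimately show "P \<in> ?A" unfolding A using P full_iff by auto
  qed
  have setL: "set ?L = {P \<in> set E. set P = C}"
  proof -
    have "length P = card C \<longleftrightarrow> set P = C" if "P \<in> set E" for P
      using that I full_iff[of P] valid_distinct[of P] by (auto simp: permutations_of_set_def)
    then show ?thesis by auto
  qed
  have fin: "finite ?A" by (simp add: finite_K)
  have dL: "distinct ?L" using I by simp
  have len: "length ?L = card (set ?L)" using dL by (rule distinct_card[symmetric])
  then have "length ?L \<le> r" using I setL by simp
  moreover have "length ?L \<le> card ?A" using len L card_mono[OF fin] by simp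
  \<comment> \<open>With fewer than \<open>r\<close> complete prefixes no ranking can be saturated,
    so every admissible one has been stored.\<close>
  moreover have "card ?A \<le> length ?L" if "length ?L < r"
  proof -
    have "?A \<subseteq> set ?L"
    proof
      fix Q assume "Q \<in> ?A"
      then have Q: "set Q = C" "settled E Q"
        using search_settled[OF inv] unfolding A by (auto simp: permutations_of_set_def)
      have "card {P \<in> set E. set P = set Q \<and> cost P \<le> cost Q} \<le> card (set ?L)"
        unfolding setL using Q by (intro card_mono) auto
      then have "\<not> saturated E Q" using that len unfolding saturated_def by simp
      then show "Q \<in> set ?L" using Q setL unfolding settled_def by simp
    qed
    then show ?thesis using len card_mono[of "set ?L" ?A] by simp
  qed
  ultimately have "length ?L = min r (card ?A)" by linarith
  then show ?thesis using dL L unfolding correct_output_iff by blast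
qed

end

section \<open>Running times of programs\<close>

text \<open>\<open>Num 1\<close> would otherwise be rewritten to \<open>Num (Suc 0)\<close>, which differs from the program text.\<close>

declare One_nat_def [simp del] Suc_eq_plus1 [symmetric, simp]

text \<open>Total correctness with \<open>T\<close> as an upper bound for the time, so that the
  bounds of branches and loops can be rounded up.\<close>

definition runs :: "com \<Rightarrow> state \<Rightarrow> nat \<Rightarrow> (state \<Rightarrow> bool) \<Rightarrow> bool" where
  "runs c s T R \<longleftrightarrow> (\<exists>t s'. exec c s t s' \<and> t \<le> T \<and> R s')"

text \<open>Tracking whole arrays is precise enough, since every variable of the program is an array
  of its own.\<close>

primrec nat_mods :: "com \<Rightarrow> nat set" where
  "nat_mods Skip = {}"
| "nat_mods (Assign a e f) = {a}"
| "nat_mods (RAssign a e f) = {}"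
| "nat_mods (Seq c d) = nat_mods c \<union> nat_mods d"
| "nat_mods (If b c d) = nat_mods c \<union> nat_mods d"
| "nat_mods (While b c) = nat_mods c"

primrec real_mods :: "com \<Rightarrow> nat set" where
  "real_mods Skip = {}"
| "real_mods (Assign a e f) = {}"
| "real_mods (RAssign a e f) = {a}"
| "real_mods (Seq c d) = real_mods c \<union> real_mods d"
| "real_mods (If b c d) = real_mods c \<union> real_mods d"
| "real_mods (While b c) = real_mods c"

lemma upd_apply [simp]: "upd h a i v b j = (if b = a \<and> j = i then v else h b j)"
  by (simp add: upd_def)

lemma upd_other [simp]: "b \<noteq> a \<Longrightarrow> upd h a i v b = h b"
  by (simp add: upd_def)

lemma upd_same [simp]: "upd h a i v a = (h a)(i := v)"
  by (simp add: upd_def)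

lemma exec_frame:
  "exec c s t s' \<Longrightarrow> (\<forall>a. a \<notin> nat_mods c \<longrightarrow> nats s' a = nats s a) \<and>
     (\<forall>a. a \<notin> real_mods c \<longrightarrow> reals s' a = reals s a)"
  by (induction rule: exec.induct) auto

lemma exec_Skip_iff: "exec Skip s t s' \<longleftrightarrow> t = 1 \<and> s' = s"
  using exec.Skip[of s] by (auto elim: exec_SkipE)

lemma exec_Assign_iff: "exec (Assign a e f) s t s' \<longleftrightarrow> t = acost e + acost f + 1 \<and>
    s' = s\<lparr>nats := upd (nats s) a (aval e s) (aval f s)\<rparr>"
  using exec.Assign[of a e f s] by (auto elim: exec_AssignE)

lemma exec_Seq_iff: "exec (Seq c d) s t s' \<longleftrightarrow>
    (\<exists>s1 t1 t2. t = t1 + t2 \<and> exec c s t1 s1 \<and> exec d s1 t2 s')"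
  by (blast elim: exec_SeqE intro: exec.Seq)

lemma exec_If_iff: "exec (If b c d) s t s' \<longleftrightarrow>
    (\<exists>u. t = bcost b + 1 + u \<and> (if bval b s then exec c s u s' else exec d s u s'))"
proof (cases "bval b s")
  case True
  then show ?thesis using exec.IfTrue[of b s c _ s' d] by (auto elim!: exec_IfE simp: ac_simps)
next
  case False
  then show ?thesis using exec.IfFalse[of b s d _ s' c] by (auto elim!: exec_IfE simp: ac_simps)
qed

lemma runs_Skip [simp]: "runs Skip s T R \<longleftrightarrow> 1 \<le> T \<and> R s"
  unfolding runs_def exec_Skip_iff by auto

lemma runs_Assign [simp]: "runs (Assign a e f) s T R \<longleftrightarrow>
    acost e + acost f + 1 \<le> T \<and> R (s\<lparr>nats := upd (nats s) a (aval e s) (aval f s)\<rparr>)"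
  unfolding runs_def exec_Assign_iff by auto

lemma ex_shift_le: "(\<exists>t (u::nat) s'. t = k + u \<and> P u s' \<and> t \<le> T \<and> R s') \<longleftrightarrow>
    k \<le> T \<and> (\<exists>u s'. P u s' \<and> u \<le> T - k \<and> R s')"
proof
  assume "\<exists>t u s'. t = k + u \<and> P u s' \<and> t \<le> T \<and> R s'"
  then obtain u s' where "P u s'" "k + u \<le> T" "R s'" by blast
  moreover from this have "k \<le> T" "u \<le> T - k" by simp_all
  ultimately show "k \<le> T \<and> (\<exists>u s'. P u s' \<and> u \<le> T - k \<and> R s')" by blast
next
  assume "k \<le> T \<and> (\<exists>u s'. P u s' \<and> u \<le> T - k \<and> R s')"
  then obtain u s' where "P u s'" "u \<le> T - k" "k \<le> T" "R s'" by blast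
  moreover from this have "k + u \<le> T" by simp
  ultimately show "\<exists>t u s'. t = k + u \<and> P u s' \<and> t \<le> T \<and> R s'" by blast
qed

lemma runs_If [simp]: "runs (If b c d) s T R \<longleftrightarrow> bcost b + 1 \<le> T \<and>
    (if bval b s then runs c s (T - (bcost b + 1)) R else runs d s (T - (bcost b + 1)) R)"
proof -
  have "runs (If b c d) s T R \<longleftrightarrow> (\<exists>t u s'. t = bcost b + 1 + u \<and>
      (if bval b s then exec c s u s' else exec d s u s') \<and> t \<le> T \<and> R s')"
    unfolding runs_def exec_If_iff by blast
  also have "\<dots> \<longleftrightarrow> bcost b + 1 \<le> T \<and>
      (\<exists>u s'. (if bval b s then exec c s u s' else exec d s u s') \<and> u \<le> T - (bcost b + 1) \<and> R s')"
    by (rule ex_shift_le)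
  finally show ?thesis unfolding runs_def by auto
qed

lemma runs_Seq_exec: "exec c s u s1 \<Longrightarrow> runs (Seq c d) s T R \<longleftrightarrow> u \<le> T \<and> runs d s1 (T - u) R"
proof -
  assume c: "exec c s u s1"
  have "runs (Seq c d) s T R \<longleftrightarrow> (\<exists>t v s'. t = u + v \<and> exec d s1 v s' \<and> t \<le> T \<and> R s')"
    unfolding runs_def exec_Seq_iff using c by (metis exec_deterministic)
  then show ?thesis unfolding runs_def ex_shift_le .
qed

text \<open>These rules let the simplifier execute straight-line code symbolically, subtracting each
  cost from the time that remains.\<close>

lemmas runs_Seq_basic [simp] =
  runs_Seq_exec[OF exec.Skip] runs_Seq_exec[OF exec.Assign] runs_Seq_exec[OF exec.RAssign]

text \<open>Moves the continuation into both branches, where symbolic execution can go on; the times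
  agree exactly.\<close>

lemma runs_Seq_If [simp]: "runs (Seq (If b c d) e) s T R = runs (If b (Seq c e) (Seq d e)) s T R"
proof -
  have "exec (Seq (If b c d) e) s t s' = exec (If b (Seq c e) (Seq d e)) s t s'" for t s'
  proof -
    have "bcost b + 1 + u + v = bcost b + 1 + (u + v)" for u v by simp
    then show ?thesis
      unfolding exec_Seq_iff exec_If_iff by (cases "bval b s") (simp_all only: if_True if_False, metis+)
  qed
  then show ?thesis unfolding runs_def by simp
qed

lemma runs_mono: "runs c s T' R \<Longrightarrow> T' \<le> T \<Longrightarrow> runs c s T R"
  unfolding runs_def by (meson order_trans)

text \<open>The frame is supplied at every use, so that postconditions need to mention only what
  changes.\<close>

lemma runs_conseq:
  assumes "runs c s T' R'" "T' \<le> T"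
    and "\<And>s'. R' s' \<Longrightarrow> (\<And>a. a \<notin> nat_mods c \<Longrightarrow> nats s' a = nats s a) \<Longrightarrow>
      (\<And>a. a \<notin> real_mods c \<Longrightarrow> reals s' a = reals s a) \<Longrightarrow> R s'"
  shows "runs c s T R"
  using assms exec_frame unfolding runs_def by (meson order_trans)

lemma runs_SeqI:
  assumes "runs c s T' R'" "T' \<le> T"
    and "\<And>s'. R' s' \<Longrightarrow> (\<And>a. a \<notin> nat_mods c \<Longrightarrow> nats s' a = nats s a) \<Longrightarrow>
      (\<And>a. a \<notin> real_mods c \<Longrightarrow> reals s' a = reals s a) \<Longrightarrow> runs d s' (T - T') R"
  shows "runs (Seq c d) s T R"
proof -
  obtain t s1 where 1: "exec c s t s1" "t \<le> T'" "R' s1" using assms(1) unfolding runs_def by blast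
  then have "runs d s1 (T - T') R" using assms(3) exec_frame by blast
  then obtain u s2 where 2: "exec d s1 u s2" "u \<le> T - T'" "R s2" unfolding runs_def by blast
  have "exec (Seq c d) s (t + u) s2" "t + u \<le> T"
    using 1 2 assms(2) by (auto intro: exec.Seq)
  then show ?thesis unfolding runs_def using 2 by blast
qed

lemma runs_While:
  assumes inv: "I s"
    and body: "\<And>s'. I s' \<Longrightarrow> bval b s' \<Longrightarrow> runs c s' T (\<lambda>s''. I s'' \<and> f s'' < (f s' :: nat))"
    and post: "\<And>s'. I s' \<Longrightarrow> \<not> bval b s' \<Longrightarrow> R s'"
    and time: "f s * (T + bcost b + 1) + bcost b + 1 \<le> T'"
  shows "runs (While b c) s T' R"
proof -
  have "\<exists>t s'. exec (While b c) s t s' \<and> t \<le> f s * (T + bcost b + 1) + bcost b + 1 \<and> R s'"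
    using inv
  proof (induction "f s" arbitrary: s rule: less_induct)
    case less
    show ?case
    proof (cases "bval b s")
      case False
      then have "exec (While b c) s (bcost b + 1) s" by (rule exec.WhileFalse)
      moreover have "bcost b + 1 \<le> f s * (T + bcost b + 1) + bcost b + 1" by simp
      ultimately show ?thesis using post[OF less.prems False] by blast
    next
      case True
      obtain t s1 where 1: "exec c s t s1" "t \<le> T" "I s1" "f s1 < f s"
        using body[OF less.prems True] unfolding runs_def by blast
      then obtain u s2 where 2: "exec (While b c) s1 u s2"
          "u \<le> f s1 * (T + bcost b + 1) + bcost b + 1" "R s2"
        using less.hyps by blast
      have "exec (While b c) s (bcost b + t + u + 1) s2"
        using True 1 2 by (blast intro: exec.WhileTrue)
      moreover have "bcost b + t + u + 1 \<le> f s * (T + bcost b + 1) + bcost b + 1"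
      proof -
        have "Suc (f s1) * (T + bcost b + 1) \<le> f s * (T + bcost b + 1)"
          using 1 by (intro mult_right_mono) auto
        then show ?thesis using 1 2 by simp
      qed
      ultimately show ?thesis using 2 by blast
    qed
  qed
  then show ?thesis unfolding runs_def using time by (meson order_trans)
qed

abbreviation var :: "nat \<Rightarrow> aexp" where
  "var x \<equiv> Cell x (Num 0)"

abbreviation set_var :: "nat \<Rightarrow> aexp \<Rightarrow> com" where
  "set_var x e \<equiv> Assign x (Num 0) e"

definition For :: "nat \<Rightarrow> aexp \<Rightarrow> com \<Rightarrow> com" where
  "For x e c = Seq (set_var x (Num 0))
     (While (Less (var x) e) (Seq c (set_var x (Plus (var x) (Num 1)))))"

lemma mods_For [simp]: "nat_mods (For x e c) = insert x (nat_mods c)" "real_mods (For x e c) = real_mods c"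
  by (auto simp: For_def)

text \<open>The invariant receives the counter as an argument and must not read it from memory,
  hence \<open>I_x\<close>. A round costs 6 for the increment, \<open>acost e + 3\<close> for the
  test and 1 for the loop, besides \<open>T\<close>; the remaining \<open>acost e + 7\<close> pays
  for the initial assignment and the failing test.\<close>

lemma runs_For:
  fixes s :: state
  assumes x: "x \<notin> nat_mods c"
    and lim: "\<And>s' :: state. (\<And>a. a \<notin> insert x (nat_mods c) \<Longrightarrow> nats s' a = nats s a) \<Longrightarrow> aval e s' = n"
    and init: "I 0 (nats s)"
    and I_x: "\<And>i h v. I i (upd h x 0 v) = I i h"
    and body: "\<And>i s'. i < n \<Longrightarrow> nats s' x 0 = i \<Longrightarrow> I i (nats s') \<Longrightarrow>
      (\<And>a. a \<notin> insert x (nat_mods c) \<Longrightarrow> nats s' a = nats s a) \<Longrightarrow>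
      runs c s' T (\<lambda>s''. I (Suc i) (nats s''))"
    and post: "\<And>s'. I n (nats s') \<Longrightarrow> R s'"
    and time: "n * (T + acost e + 10) + acost e + 7 \<le> T'"
  shows "runs (For x e c) s T' R"
proof -
  let ?J = "\<lambda>s'. nats s' x 0 \<le> n \<and> I (nats s' x 0) (nats s') \<and>
    (\<forall>a. a \<notin> insert x (nat_mods c) \<longrightarrow> nats s' a = nats s a)"
  let ?s = "s\<lparr>nats := upd (nats s) x 0 0\<rparr>"
  let ?b = "Less (var x) e"
  have T': "acost (Num 0) + acost (Num 0) + 1 \<le> T'" using time by simp
  have "runs (While ?b (Seq c (set_var x (Plus (var x) (Num 1))))) ?s (T' - 3) R"
  proof (rule runs_While[where I = ?J and f = "\<lambda>s'. n - nats s' x 0" and T = "T + 6"])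
    show "?J ?s" using init I_x by auto
  next
    fix s' assume J: "?J s'" and b: "bval ?b s'"
    have less: "nats s' x 0 < n" using b lim[of s'] J by auto
    show "runs (Seq c (set_var x (Plus (var x) (Num 1)))) s' (T + 6)
        (\<lambda>s''. ?J s'' \<and> n - nats s'' x 0 < n - nats s' x 0)"
    proof (rule runs_SeqI[where T' = T and R' = "\<lambda>s''. I (Suc (nats s' x 0)) (nats s'')"])
      show "runs c s' T (\<lambda>s''. I (Suc (nats s' x 0)) (nats s''))"
        using body[OF less refl] J by blast
    next
      fix s'' :: state assume "I (Suc (nats s' x 0)) (nats s'')"
        "\<And>a. a \<notin> nat_mods c \<Longrightarrow> nats s'' a = nats s' a"
      then show "runs (set_var x (Plus (var x) (Num 1))) s'' (T + 6 - T)
          (\<lambda>s''. ?J s'' \<and> n - nats s'' x 0 < n - nats s' x 0)"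
        using less J x I_x by (auto simp: Suc_eq_plus1[symmetric])
    qed simp
  next
    fix s' assume J: "?J s'" and b: "\<not> bval ?b s'"
    have "nats s' x 0 = n" using b lim[of s'] J by auto
    then show "R s'" using J post by auto
  next
    show "(n - nats ?s x 0) * (T + 6 + bcost ?b + 1) + bcost ?b + 1 \<le> T' - 3"
      using time by (simp add: algebra_simps)
  qed
  then show ?thesis unfolding For_def using T' by simp
qed

text \<open>For matrices stored row by row: a write to one entry leaves all others intact.\<close>

lemma index_eq_iff:
  fixes c c' :: nat
  assumes "c < m" "c' < m"
  shows "y * m + c = y' * m + c' \<longleftrightarrow> y = y' \<and> c = c'"
proof
  assume *: "y * m + c = y' * m + c'"
  have "(y * m + c) div m = y" "(y' * m + c') div m = y'" using assms by auto
  then have "y = y'" using * by simp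
  then show "y = y' \<and> c = c'" using * by simp
qed simp

section \<open>The program\<close>

text \<open>
  For \<open>m\<close> candidates, entry \<open>y * m + c\<close> of array 2 is the number of votes that place candidate \<open>y\<close> before
  candidate \<open>c\<close>, array 3 holds the multiples of \<open>m\<close> (the machine cannot multiply), array 4 the powers of
  two and array 5 the positions in the current vote.  The prefixes found so far are stored in arrays 6
  (cost), 7 (length), 8 (code of the set) and 9, whose entry \<open>e * m + i\<close> is the position, counted from 1,
  of candidate \<open>i\<close> in prefix \<open>e\<close>, or 0.  The other arrays are used as variables: 10 is \<open>r\<close>, 11 the number of
  prefixes, 12 the cost \<open>k\<close> searched for, 13 tells whether a prefix is complete, 14 and 15 are the prefix
  and the candidate to be appended, 17 and 18 the resulting cost and whether the unanimity order is
  violated, 19 is a counter, 16, 20 and 21 are loop variables.  Real array 1 holds \<open>lam * min k k_OPT\<close>.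
\<close>

abbreviation "num_cands \<equiv> Cell 0 (Num 0)"
abbreviation "num_votes \<equiv> Cell 0 (Num 1)"
abbreviation "cand i \<equiv> Cell 0 (Plus (Num 2) i)"
abbreviation "votes_at i \<equiv> Cell 0 (Plus (Plus (Num 2) num_cands) i)"
abbreviation "addr i j \<equiv> Plus (Cell 3 i) j"

section \<open>Preprocessing of the input\<close>

definition make_tables :: com where
  "make_tables = Seq (set_var 4 (Num 1)) (For 16 (Plus num_cands num_votes)
     (Seq (Assign 3 (Plus (var 16) (Num 1)) (Plus (Cell 3 (var 16)) num_cands))
          (Assign 4 (Plus (var 16) (Num 1)) (Plus (Cell 4 (var 16)) (Cell 4 (var 16))))))"

text \<open>Array 5 is indexed by the candidates themselves and is never cleared: each vote
  overwrites all entries that are read.\<close>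

definition read_vote :: com where
  "read_vote = For 16 num_cands (Assign 5 (votes_at (addr (var 21) (var 16))) (var 16))"

definition count_row :: com where
  "count_row = For 15 num_cands
     (If (Less (Cell 5 (cand (var 16))) (Cell 5 (cand (var 15))))
        (Assign 2 (addr (var 16) (var 15)) (Plus (Cell 2 (addr (var 16) (var 15))) (Num 1))) Skip)"

definition count_vote :: com where
  "count_vote = For 16 num_cands count_row"

definition count_votes :: com where
  "count_votes = For 21 num_votes (Seq read_vote count_vote)"

text \<open>The ones that encode \<open>r\<close> end at the first cell behind the input, which
  holds 0.\<close>

definition count_r :: com where
  "count_r = While (Less (Num 0) (votes_at (addr num_votes (var 10)))) (set_var 10 (Plus (var 10) (Num 1)))"

lemma mods_pre [simp]:
  "nat_mods count_row = {2, 15}" "real_mods count_row = {}"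
  "nat_mods make_tables = {3, 4, 16}" "real_mods make_tables = {}"
  "nat_mods read_vote = {5, 16}" "real_mods read_vote = {}"
  "nat_mods count_vote = {2, 15, 16}" "real_mods count_vote = {}"
  "nat_mods count_votes = {2, 5, 15, 16, 21}" "real_mods count_votes = {}"
  "nat_mods count_r = {10}" "real_mods count_r = {}"
  by (auto simp: make_tables_def read_vote_def count_row_def count_vote_def count_votes_def count_r_def)

text \<open>Multiples up to \<open>m\<close> address the rows of array 2; those up to
  \<open>n\<close> address the votes and the unary \<open>r\<close> behind them.\<close>

lemma runs_make_tables:
  assumes "nats s 0 0 = m" "nats s 0 1 = n" "nats s 3 0 = 0"
  shows "runs make_tables s (50 * (m + n) + 20) (\<lambda>s'. \<forall>i \<le> m + n. nats s' 3 i = i * m \<and> nats s' 4 i = 2 ^ i)"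
  unfolding make_tables_def
proof (simp, rule runs_For[where I = "\<lambda>i h. \<forall>j\<le>i. h 3 j = j * m \<and> h 4 j = 2 ^ j" and n = "m + n" and T = 30])
qed (use assms in \<open>auto simp: le_Suc_eq\<close>)

lemma runs_read_vote:
  assumes "nats s 0 0 = m" "nats s 3 (nats s 21 0) = b"
    and "\<And>a. a < m \<Longrightarrow> nats s 0 (2 + m + (b + a)) = v ! a" and "distinct v" "length v = m"
  shows "runs read_vote s (30 * m + 20) (\<lambda>s'. \<forall>a<m. nats s' 5 (v ! a) = a)"
  unfolding read_vote_def
proof (rule runs_For[where I = "\<lambda>i h. \<forall>a<i. h 5 (v ! a) = a" and n = m and T = 18])
qed (use assms in \<open>auto simp: less_Suc_eq nth_eq_iff_index_eq\<close>)

lemma runs_count_row: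
  assumes "nats s 0 0 = m" "\<And>i. i < m \<Longrightarrow> nats s 3 i = i * m" "\<And>i. i < m \<Longrightarrow> nats s 0 (2 + i) = cs ! i"
    and "nats s 16 0 = i" "i < m"
  shows "runs count_row s (45 * m + 9) (\<lambda>s'. \<forall>y<m. \<forall>c<m. nats s' 2 (y * m + c) =
    nats s 2 (y * m + c) + of_bool (y = i \<and> nats s 5 (cs ! y) < nats s 5 (cs ! c)))"
  unfolding count_row_def
proof (rule runs_For[where n = m and T = 33 and I = "\<lambda>j h. \<forall>y<m. \<forall>c<m. h 2 (y * m + c) =
      nats s 2 (y * m + c) + of_bool (y = i \<and> c < j \<and> nats s 5 (cs ! y) < nats s 5 (cs ! c))"])
qed (use assms in \<open>auto simp: index_eq_iff less_Suc_eq\<close>)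

lemma runs_count_vote:
  assumes "nats s 0 0 = m" "\<And>i. i < m \<Longrightarrow> nats s 3 i = i * m" "\<And>i. i < m \<Longrightarrow> nats s 0 (2 + i) = cs ! i"
  shows "runs count_vote s (60 * (m + 1) * (m + 1)) (\<lambda>s'. \<forall>y<m. \<forall>c<m.
    nats s' 2 (y * m + c) = nats s 2 (y * m + c) + of_bool (nats s 5 (cs ! y) < nats s 5 (cs ! c)))"
  unfolding count_vote_def
proof (rule runs_For[where n = m and T = "45 * m + 9" and I = "\<lambda>i h. \<forall>y<m. \<forall>c<m.
    h 2 (y * m + c) = nats s 2 (y * m + c) + of_bool (y < i \<and> nats s 5 (cs ! y) < nats s 5 (cs ! c))"])
  fix i and s' :: state
  assume "i < m" "nats s' 16 0 = i" and I: "\<forall>y<m. \<forall>c<m.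
    nats s' 2 (y * m + c) = nats s 2 (y * m + c) + of_bool (y < i \<and> nats s 5 (cs ! y) < nats s 5 (cs ! c))"
    and fr: "\<And>a. a \<notin> insert 16 (nat_mods count_row) \<Longrightarrow> nats s' a = nats s a"
  then show "runs count_row s' (45 * m + 9) (\<lambda>s'. \<forall>y<m. \<forall>c<m. nats s' 2 (y * m + c) =
       nats s 2 (y * m + c) + of_bool (y < Suc i \<and> nats s 5 (cs ! y) < nats s 5 (cs ! c)))"
    using assms by (intro runs_conseq[OF runs_count_row[of s' m cs i]]) (auto simp: less_Suc_eq)
qed (use assms in \<open>auto simp: algebra_simps\<close>)

lemma runs_count_votes:
  assumes s: "nats s 0 0 = m" "nats s 0 1 = n" "\<And>i. i \<le> m + n \<Longrightarrow> nats s 3 i = i * m"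
    "\<And>i. i < m \<Longrightarrow> nats s 0 (2 + i) = cs ! i"
    "\<And>j a. j < n \<Longrightarrow> a < m \<Longrightarrow> nats s 0 (2 + m + (j * m + a)) = vs ! j ! a"
    "\<And>p. nats s 2 p = 0"
    and vs: "length vs = n" "length cs = m" "\<And>v. v \<in> set vs \<Longrightarrow> distinct v \<and> set v = set cs" "distinct cs"
  shows "runs count_votes s (200 * (m + 1) * (m + 1) * (n + 1))
    (\<lambda>s'. \<forall>y<m. \<forall>c<m. nats s' 2 (y * m + c) = length (filter (\<lambda>v. before v (cs ! y) (cs ! c)) vs))"
  unfolding count_votes_def
proof (rule runs_For[where n = n and T = "110 * (m + 1) * (m + 1)" and I = "\<lambda>j h. \<forall>y<m. \<forall>c<m.
    h 2 (y * m + c) = length (filter (\<lambda>v. before v (cs ! y) (cs ! c)) (take j vs))"])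
  fix j and s' :: state
  assume j: "j < n" "nats s' 21 0 = j" and I: "\<forall>y<m. \<forall>c<m. nats s' 2 (y * m + c) =
      length (filter (\<lambda>v. before v (cs ! y) (cs ! c)) (take j vs))"
    and fr: "\<And>a. a \<notin> insert 21 (nat_mods (Seq read_vote count_vote)) \<Longrightarrow> nats s' a = nats s a"
  have "vs ! j \<in> set vs" using vs(1) j by simp
  then have v: "distinct (vs ! j)" "set (vs ! j) = set cs" using vs(3) by auto
  have len: "length (vs ! j) = m" using distinct_card[OF v(1)] distinct_card[OF vs(4)] v(2) vs(2) by simp
  \<comment> \<open>Such an \<open>h\<close> is the inverse of the vote as a list and turns
    \<open>before\<close> into a comparison of numbers.\<close>
  have pos: "before (vs ! j) (cs ! y) (cs ! c) \<longleftrightarrow> h (cs ! y) < h (cs ! c)"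
    if h: "\<forall>a<m. h (vs ! j ! a) = a" and "y < m" "c < m" for h :: "nat \<Rightarrow> nat" and y c
  proof -
    have "cs ! y \<in> set (vs ! j)" "cs ! c \<in> set (vs ! j)" using v(2) vs(2) that by auto
    then obtain a b where ab: "a < m" "b < m" "vs ! j ! a = cs ! y" "vs ! j ! b = cs ! c"
      unfolding in_set_conv_nth len by blast
    have "h (cs ! y) = a" "h (cs ! c) = b" using h ab by auto
    moreover have "vs ! j ! i = cs ! y \<longleftrightarrow> i = a" "vs ! j ! i = cs ! c \<longleftrightarrow> i = b" if "i < m" for i
      using ab that v(1) len unfolding ab(3,4)[symmetric] by (simp_all add: nth_eq_iff_index_eq)
    ultimately show ?thesis unfolding before_def len using ab
      by (metis order.strict_trans)
  qed
  have rv: "runs read_vote s' (30 * m + 20) (\<lambda>s''. \<forall>a<m. nats s'' 5 (vs ! j ! a) = a)"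
    by (rule runs_read_vote[where b = "j * m"]) (use s v len j fr in simp_all)
  show "runs (Seq read_vote count_vote) s' (110 * (m + 1) * (m + 1)) (\<lambda>s''. \<forall>y<m. \<forall>c<m. nats s'' 2 (y * m + c) =
      length (filter (\<lambda>v. before v (cs ! y) (cs ! c)) (take (Suc j) vs)))"
  proof (rule runs_SeqI[OF rv])
    fix s1 :: state
    assume s1: "\<forall>a<m. nats s1 5 (vs ! j ! a) = a" "\<And>a. a \<notin> nat_mods read_vote \<Longrightarrow> nats s1 a = nats s' a"
    show "runs count_vote s1 (110 * (m + 1) * (m + 1) - (30 * m + 20)) (\<lambda>s''. \<forall>y<m. \<forall>c<m. nats s'' 2 (y * m + c) =
      length (filter (\<lambda>v. before v (cs ! y) (cs ! c)) (take (Suc j) vs)))"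
    proof (rule runs_conseq[OF runs_count_vote[of s1 m cs]])
      fix s2 :: state
      assume "\<forall>y<m. \<forall>c<m. nats s2 2 (y * m + c) = nats s1 2 (y * m + c) +
        of_bool (nats s1 5 (cs ! y) < nats s1 5 (cs ! c))"
      then show "\<forall>y<m. \<forall>c<m. nats s2 2 (y * m + c) =
        length (filter (\<lambda>v. before v (cs ! y) (cs ! c)) (take (Suc j) vs))"
        using pos[OF s1(1)] s1(2) I j vs(1) by (simp add: take_Suc_conv_app_nth)
    qed (use s s1 fr j in \<open>simp_all add: algebra_simps\<close>)
  qed (simp add: algebra_simps)
qed (use s vs in \<open>simp_all add: algebra_simps\<close>)

lemma runs_count_r:
  assumes "nats s 0 0 = m" "nats s 0 1 = n" "nats s 3 n = b" "nats s 10 0 = 0"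
    and "\<And>i. i < r \<Longrightarrow> nats s 0 (2 + m + (b + i)) = 1" "nats s 0 (2 + m + (b + r)) = 0"
  shows "runs count_r s (30 * r + 20) (\<lambda>s'. nats s' 10 0 = r)"
  unfolding count_r_def
proof -
  let ?I = "\<lambda>s'. nats s' 10 0 \<le> r \<and> (\<forall>a. a \<noteq> 10 \<longrightarrow> nats s' a = nats s a)"
  let ?b = "Less (Num 0) (votes_at (addr num_votes (var 10)))"
  have b: "bval ?b s' \<longleftrightarrow> nats s' 10 0 < r" if "?I s'" for s'
  proof -
    have "nats s' 0 = nats s 0" "nats s' 3 = nats s 3" using that by simp_all
    then show ?thesis using that assms by (cases "nats s' 10 0 = r") simp_all
  qed
  show "runs (While ?b (set_var 10 (Plus (var 10) (Num 1)))) s (30 * r + 20) (\<lambda>s'. nats s' 10 0 = r)"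
  proof (rule runs_While[where I = ?I and f = "\<lambda>s'. r - nats s' 10 0" and T = 6])
    fix s' assume I: "?I s'" and "bval ?b s'"
    then show "runs (set_var 10 (Plus (var 10) (Num 1))) s' 6 (\<lambda>s''. ?I s'' \<and> r - nats s'' 10 0 < r - nats s' 10 0)"
      using b[OF I] by simp
  next
    fix s' assume I: "?I s'" and "\<not> bval ?b s'"
    then show "nats s' 10 0 = r" using b[OF I] by simp
  qed (use assms in simp_all)
qed

section \<open>Appending a candidate to a prefix\<close>

abbreviation "Eq a b \<equiv> BAnd (BNot (Less a b)) (BNot (Less b a))"

definition extend_cost :: com where
  "extend_cost = Seq (set_var 17 (Cell 6 (var 14))) (Seq (set_var 18 (Num 0))
     (For 16 num_cands (If (Less (Num 0) (Cell 9 (addr (var 14) (var 16)))) Skip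
       (Seq (set_var 17 (Plus (var 17) (Cell 2 (addr (var 16) (var 15)))))
         (If (Less (Cell 2 (addr (var 16) (var 15))) num_votes) Skip (set_var 18 (Num 1)))))))"

text \<open>This run over all prefixes, possibly made for extensions of each of them, is what
  squares their number in the time bound.\<close>

definition count_same :: com where
  "count_same = Seq (set_var 19 (Num 0)) (For 20 (var 11)
     (If (Eq (Cell 8 (var 20)) (Plus (Cell 8 (var 14)) (Cell 4 (var 15))))
       (set_var 19 (Plus (var 19) (Num 1))) Skip))"

definition copy_positions :: com where
  "copy_positions = For 16 num_cands
     (Assign 9 (addr (var 11) (var 16)) (Cell 9 (addr (var 14) (var 16))))"

text \<open>The cost is copied from \<open>k\<close>, to which it is equal when this code is
  reached. Array 3 grows along with the list, so that the row of the next prefix can be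
  addressed.\<close>

definition store_extension :: com where
  "store_extension = Seq copy_positions
    (Seq (Assign 9 (addr (var 11) (var 15)) (Plus (Cell 7 (var 14)) (Num 1)))
    (Seq (Assign 7 (var 11) (Plus (Cell 7 (var 14)) (Num 1)))
    (Seq (Assign 6 (var 11) (var 12))
    (Seq (Assign 8 (var 11) (Plus (Cell 8 (var 14)) (Cell 4 (var 15))))
    (Seq (Assign 3 (Plus (var 11) (Num 1)) (Plus (Cell 3 (var 11)) num_cands))
         (set_var 11 (Plus (var 11) (Num 1))))))))"

definition try_cand :: com where
  "try_cand = If (Less (Num 0) (Cell 9 (addr (var 14) (var 15)))) Skip
     (Seq extend_cost (If (BAnd (Eq (var 18) (Num 0)) (Eq (var 17) (var 12)))
       (Seq count_same (If (Less (var 19) (var 10)) store_extension Skip)) Skip))"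

lemma mods_try [simp]:
  "nat_mods extend_cost = {16, 17, 18}" "real_mods extend_cost = {}"
  "nat_mods count_same = {19, 20}" "real_mods count_same = {}"
  "nat_mods copy_positions = {9, 16}" "real_mods copy_positions = {}"
  "nat_mods store_extension = {3, 6, 7, 8, 9, 11, 16}" "real_mods store_extension = {}"
  "nat_mods try_cand = {3, 6, 7, 8, 9, 11, 16, 17, 18, 19, 20}" "real_mods try_cand = {}"
  by (auto simp: extend_cost_def count_same_def copy_positions_def store_extension_def try_cand_def)

lemma runs_extend_cost:
  assumes "nats s 0 0 = m" "nats s 0 1 = n" "nats s 14 0 = e" "nats s 15 0 = c" "nats s 3 e = e * m"
    and "\<And>y. y < m \<Longrightarrow> nats s 3 y = y * m"
  shows "runs extend_cost s (80 * m + 40) (\<lambda>s'.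
    nats s' 17 0 = nats s 6 e + (\<Sum>y<m. if nats s 9 (e * m + y) = 0 then nats s 2 (y * m + c) else 0) \<and>
    (nats s' 18 0 = 0 \<longleftrightarrow> (\<forall>y<m. nats s 9 (e * m + y) = 0 \<longrightarrow> nats s 2 (y * m + c) < n)))"
  unfolding extend_cost_def
proof (simp, rule runs_For[where n = m and T = 60 and I = "\<lambda>i h.
    h 17 0 = nats s 6 e + (\<Sum>y<i. if nats s 9 (e * m + y) = 0 then nats s 2 (y * m + c) else 0) \<and>
    (h 18 0 = 0 \<longleftrightarrow> (\<forall>y<i. nats s 9 (e * m + y) = 0 \<longrightarrow> nats s 2 (y * m + c) < n))"])
qed (use assms in \<open>auto simp: less_Suc_eq\<close>)

lemma card_less_Suc_Collect:
  "card {f. f < Suc i \<and> R f} = card {f. f < i \<and> R f} + of_bool (R i)"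
proof -
  have "{f. f < Suc i \<and> R f} = (if R i then insert i {f. f < i \<and> R f} else {f. f < i \<and> R f})"
    by (auto simp: less_Suc_eq)
  then show ?thesis by simp
qed

lemma runs_count_same:
  assumes "nats s 11 0 = N"
  shows "runs count_same s (50 * N + 30) (\<lambda>s'. nats s' 19 0 =
    card {f. f < N \<and> nats s 8 f = nats s 8 (nats s 14 0) + nats s 4 (nats s 15 0)})"
  unfolding count_same_def
proof (simp, rule runs_For[where n = N and T = 35 and I = "\<lambda>i h. h 19 0 =
    card {f. f < i \<and> nats s 8 f = nats s 8 (nats s 14 0) + nats s 4 (nats s 15 0)}"])
qed (use assms in \<open>auto simp: card_less_Suc_Collect\<close>)

lemma runs_copy_positions:
  assumes "nats s 0 0 = m" "nats s 11 0 = N" "nats s 14 0 = e" "e < N" "nats s 3 e = e * m" "nats s 3 N = N * m"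
  shows "runs copy_positions s (40 * m + 20) (\<lambda>s'. \<forall>f y. y < m \<longrightarrow>
    nats s' 9 (f * m + y) = (if f = N then nats s 9 (e * m + y) else nats s 9 (f * m + y)))"
  unfolding copy_positions_def
proof (rule runs_For[where n = m and T = 20 and I = "\<lambda>i h. \<forall>f y. y < m \<longrightarrow>
    h 9 (f * m + y) = (if f = N \<and> y < i then nats s 9 (e * m + y) else nats s 9 (f * m + y))"])
qed (use assms in \<open>auto simp: index_eq_iff less_Suc_eq\<close>)

lemma runs_store_extension:
  assumes s: "nats s 0 0 = m" "nats s 11 0 = N" "nats s 14 0 = e" "e < N" "nats s 3 e = e * m" "nats s 3 N = N * m"
    "nats s 15 0 = c" "c < m"
  shows "runs store_extension s (40 * m + 120) (\<lambda>s'.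
    (\<forall>f y. y < m \<longrightarrow> nats s' 9 (f * m + y) =
       (if f = N then if y = c then Suc (nats s 7 e) else nats s 9 (e * m + y) else nats s 9 (f * m + y))) \<and>
    nats s' 7 = (nats s 7)(N := Suc (nats s 7 e)) \<and>
    nats s' 6 = (nats s 6)(N := nats s 12 0) \<and>
    nats s' 8 = (nats s 8)(N := nats s 8 e + nats s 4 c) \<and>
    nats s' 3 = (nats s 3)(Suc N := N * m + m) \<and> nats s' 11 0 = Suc N)"
  unfolding store_extension_def
  by (rule runs_SeqI[OF runs_copy_positions[OF s(1-6)]]) (use s in \<open>auto simp: index_eq_iff\<close>)

section \<open>The list of prefixes as represented in memory\<close>

definition position :: "'a list \<Rightarrow> 'a \<Rightarrow> nat" where
  "position P x = (if x \<in> set P then Suc (length (takeWhile ((\<noteq>) x) P)) else 0)"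

lemma position_eq_0_iff: "position P x = 0 \<longleftrightarrow> x \<notin> set P"
  by (simp add: position_def)

lemma position_snoc: "c \<notin> set P \<Longrightarrow> position (P @ [c]) x = (if x = c then Suc (length P) else position P x)"
  by (auto simp: position_def takeWhile_append)

lemma nth_position: "x \<in> set P \<Longrightarrow> \<exists>p. position P x = Suc p \<and> p < length P \<and> P ! p = x"
  by (induction P) (auto simp: position_def)

text \<open>The program counts indices, \<open>search_inv\<close> counts prefixes.\<close>

lemma card_nth_Collect: "distinct E \<Longrightarrow> card {f. f < length E \<and> R (E ! f)} = card {P \<in> set E. R P}"
proof -
  assume "distinct E"
  then have "inj_on ((!) E) {f. f < length E \<and> R (E ! f)}"
    by (auto simp: inj_on_def nth_eq_iff_index_eq)
  moreover have "{P \<in> set E. R P} = (!) E ` {f. f < length E \<and> R (E ! f)}"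
    by (auto simp: in_set_conv_nth)
  ultimately show ?thesis by (simp add: card_image)
qed

locale aggregation = search "set cs" "mset vs" cs r
  for cs :: "nat list" and vs :: "nat list list" and r :: nat
begin

abbreviation "m \<equiv> length cs"
abbreviation "n \<equiv> length vs"

text \<open>A sum of powers of two: appending a candidate is one addition, and equality of sets is
  one comparison of numbers.\<close>

definition code :: "nat list \<Rightarrow> nat" where
  "code P = set_encode {i. i < m \<and> cs ! i \<in> set P}"

lemma code_snoc: "i < m \<Longrightarrow> cs ! i \<notin> set P \<Longrightarrow> code (P @ [cs ! i]) = code P + 2 ^ i"
proof -
  assume i: "i < m" "cs ! i \<notin> set P"
  have "{j. j < m \<and> cs ! j \<in> set (P @ [cs ! i])} = insert i {j. j < m \<and> cs ! j \<in> set P}"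
    using i cs(2) by (auto simp: nth_eq_iff_index_eq)
  then show ?thesis unfolding code_def using i by simp
qed

lemma code_eq_iff:
  assumes "set P \<subseteq> set cs" "set Q \<subseteq> set cs"
  shows "code P = code Q \<longleftrightarrow> set P = set Q"
proof -
  have "set R = (!) cs ` {i. i < m \<and> cs ! i \<in> set R}" if "set R \<subseteq> set cs" for R
  proof (intro equalityI subsetI)
    fix x assume x: "x \<in> set R"
    then have "x \<in> set cs" using that by blast
    then obtain i where "i < m" "cs ! i = x" unfolding in_set_conv_nth by blast
    then show "x \<in> (!) cs ` {i. i < m \<and> cs ! i \<in> set R}" using x by blast
  qed auto
  then have "set P = set Q" if "{i. i < m \<and> cs ! i \<in> set P} = {i. i < m \<and> cs ! i \<in> set Q}"
    using assms that by metis
  then show ?thesis unfolding code_def by (subst set_encode_eq) auto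
qed

text \<open>Allows the program to include the appended candidate itself in the sum for
  \<open>gain\<close> and in the test for \<open>free\<close>, where it should be left out.\<close>

lemma pref_self: "pref x x = 0"
proof -
  have "{#v \<in># mset vs. before v x x#} = {#}"
    using voteD before_irrefl[of _ x] by (intro multiset_eqI) (auto simp: count_eq_zero_iff)
  then show ?thesis unfolding pref_def by simp
qed

lemma gain_eq_sum: "gain S c = (\<Sum>y<m. if cs ! y \<notin> S then pref (cs ! y) c else 0)"
proof -
  have "gain S c = (\<Sum>x\<in>{x \<in> set cs. x \<notin> S}. pref x c)"
    unfolding gain_def by (rule sum.mono_neutral_left) (auto simp: pref_self)
  also have "\<dots> = (\<Sum>x\<in>set cs. if x \<notin> S then pref x c else 0)"
    by (rule sum.inter_filter) simp
  also have "\<dots> = (\<Sum>y<m. if cs ! y \<notin> S then pref (cs ! y) c else 0)"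
    by (rule sum.reindex_bij_betw[symmetric]) (use bij_betw_nth[OF cs(2)] in simp)
  finally show ?thesis .
qed

lemma free_iff: "i < m \<Longrightarrow> cs ! i \<notin> S \<Longrightarrow>
    free S (cs ! i) \<longleftrightarrow> (\<forall>y<m. cs ! y \<notin> S \<longrightarrow> pref (cs ! y) (cs ! i) < n)"
proof -
  have "0 < n" using V_ne by auto
  then have "(\<forall>y<m. cs ! y \<notin> S \<longrightarrow> pref (cs ! y) (cs ! i) < n) \<longleftrightarrow>
      (\<forall>x\<in>set cs. x \<notin> S \<and> x \<noteq> cs ! i \<longrightarrow> pref x (cs ! i) < n)"
    using pref_self by (metis in_set_conv_nth)
  then show "i < m \<Longrightarrow> cs ! i \<notin> S \<Longrightarrow> ?thesis" unfolding free_def by auto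
qed

text \<open>The arrays that the search only reads, as opposed to those in
  \<open>stored\<close>.\<close>

definition tables :: "(nat \<Rightarrow> nat \<Rightarrow> nat) \<Rightarrow> bool" where
  "tables h \<longleftrightarrow> h 0 0 = m \<and> h 0 1 = n \<and> (\<forall>i<m. h 0 (2 + i) = cs ! i) \<and> (\<forall>i<m. h 4 i = 2 ^ i) \<and>
     (\<forall>y<m. \<forall>c<m. h 2 (y * m + c) = pref (cs ! y) (cs ! c)) \<and> h 10 0 = r"

text \<open>The range for array 3 includes \<open>length E\<close>, the row that the next prefix
  will occupy.\<close>

definition stored :: "nat list list \<Rightarrow> (nat \<Rightarrow> nat \<Rightarrow> nat) \<Rightarrow> bool" where
  "stored E h \<longleftrightarrow> h 11 0 = length E \<and>
     (\<forall>f<length E. h 6 f = cost (E ! f) \<and> h 7 f = length (E ! f) \<and> h 8 f = code (E ! f) \<and>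
        (\<forall>i<m. h 9 (f * m + i) = position (E ! f) (cs ! i))) \<and>
     (\<forall>i. i \<le> m + n \<or> i \<le> length E \<longrightarrow> h 3 i = i * m)"

lemma tables_cong: "h 0 = h' 0 \<Longrightarrow> h 2 = h' 2 \<Longrightarrow> h 4 = h' 4 \<Longrightarrow> h 10 = h' 10 \<Longrightarrow> tables h = tables h'"
  unfolding tables_def by simp

lemma stored_cong: "h 3 = h' 3 \<Longrightarrow> h 6 = h' 6 \<Longrightarrow> h 7 = h' 7 \<Longrightarrow> h 8 = h' 8 \<Longrightarrow> h 9 = h' 9 \<Longrightarrow> h 11 = h' 11 \<Longrightarrow>
    stored E h = stored E h'"
  unfolding stored_def by simp

lemma runs_try_cand:
  assumes tab: "tables (nats s)" and st: "stored E (nats s)" and inv: "search_inv E k e i"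
    and e: "e < length E" and i: "i < m"
    and vars: "nats s 14 0 = e" "nats s 15 0 = i" "nats s 12 0 = k"
  shows "runs try_cand s (120 * m + 50 * length E + 300)
    (\<lambda>s'. stored (try_append E k (E ! e @ [cs ! i])) (nats s'))"
proof (cases "cs ! i \<in> set (E ! e)")
  case True
  \<comment> \<open>\<open>free\<close> excludes candidates of the prefix, which matches the early
    exit of the program at a positive position.\<close>
  then have "\<not> valid (E ! e @ [cs ! i])" by (simp add: free_def)
  then have "try_append E k (E ! e @ [cs ! i]) = E" unfolding try_append_def by (simp only: simp_thms if_False)
  moreover have "nats s 9 (nats s 3 e + i) \<noteq> 0"
    using True st e i by (simp add: stored_def position_eq_0_iff)
  ultimately show ?thesis unfolding try_cand_def using vars st by simp
next
  case False
  define P Q where "P = E ! e" and "Q = P @ [cs ! i]"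
  have "P \<in> set E" using e P_def by simp
  then have P: "valid P" "set P \<subseteq> set cs"
    using inv valid_distinct unfolding search_inv_def by blast+
  have cnt: "card {f. f < length E \<and> nats s 8 f = nats s 8 e + nats s 4 i} = card {R \<in> set E. set R = set Q}"
  proof -
    have dE: "distinct E" using inv unfolding search_inv_def by blast
    have "nats s 8 f = nats s 8 e + nats s 4 i \<longleftrightarrow> set (E ! f) = set Q" if "f < length E" for f
    proof -
      have "E ! f \<in> set E" using that by simp
      then have "set (E ! f) \<subseteq> set cs" using inv valid_distinct unfolding search_inv_def by blast
      moreover have "set Q \<subseteq> set cs" using P i by (simp add: Q_def)
      ultimately have "code (E ! f) = code Q \<longleftrightarrow> set (E ! f) = set Q" by (rule code_eq_iff)
      then show ?thesis using that e i False st tab code_snoc[OF i]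
        by (simp add: stored_def tables_def P_def Q_def)
    qed
    then have "{f. f < length E \<and> nats s 8 f = nats s 8 e + nats s 4 i} = {f. f < length E \<and> set (E ! f) = set Q}"
      by blast
    then show ?thesis using card_nth_Collect[OF dE, of "\<lambda>R. set R = set Q"] by simp
  qed
  have free: "free (set P) (cs ! i) \<longleftrightarrow> (\<forall>y<m. nats s 9 (e * m + y) = 0 \<longrightarrow> nats s 2 (y * m + i) < n)"
    using free_iff[OF i, of "set P"] False e i st tab
    by (simp add: P_def stored_def tables_def position_eq_0_iff)
  have cost: "cost Q = nats s 6 e + (\<Sum>y<m. if nats s 9 (e * m + y) = 0 then nats s 2 (y * m + i) else 0)"
  proof -
    have "(\<Sum>y<m. if nats s 9 (e * m + y) = 0 then nats s 2 (y * m + i) else 0) = gain (set P) (cs ! i)"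
      unfolding gain_eq_sum using e i st tab
      by (intro sum.cong) (simp_all add: P_def stored_def tables_def position_eq_0_iff)
    then show ?thesis using st e by (simp add: Q_def P_def stored_def)
  qed
  have Q: "valid Q \<longleftrightarrow> free (set P) (cs ! i)" using P by (simp add: Q_def)
  have tA: "try_append E k Q = (if free (set P) (cs ! i) \<and> cost Q = k \<and>
      card {R \<in> set E. set R = set Q} < r then E @ [Q] else E)"
    unfolding try_append_def Q ..
  have off: "\<And>y. y < m \<Longrightarrow> nats s 3 y = y * m" "nats s 3 e = e * m" "nats s 3 (length E) = length E * m"
    using st e by (simp_all add: stored_def)
  have tb: "nats s 0 0 = m" "nats s 0 1 = n" "nats s 10 0 = r" "nats s 11 0 = length E"
    using st tab by (simp_all add: stored_def tables_def)
  note ec = runs_extend_cost[OF tb(1,2) vars(1,2) off(2,1)]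
  let ?rest = "If (BAnd (Eq (var 18) (Num 0)) (Eq (var 17) (var 12)))
       (Seq count_same (If (Less (var 19) (var 10)) store_extension Skip)) Skip"
  have "runs (Seq extend_cost ?rest) s (120 * m + 50 * length E + 290) (\<lambda>s'. stored (try_append E k Q) (nats s'))"
  proof (rule runs_SeqI[OF ec])
    fix s1 :: state
    assume "nats s1 17 0 = nats s 6 e + (\<Sum>y<m. if nats s 9 (e * m + y) = 0 then nats s 2 (y * m + i) else 0) \<and>
      (nats s1 18 0 = 0 \<longleftrightarrow> (\<forall>y<m. nats s 9 (e * m + y) = 0 \<longrightarrow> nats s 2 (y * m + i) < n))"
    then have s1: "nats s1 17 0 = cost Q" "nats s1 18 0 = 0 \<longleftrightarrow> free (set P) (cs ! i)"
      unfolding cost free by blast+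
    assume "\<And>a. a \<notin> nat_mods extend_cost \<Longrightarrow> nats s1 a = nats s a"
    then have fr1: "nats s1 a = nats s a" if "a \<notin> {16, 17, 18}" for a using that by simp
    have st1: "stored E (nats s1)" using st stored_cong[of "nats s1" "nats s" E] fr1 by simp
    have b: "bval (BAnd (Eq (var 18) (Num 0)) (Eq (var 17) (var 12))) s1 \<longleftrightarrow> free (set P) (cs ! i) \<and> cost Q = k"
      using s1 fr1 vars by auto
    show "runs ?rest s1 (120 * m + 50 * length E + 290 - (80 * m + 40)) (\<lambda>s'. stored (try_append E k Q) (nats s'))"
    proof (cases "free (set P) (cs ! i) \<and> cost Q = k")
      case False
      then have "try_append E k Q = E" using tA by auto
      moreover have "\<not> bval (BAnd (Eq (var 18) (Num 0)) (Eq (var 17) (var 12))) s1"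
        unfolding b by (rule False)
      ultimately show ?thesis using st1 by (simp only: runs_If if_False) simp
    next
      case True
      have cs1: "runs count_same s1 (50 * length E + 30) (\<lambda>s'. nats s' 19 0 = card {R \<in> set E. set R = set Q})"
        using runs_count_same[of s1 "length E"] cnt fr1 tb vars by simp
      have "runs (Seq count_same (If (Less (var 19) (var 10)) store_extension Skip)) s1
          (40 * m + 50 * length E + 220) (\<lambda>s'. stored (try_append E k Q) (nats s'))"
      proof (rule runs_SeqI[OF cs1])
        fix s2 :: state
        assume s2: "nats s2 19 0 = card {R \<in> set E. set R = set Q}"
        assume "\<And>a. a \<notin> nat_mods count_same \<Longrightarrow> nats s2 a = nats s1 a"
        then have fr2: "nats s2 a = nats s a" if "a \<notin> {16, 17, 18, 19, 20}" for a
          using that fr1 by simp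
        have st2: "stored E (nats s2)" using st stored_cong[of "nats s2" "nats s" E] fr2 by simp
        show "runs (If (Less (var 19) (var 10)) store_extension Skip) s2
          (40 * m + 50 * length E + 220 - (50 * length E + 30)) (\<lambda>s'. stored (try_append E k Q) (nats s'))"
        proof (cases "card {R \<in> set E. set R = set Q} < r")
          case False
          then have "try_append E k Q = E" using tA by auto
          then show ?thesis using s2 fr2 tb False st2 by simp
        next
          case less: True
          then have EQ: "try_append E k Q = E @ [Q]" using tA True by simp
          have "runs store_extension s2 (40 * m + 120) (\<lambda>s'. stored (E @ [Q]) (nats s'))"
          proof (rule runs_conseq[OF runs_store_extension[of s2 m "length E" e i]])
            fix s3 :: state
            assume s3: "(\<forall>f y. y < m \<longrightarrow> nats s3 9 (f * m + y) =
               (if f = length E then if y = i then Suc (nats s2 7 e) else nats s2 9 (e * m + y)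
                else nats s2 9 (f * m + y))) \<and>
              nats s3 7 = (nats s2 7)(length E := Suc (nats s2 7 e)) \<and>
              nats s3 6 = (nats s2 6)(length E := nats s2 12 0) \<and>
              nats s3 8 = (nats s2 8)(length E := nats s2 8 e + nats s2 4 i) \<and>
              nats s3 3 = (nats s2 3)(Suc (length E) := length E * m + m) \<and> nats s3 11 0 = Suc (length E)"
            have new: "nats s3 6 (length E) = cost Q" "nats s3 7 (length E) = length Q"
              "nats s3 8 (length E) = code Q"
              using s3 True fr2 vars st e i \<open>cs ! i \<notin> set (E ! e)\<close> tab
              by (simp_all add: stored_def tables_def Q_def P_def code_snoc)
            have newpos: "nats s3 9 (length E * m + y) = position Q (cs ! y)" if "y < m" for y
              using s3 fr2 st e i \<open>cs ! i \<notin> set (E ! e)\<close> cs(2) that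
              by (auto simp: stored_def Q_def P_def position_snoc nth_eq_iff_index_eq)
            have old: "nats s3 6 f = cost (E ! f)" "nats s3 7 f = length (E ! f)" "nats s3 8 f = code (E ! f)"
              "\<And>y. y < m \<Longrightarrow> nats s3 9 (f * m + y) = position (E ! f) (cs ! y)" if "f < length E" for f
              using s3 st2 that by (simp_all add: stored_def)
            have off3: "nats s3 3 j = j * m" if "j \<le> m + n \<or> j \<le> Suc (length E)" for j
              using s3 st2 that by (auto simp: stored_def le_Suc_eq)
            show "stored (E @ [Q]) (nats s3)"
              unfolding stored_def using new newpos old off3 s3 by (auto simp: nth_append less_Suc_eq)
          qed (use fr2 tb vars e i off in simp_all)
          then show ?thesis using EQ less s2 fr2 tb by (auto elim: runs_mono)
        qed
      qed simp
      moreover have "bval (BAnd (Eq (var 18) (Num 0)) (Eq (var 17) (var 12))) s1"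
        unfolding b by (rule True)
      ultimately show ?thesis by (simp only: runs_If if_True) (auto elim: runs_mono)
    qed
  next
    show "80 * m + 40 \<le> 120 * m + 50 * length E + 290" by linarith
  qed
  moreover have "nats s 9 (nats s 3 e + i) = 0"
    using False st e i by (simp add: stored_def position_eq_0_iff)
  ultimately show ?thesis
    unfolding try_cand_def using vars by (auto simp: Q_def P_def elim: runs_mono)
qed

end

section \<open>Passes over the list of prefixes\<close>

definition scan_prefix :: com where
  "scan_prefix = Seq (If (Less (Cell 7 (var 14)) num_cands) Skip (set_var 13 (Num 1)))
     (Seq (For 15 num_cands try_cand) (set_var 14 (Plus (var 14) (Num 1))))"

text \<open>The list grows during the scan, so the limit is not constant, as \<open>runs_For\<close>
  would demand.\<close>

definition scan_all :: com where
  "scan_all = While (Less (var 14) (var 11)) scan_prefix"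

text \<open>Without multiplication \<open>lam * k_OPT\<close> has to be accumulated:
  \<open>lam\<close> is added once in each of the \<open>k_OPT\<close> passes that end without a
  complete prefix.\<close>

definition search_pass :: com where
  "search_pass = Seq (set_var 14 (Num 0)) (Seq (set_var 13 (Num 0)) (Seq scan_all
     (Seq (If (Less (Num 0) (var 13)) Skip (RAssign 1 (Num 0) (RPlus (RCell 1 (Num 0)) (RCell 0 (Num 0)))))
       (set_var 12 (Plus (var 12) (Num 1))))))"

definition search_loop :: com where
  "search_loop = While (BNot (RLess (RCell 1 (Num 0)) (RNat (var 12)))) search_pass"

text \<open>As positions count from 1, entry 0 stays free for the number of rankings, which is
  written last.\<close>

definition write_ranking :: com where
  "write_ranking = For 16 num_cands
     (Assign 1 (addr (var 19) (Cell 9 (addr (var 20) (var 16)))) (cand (var 16)))"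

definition write_rankings :: com where
  "write_rankings = Seq (set_var 19 (Num 0)) (Seq (For 20 (var 11)
     (If (Less (Cell 7 (var 20)) num_cands) Skip (Seq write_ranking (set_var 19 (Plus (var 19) (Num 1))))))
     (Assign 1 (Num 0) (var 19)))"

lemma mods_scan [simp]:
  "nat_mods scan_prefix = {3, 6, 7, 8, 9, 11, 13, 14, 15, 16, 17, 18, 19, 20}" "real_mods scan_prefix = {}"
  "nat_mods scan_all = {3, 6, 7, 8, 9, 11, 13, 14, 15, 16, 17, 18, 19, 20}" "real_mods scan_all = {}"
  "nat_mods search_pass = {3, 6, 7, 8, 9, 11, 12, 13, 14, 15, 16, 17, 18, 19, 20}" "real_mods search_pass = {1}"
  "nat_mods search_loop = {3, 6, 7, 8, 9, 11, 12, 13, 14, 15, 16, 17, 18, 19, 20}" "real_mods search_loop = {1}"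
  "nat_mods write_ranking = {1, 16}" "real_mods write_ranking = {}"
  by (auto simp: scan_prefix_def scan_all_def search_pass_def search_loop_def write_ranking_def)

context aggregation
begin

lemma ex_less_Suc_iff: "(\<exists>j<Suc e. R j) \<longleftrightarrow> (\<exists>j<e. R j) \<or> R e"
  by (auto simp: less_Suc_eq)

lemma try_append_append: "\<exists>F. try_append E k Q = E @ F"
  by (auto simp: try_append_def)

text \<open>Lists have the form \<open>E @ F\<close>, so that index \<open>e\<close> keeps denoting
  the same prefix. The time of a round depends on the current length, hence the uniform bound
  \<open>M\<close>.\<close>

lemma runs_scan_cands:
  assumes tab: "tables (nats s)" and st: "stored E (nats s)" and inv: "search_inv E k e 0"
    and e: "e < length E" and vars: "nats s 14 0 = e" "nats s 12 0 = k"
    and M: "\<And>E i. search_inv E k e i \<Longrightarrow> length E \<le> M"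
  shows "runs (For 15 num_cands try_cand) s (m * (120 * m + 50 * M + 320) + 20)
    (\<lambda>s'. \<exists>F. search_inv (E @ F) k e m \<and> stored (E @ F) (nats s'))"
proof (rule runs_For[where n = m and T = "120 * m + 50 * M + 300" and
      I = "\<lambda>i h. \<exists>F. search_inv (E @ F) k e i \<and> stored (E @ F) h"])
  show "\<exists>F. search_inv (E @ F) k e 0 \<and> stored (E @ F) (nats s)"
    using st inv by (intro exI[of _ "[]"]) simp
next
  fix i h v
  have "stored F (upd h 15 0 v) = stored F h" for F by (rule stored_cong) auto
  then show "(\<exists>F. search_inv (E @ F) k e i \<and> stored (E @ F) (upd h 15 0 v)) =
      (\<exists>F. search_inv (E @ F) k e i \<and> stored (E @ F) h)" by simp
next
  fix i and s' :: state
  assume i: "i < m" "nats s' 15 0 = i" and "\<exists>F. search_inv (E @ F) k e i \<and> stored (E @ F) (nats s')"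
    and fr: "\<And>a. a \<notin> insert 15 (nat_mods try_cand) \<Longrightarrow> nats s' a = nats s a"
  then obtain F where F: "search_inv (E @ F) k e i" "stored (E @ F) (nats s')" by blast
  have "tables (nats s')" using tab tables_cong[of "nats s'" "nats s"] fr by simp
  then have "runs try_cand s' (120 * m + 50 * length (E @ F) + 300)
      (\<lambda>s''. stored (try_append (E @ F) k ((E @ F) ! e @ [cs ! i])) (nats s''))"
    using F i e fr vars by (intro runs_try_cand) auto
  then show "runs try_cand s' (120 * m + 50 * M + 300)
      (\<lambda>s''. \<exists>F. search_inv (E @ F) k e (Suc i) \<and> stored (E @ F) (nats s''))"
  proof (rule runs_conseq)
    show "120 * m + 50 * length (E @ F) + 300 \<le> 120 * m + 50 * M + 300" using M[OF F(1)] by simp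
  next
    fix s'' :: state
    assume st: "stored (try_append (E @ F) k ((E @ F) ! e @ [cs ! i])) (nats s'')"
    obtain G where G: "try_append (E @ F) k ((E @ F) ! e @ [cs ! i]) = (E @ F) @ G"
      using try_append_append by blast
    have "search_inv (try_append (E @ F) k ((E @ F) ! e @ [cs ! i])) k e (Suc i)"
      using F i e by (intro search_inv_step) auto
    then show "\<exists>F. search_inv (E @ F) k e (Suc i) \<and> stored (E @ F) (nats s'')"
      using st unfolding G by (intro exI[of _ "F @ G"]) simp
  qed
next
  show "\<And>s'. (\<And>a. a \<notin> insert 15 (nat_mods try_cand) \<Longrightarrow> nats s' a = nats s a) \<Longrightarrow> aval num_cands s' = m"
    using tab by (simp add: tables_def)
qed (simp_all add: algebra_simps)

lemma runs_scan_prefix: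
  assumes tab: "tables (nats s)" and st: "stored E (nats s)" and inv: "search_inv E k e 0"
    and e: "e < length E" and vars: "nats s 14 0 = e" "nats s 12 0 = k"
    and M: "\<And>E i. search_inv E k e i \<Longrightarrow> length E \<le> M"
  shows "runs scan_prefix s (m * (120 * m + 50 * M + 320) + 50)
    (\<lambda>s'. \<exists>F. search_inv (E @ F) k (Suc e) 0 \<and> stored (E @ F) (nats s') \<and> nats s' 14 0 = Suc e \<and>
       (nats s' 13 0 \<noteq> 0 \<longleftrightarrow> nats s 13 0 \<noteq> 0 \<or> length (E ! e) = m))"
proof -
  have "E ! e \<in> set E" using e by simp
  then have "valid (E ! e)" using inv unfolding search_inv_def by blast
  then have "card (set (E ! e)) = length (E ! e)" "set (E ! e) \<subseteq> set cs"
    using valid_distinct distinct_card by blast+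
  then have le: "length (E ! e) \<le> m"
    using card_mono[of "set cs" "set (E ! e)"] distinct_card[OF cs(2)] by simp
  have len: "nats s 7 e = length (E ! e)" "nats s 0 0 = m" using st e tab by (simp_all add: stored_def tables_def)
  define s1 where "s1 = (if length (E ! e) < m then s else s\<lparr>nats := upd (nats s) 13 0 1\<rparr>)"
  have s1: "nats s1 13 0 \<noteq> 0 \<longleftrightarrow> nats s 13 0 \<noteq> 0 \<or> length (E ! e) = m"
    and fr: "\<And>a. a \<noteq> 13 \<Longrightarrow> nats s1 a = nats s a"
    using le by (auto simp: s1_def)
  have "tables (nats s1)" "stored E (nats s1)"
    using tab st tables_cong[of "nats s1" "nats s"] stored_cong[of "nats s1" "nats s"] fr by simp_all
  then have "runs (For 15 num_cands try_cand) s1 (m * (120 * m + 50 * M + 320) + 20)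
    (\<lambda>s'. \<exists>F. search_inv (E @ F) k e m \<and> stored (E @ F) (nats s'))"
    using inv e vars fr M by (intro runs_scan_cands) auto
  then have "runs (Seq (For 15 num_cands try_cand) (set_var 14 (Plus (var 14) (Num 1)))) s1
    (m * (120 * m + 50 * M + 320) + 30)
    (\<lambda>s'. \<exists>F. search_inv (E @ F) k (Suc e) 0 \<and> stored (E @ F) (nats s') \<and> nats s' 14 0 = Suc e \<and>
       (nats s' 13 0 \<noteq> 0 \<longleftrightarrow> nats s 13 0 \<noteq> 0 \<or> length (E ! e) = m))"
  proof (rule runs_SeqI)
    fix s2 :: state
    assume "\<exists>F. search_inv (E @ F) k e m \<and> stored (E @ F) (nats s2)"
    then obtain F where F: "search_inv (E @ F) k e m" "stored (E @ F) (nats s2)" by blast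
    assume fr2: "\<And>a. a \<notin> nat_mods (For 15 num_cands try_cand) \<Longrightarrow> nats s2 a = nats s1 a"
    have "stored (E @ F) (upd (nats s2) 14 0 (Suc e))"
      using F stored_cong[of "upd (nats s2) 14 0 (Suc e)" "nats s2"] by simp
    then show "runs (set_var 14 (Plus (var 14) (Num 1))) s2
        (m * (120 * m + 50 * M + 320) + 30 - (m * (120 * m + 50 * M + 320) + 20))
        (\<lambda>s'. \<exists>F. search_inv (E @ F) k (Suc e) 0 \<and> stored (E @ F) (nats s') \<and> nats s' 14 0 = Suc e \<and>
          (nats s' 13 0 \<noteq> 0 \<longleftrightarrow> nats s 13 0 \<noteq> 0 \<or> length (E ! e) = m))"
      using search_inv_next[OF F(1)] fr2 fr s1 vars by auto
  qed simp
  then show ?thesis unfolding scan_prefix_def using len vars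
    by (auto simp: s1_def split: if_splits elim: runs_mono)
qed

text \<open>The distance to the end of the list may increase in a round; the distance of the index
  to \<open>M\<close> always decreases.\<close>

lemma runs_scan_all:
  assumes tab: "tables (nats s)" and st: "stored E (nats s)" and inv: "search_inv E k 0 0"
    and vars: "nats s 14 0 = 0" "nats s 13 0 = 0" "nats s 12 0 = k"
    and M: "\<And>E e i. search_inv E k e i \<Longrightarrow> length E \<le> M"
  shows "runs scan_all s (M * (m * (120 * m + 50 * M + 320) + 60) + 10)
    (\<lambda>s'. \<exists>E. search_inv E k (length E) 0 \<and> stored E (nats s') \<and>
       (nats s' 13 0 \<noteq> 0 \<longleftrightarrow> (\<exists>P\<in>set E. length P = m)))"
proof -
  let ?I = "\<lambda>s'. tables (nats s') \<and> nats s' 12 0 = k \<and> (\<exists>E. search_inv E k (nats s' 14 0) 0 \<and>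
    stored E (nats s') \<and> nats s' 14 0 \<le> length E \<and>
    (nats s' 13 0 \<noteq> 0 \<longleftrightarrow> (\<exists>j<nats s' 14 0. length (E ! j) = m)))"
  let ?T = "m * (120 * m + 50 * M + 320) + 50"
  show ?thesis unfolding scan_all_def
  proof (rule runs_While[where I = ?I and f = "\<lambda>s'. M - nats s' 14 0" and T = ?T])
    show "?I s" using tab st inv vars by auto
  next
    fix s' assume I: "?I s'" and b: "bval (Less (var 14) (var 11)) s'"
    then obtain E where E: "search_inv E k (nats s' 14 0) 0" "stored E (nats s')"
      "nats s' 13 0 \<noteq> 0 \<longleftrightarrow> (\<exists>j<nats s' 14 0. length (E ! j) = m)" by blast
    have e: "nats s' 14 0 < length E" using b E(2) by (simp add: stored_def)
    have "runs scan_prefix s' ?T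
      (\<lambda>s''. \<exists>F. search_inv (E @ F) k (Suc (nats s' 14 0)) 0 \<and> stored (E @ F) (nats s'') \<and>
       nats s'' 14 0 = Suc (nats s' 14 0) \<and>
       (nats s'' 13 0 \<noteq> 0 \<longleftrightarrow> nats s' 13 0 \<noteq> 0 \<or> length (E ! nats s' 14 0) = m))"
      using I E e M by (intro runs_scan_prefix) auto
    then show "runs scan_prefix s' ?T (\<lambda>s''. ?I s'' \<and> M - nats s'' 14 0 < M - nats s' 14 0)"
    proof (rule runs_conseq)
      fix s'' :: state
      assume "\<exists>F. search_inv (E @ F) k (Suc (nats s' 14 0)) 0 \<and> stored (E @ F) (nats s'') \<and>
       nats s'' 14 0 = Suc (nats s' 14 0) \<and>
       (nats s'' 13 0 \<noteq> 0 \<longleftrightarrow> nats s' 13 0 \<noteq> 0 \<or> length (E ! nats s' 14 0) = m)"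
      then obtain F where F: "search_inv (E @ F) k (Suc (nats s' 14 0)) 0" "stored (E @ F) (nats s'')"
        "nats s'' 14 0 = Suc (nats s' 14 0)"
        "nats s'' 13 0 \<noteq> 0 \<longleftrightarrow> nats s' 13 0 \<noteq> 0 \<or> length (E ! nats s' 14 0) = m" by blast
      assume fr: "\<And>a. a \<notin> nat_mods scan_prefix \<Longrightarrow> nats s'' a = nats s' a"
      have "tables (nats s'')" using I tables_cong[of "nats s''" "nats s'"] fr by simp
      moreover have "nats s'' 12 0 = k" using I fr by simp
      moreover have "nats s'' 13 0 \<noteq> 0 \<longleftrightarrow> (\<exists>j<nats s'' 14 0. length ((E @ F) ! j) = m)"
      proof -
        have "(\<exists>j<nats s' 14 0. length ((E @ F) ! j) = m) \<longleftrightarrow> (\<exists>j<nats s' 14 0. length (E ! j) = m)"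
          using e by (intro ex_cong1 conj_cong) (simp_all add: nth_append)
        moreover have "length ((E @ F) ! nats s' 14 0) = length (E ! nats s' 14 0)"
          using e by (simp add: nth_append)
        ultimately show ?thesis using F(4) E(3) unfolding F(3) ex_less_Suc_iff by (simp only:)
      qed
      moreover have "nats s' 14 0 < M" using e M[OF E(1)] by simp
      ultimately show "?I s'' \<and> M - nats s'' 14 0 < M - nats s' 14 0"
        using F(1-3) e by (intro conjI exI[of _ "E @ F"]) auto
    qed simp
  next
    fix s' assume I: "?I s'" and b: "\<not> bval (Less (var 14) (var 11)) s'"
    then obtain E where E: "search_inv E k (nats s' 14 0) 0" "stored E (nats s')" "nats s' 14 0 \<le> length E"
      "nats s' 13 0 \<noteq> 0 \<longleftrightarrow> (\<exists>j<nats s' 14 0. length (E ! j) = m)" by blast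
    have "nats s' 14 0 = length E" using b E by (simp add: stored_def)
    moreover have "(\<exists>P\<in>set E. length P = m) \<longleftrightarrow> (\<exists>j<length E. length (E ! j) = m)"
      by (metis in_set_conv_nth)
    ultimately have "nats s' 13 0 \<noteq> 0 \<longleftrightarrow> (\<exists>P\<in>set E. length P = m)" "search_inv E k (length E) 0"
      using E by simp_all
    then show "\<exists>E. search_inv E k (length E) 0 \<and> stored E (nats s') \<and>
       (nats s' 13 0 \<noteq> 0 \<longleftrightarrow> (\<exists>P\<in>set E. length P = m))"
      using E(2) by blast
  qed (use vars in \<open>simp add: algebra_simps\<close>)
qed

lemma runs_search_pass:
  assumes tab: "tables (nats s)" and st: "stored E (nats s)" and inv: "search_inv E k 0 0"
    and k: "nats s 12 0 = k"
    and M: "\<And>E e i. search_inv E k e i \<Longrightarrow> length E \<le> M"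
  shows "runs search_pass s (M * (m * (120 * m + 50 * M + 320) + 60) + 50)
    (\<lambda>s'. tables (nats s') \<and> (\<exists>E. search_inv E (Suc k) 0 0 \<and> stored E (nats s')) \<and> nats s' 12 0 = Suc k \<and>
       reals s' 1 0 = (if k_OPT (set cs) (mset vs) \<le> k then reals s 1 0 else reals s 1 0 + reals s 0 0))"
proof -
  define R :: "state \<Rightarrow> bool" where "R = (\<lambda>s'. tables (nats s') \<and> (\<exists>E. search_inv E (Suc k) 0 0 \<and> stored E (nats s')) \<and> nats s' 12 0 = Suc k \<and>
       reals s' 1 0 = (if k_OPT (set cs) (mset vs) \<le> k then reals s 1 0 else reals s 1 0 + reals s 0 0))"
  define s1 where "s1 = s\<lparr>nats := upd (upd (nats s) 14 0 0) 13 0 0\<rparr>"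
  have fr: "nats s1 a = nats s a" if "a \<notin> {13, 14}" for a using that by (simp add: s1_def)
  have "tables (nats s1)" "stored E (nats s1)"
    using tab st tables_cong[of "nats s1" "nats s"] stored_cong[of "nats s1" "nats s"] fr by simp_all
  then have sc: "runs scan_all s1 (M * (m * (120 * m + 50 * M + 320) + 60) + 10)
    (\<lambda>s'. \<exists>E. search_inv E k (length E) 0 \<and> stored E (nats s') \<and>
       (nats s' 13 0 \<noteq> 0 \<longleftrightarrow> (\<exists>P\<in>set E. length P = m)))"
    using inv k M fr by (intro runs_scan_all) (auto simp: s1_def)
  have rest: "runs (Seq scan_all (Seq (If (Less (Num 0) (var 13)) Skip
       (RAssign 1 (Num 0) (RPlus (RCell 1 (Num 0)) (RCell 0 (Num 0)))))
       (set_var 12 (Plus (var 12) (Num 1))))) s1 (M * (m * (120 * m + 50 * M + 320) + 60) + 40)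
    R"
  proof (rule runs_SeqI[OF sc])
    fix s2 :: state
    assume "\<exists>E. search_inv E k (length E) 0 \<and> stored E (nats s2) \<and>
       (nats s2 13 0 \<noteq> 0 \<longleftrightarrow> (\<exists>P\<in>set E. length P = m))"
    then obtain E where E: "search_inv E k (length E) 0" "stored E (nats s2)"
       "nats s2 13 0 \<noteq> 0 \<longleftrightarrow> (\<exists>P\<in>set E. length P = m)" by blast
    assume fr2: "\<And>a. a \<notin> nat_mods scan_all \<Longrightarrow> nats s2 a = nats s1 a"
      and rf: "\<And>a. a \<notin> real_mods scan_all \<Longrightarrow> reals s2 a = reals s1 a"
    have inv': "search_inv E (Suc k) 0 0" using search_inv_pass[OF E(1)] .
    have F: "0 < nats s2 13 0 \<longleftrightarrow> k_OPT (set cs) (mset vs) \<le> k"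
      using search_found_iff[OF inv'] E(3) distinct_card[OF cs(2)] by simp
    have "tables (upd (nats s2) 12 0 (Suc k))"
      using tab tables_cong[of "upd (nats s2) 12 0 (Suc k)" "nats s"] fr fr2 by simp
    moreover have "stored E (upd (nats s2) 12 0 (Suc k))"
      using E stored_cong[of "upd (nats s2) 12 0 (Suc k)" "nats s2"] by simp
    moreover have "nats s2 12 0 = k" "reals s2 = reals s" using fr fr2 rf k by (auto simp: s1_def)
    ultimately show "runs (Seq (If (Less (Num 0) (var 13)) Skip
       (RAssign 1 (Num 0) (RPlus (RCell 1 (Num 0)) (RCell 0 (Num 0)))))
       (set_var 12 (Plus (var 12) (Num 1)))) s2
       (M * (m * (120 * m + 50 * M + 320) + 60) + 40 - (M * (m * (120 * m + 50 * M + 320) + 60) + 10))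
    R"
      using F inv' by (auto simp: R_def)
  qed simp
  show ?thesis unfolding search_pass_def R_def[symmetric]
    by (simp, rule runs_mono[OF rest[unfolded s1_def]], simp)
qed

lemma runs_search_loop:
  fixes lam :: real
  defines "B \<equiv> nat \<lfloor>lam * real (k_OPT (set cs) (mset vs))\<rfloor>"
  assumes tab: "tables (nats s)" and st: "stored [[]] (nats s)"
    and vars: "nats s 12 0 = 0" "reals s 1 0 = 0" "reals s 0 0 = lam" and lam: "1 \<le> lam"
    and M: "\<And>E k e i. k \<le> B \<Longrightarrow> search_inv E k e i \<Longrightarrow> length E \<le> M"
  shows "runs search_loop s (Suc B * (M * (m * (120 * m + 50 * M + 320) + 60) + 60) + 10)
    (\<lambda>s'. tables (nats s') \<and> (\<exists>E k. search_inv E k 0 0 \<and> stored E (nats s') \<and> k \<le> Suc B \<and>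
       lam * real (k_OPT (set cs) (mset vs)) < real k))"
proof -
  let ?kO = "k_OPT (set cs) (mset vs)"
  let ?b = "BNot (RLess (RCell 1 (Num 0)) (RNat (var 12)))"
  let ?I = "\<lambda>s'. tables (nats s') \<and> (\<exists>E. search_inv E (nats s' 12 0) 0 0 \<and> stored E (nats s')) \<and>
    nats s' 12 0 \<le> Suc B \<and> reals s' 1 0 = lam * real (min (nats s' 12 0) ?kO) \<and> reals s' 0 0 = lam"
  let ?T = "M * (m * (120 * m + 50 * M + 320) + 60) + 50"
  have le: "real (min k ?kO) \<le> lam * real (min k ?kO)" for k
    using lam mult_right_mono[of 1 lam "real (min k ?kO)"] by simp
  \<comment> \<open>Up to \<open>k_OPT\<close> the accumulated value is \<open>lam * k\<close>, at
    least \<open>k\<close> because of \<open>lam >= 1\<close>, so the loop cannot stop too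
    early.\<close>
  have less_iff: "lam * real (min k ?kO) < real k \<longleftrightarrow> lam * real ?kO < real k" for k
  proof (cases "k \<le> ?kO")
    case True
    have "real ?kO \<le> lam * real ?kO" using le[of ?kO] by simp
    then show ?thesis using le[of k] True by (simp add: min_def)
  next
    case False
    then show ?thesis by (simp add: min_def)
  qed
  show ?thesis unfolding search_loop_def
  proof (rule runs_While[where I = ?I and f = "\<lambda>s'. Suc B - nats s' 12 0" and T = ?T])
    show "?I s" using tab st vars search_inv_init by auto
  next
    fix s' assume I: "?I s'" and b: "bval ?b s'"
    then obtain E where E: "search_inv E (nats s' 12 0) 0 0" "stored E (nats s')" by blast
    have "real (nats s' 12 0) \<le> lam * real ?kO" using b I less_iff[of "nats s' 12 0"] by simp
    \<comment> \<open>So there are at most \<open>B + 1\<close> passes, and \<open>M\<close> has to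
      bound only the lists occurring in them.\<close>
    then have kB: "nats s' 12 0 \<le> B" unfolding B_def by (simp add: le_nat_floor)
    have "runs search_pass s' ?T (\<lambda>s''. tables (nats s'') \<and>
       (\<exists>E. search_inv E (Suc (nats s' 12 0)) 0 0 \<and> stored E (nats s'')) \<and> nats s'' 12 0 = Suc (nats s' 12 0) \<and>
       reals s'' 1 0 = (if ?kO \<le> nats s' 12 0 then reals s' 1 0 else reals s' 1 0 + reals s' 0 0))"
      using I E M[OF kB] by (intro runs_search_pass) auto
    then show "runs search_pass s' ?T (\<lambda>s''. ?I s'' \<and> Suc B - nats s'' 12 0 < Suc B - nats s' 12 0)"
      by (rule runs_conseq) (use I kB in \<open>auto simp: min_def algebra_simps\<close>)
  next
    fix s' assume I: "?I s'" and b: "\<not> bval ?b s'"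
    then show "tables (nats s') \<and> (\<exists>E k. search_inv E k 0 0 \<and> stored E (nats s') \<and> k \<le> Suc B \<and>
       lam * real ?kO < real k)"
      using less_iff[of "nats s' 12 0"] by auto
  qed (use vars in \<open>simp add: algebra_simps\<close>)
qed

end

section \<open>Writing the result\<close>

lemma concat_nth_uniform:
  "(\<And>x. x \<in> set L \<Longrightarrow> length x = m) \<Longrightarrow> g < length L \<Longrightarrow> p < m \<Longrightarrow> concat L ! (g * m + p) = L ! g ! p"
proof (induction L arbitrary: g)
  case (Cons x L)
  then show ?case by (cases g) (auto simp: nth_append)
qed simp

lemma length_concat_uniform: "(\<And>x. x \<in> set L \<Longrightarrow> length x = m) \<Longrightarrow> length (concat L) = length L * m"
  by (induction L) auto

lemma has_outputI:
  assumes "nats s 1 0 = length L" "\<And>x. x \<in> set L \<Longrightarrow> length x = m"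
    and "\<And>g p. g < length L \<Longrightarrow> p < m \<Longrightarrow> nats s 1 (g * m + Suc p) = L ! g ! p"
  shows "has_output s L"
  unfolding has_output_def
proof (intro allI impI)
  fix i assume i: "i < length (length L # concat L)"
  show "nats s 1 i = (length L # concat L) ! i"
  proof (cases i)
    case 0
    then show ?thesis using assms(1) by simp
  next
    case (Suc j)
    then have j: "j < length L * m" using i length_concat_uniform[of L m] assms(2) by simp
    then have "0 < m" by (cases m) auto
    then have p: "j mod m < m" and g: "j div m < length L"
      using j by (simp_all add: less_mult_imp_div_less)
    show ?thesis
      using assms(3)[OF g p] concat_nth_uniform[OF assms(2) g p] Suc by simp
  qed
qed

context aggregation
begin

text \<open>\<open>q\<close> rankings have been written before, and the cells up to
  \<open>q * m\<close> contain them. From \<open>q <= f\<close> it follows that array 3 holds the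
  offset \<open>q * m\<close>.\<close>

lemma runs_write_ranking:
  assumes tab: "tables (nats s)" and st: "stored E (nats s)" and f: "f < length E" and q: "q \<le> f"
    and P: "valid (E ! f)" "length (E ! f) = m" and vars: "nats s 20 0 = f" "nats s 19 0 = q"
  shows "runs write_ranking s (50 * m + 20) (\<lambda>s'. (\<forall>p<m. nats s' 1 (q * m + Suc p) = E ! f ! p) \<and>
    (\<forall>p\<le>q * m. nats s' 1 p = nats s 1 p))"
proof -
  define P where "P = E ! f"
  have "card (set cs) = m" using cs(2) by (rule distinct_card)
  then have "P \<in> permutations_of_set (set cs)" using full_iff[of P] P by (simp add: P_def)
  then have Ps: "distinct P" "set P = set cs" by (simp_all add: permutations_of_set_def)
  \<comment> \<open>Different candidates have different positions, so no write destroys an earlier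
    one.\<close>
  have inj: "y = i" if "position P (cs ! y) = position P (cs ! i)" "y < m" "i < m" for y i
  proof -
    have "cs ! y \<in> set P" "cs ! i \<in> set P" using Ps that by simp_all
    then have "cs ! y = cs ! i" using nth_position[of "cs ! y" P] nth_position[of "cs ! i" P] that by auto
    then show ?thesis using that cs(2) by (simp add: nth_eq_iff_index_eq)
  qed
  have pos: "0 < position P (cs ! i)" if "i < m" for i
    using that Ps(2) position_eq_0_iff[of P "cs ! i"] by simp
  have s: "nats s 0 0 = m" "nats s 3 f = f * m" "nats s 3 q = q * m"
    "\<And>i. i < m \<Longrightarrow> nats s 0 (2 + i) = cs ! i" "\<And>i. i < m \<Longrightarrow> nats s 9 (f * m + i) = position P (cs ! i)"
    using tab st f q by (simp_all add: tables_def stored_def P_def)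
  have "runs write_ranking s (50 * m + 20) (\<lambda>s'. (\<forall>y<m. nats s' 1 (q * m + position P (cs ! y)) = cs ! y) \<and>
    (\<forall>p\<le>q * m. nats s' 1 p = nats s 1 p))"
    unfolding write_ranking_def
  proof (rule runs_For[where n = m and T = 25 and
      I = "\<lambda>i h. (\<forall>y<i. h 1 (q * m + position P (cs ! y)) = cs ! y) \<and> (\<forall>p\<le>q * m. h 1 p = nats s 1 p)"])
    fix i and s' :: state
    assume i: "i < m" "nats s' 16 0 = i"
      and I: "(\<forall>y<i. nats s' 1 (q * m + position P (cs ! y)) = cs ! y) \<and> (\<forall>p\<le>q * m. nats s' 1 p = nats s 1 p)"
      and fr: "\<And>a. a \<notin> insert 16 (nat_mods (Assign 1 (addr (var 19) (Cell 9 (addr (var 20) (var 16)))) (cand (var 16)))) \<Longrightarrow>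
        nats s' a = nats s a"
    have "\<forall>y<i. position P (cs ! y) \<noteq> position P (cs ! i)" using inj i by fastforce
    then show "runs (Assign 1 (addr (var 19) (Cell 9 (addr (var 20) (var 16)))) (cand (var 16))) s' 25
      (\<lambda>s''. (\<forall>y<Suc i. nats s'' 1 (q * m + position P (cs ! y)) = cs ! y) \<and>
         (\<forall>p\<le>q * m. nats s'' 1 p = nats s 1 p))"
      using I i s fr vars pos[OF i(1)] by (auto simp: less_Suc_eq)
  qed (use s in auto)
  then show ?thesis
  proof (rule runs_conseq)
    fix s' :: state
    assume *: "(\<forall>y<m. nats s' 1 (q * m + position P (cs ! y)) = cs ! y) \<and> (\<forall>p\<le>q * m. nats s' 1 p = nats s 1 p)"
    have "nats s' 1 (q * m + Suc p) = P ! p" if "p < m" for p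
    proof -
      have len: "length P = m" using assms(6) by (simp add: P_def)
      have inP: "P ! p \<in> set P" using that len by simp
      then have "P ! p \<in> set cs" using Ps(2) by simp
      then obtain y where y: "y < m" "cs ! y = P ! p" unfolding in_set_conv_nth by blast
      obtain p' where p': "position P (P ! p) = Suc p'" "p' < length P" "P ! p' = P ! p"
        using nth_position[OF inP] by blast
      then have "p' = p" using Ps(1) that len by (simp add: nth_eq_iff_index_eq)
      then show ?thesis using conjunct1[OF *, rule_format, OF y(1)] y(2) p'(1) by simp
    qed
    then show "(\<forall>p<m. nats s' 1 (q * m + Suc p) = E ! f ! p) \<and> (\<forall>p\<le>q * m. nats s' 1 p = nats s 1 p)"
      using * by (simp add: P_def)
  qed simp
qed

lemma runs_write_rankings:
  assumes tab: "tables (nats s)" and st: "stored E (nats s)" and E: "\<And>P. P \<in> set E \<Longrightarrow> valid P"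
  shows "runs write_rankings s (length E * (50 * m + 60) + 40)
    (\<lambda>s'. has_output s' (filter (\<lambda>P. length P = m) E))"
proof -
  define L where "L = (\<lambda>f. filter (\<lambda>P. length P = m) (take f E))"
  have L_Suc: "L (Suc f) = (if length (E ! f) = m then L f @ [E ! f] else L f)" if "f < length E" for f
    using that by (simp add: L_def take_Suc_conv_app_nth)
  have L_le: "length (L f) \<le> f" for f
    unfolding L_def using length_filter_le[of _ "take f E"] by (simp add: order_trans)
  let ?I = "\<lambda>f h. h 19 0 = length (L f) \<and> (\<forall>g<length (L f). \<forall>p<m. h 1 (g * m + Suc p) = L f ! g ! p)"
  let ?body = "If (Less (Cell 7 (var 20)) num_cands) Skip (Seq write_ranking (set_var 19 (Plus (var 19) (Num 1))))"
  define s1 where "s1 = s\<lparr>nats := upd (nats s) 19 0 0\<rparr>"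
  have tab1: "tables (nats s1)" and st1: "stored E (nats s1)"
    using tab st tables_cong[of "nats s1" "nats s"] stored_cong[of "nats s1" "nats s"] by (simp_all add: s1_def)
  have le: "length P \<le> m" if "P \<in> set E" for P
    using valid_distinct[OF E[OF that]] card_mono[of "set cs" "set P"] distinct_card[of P] distinct_card[OF cs(2)]
    by simp
  have loop: "runs (For 20 (var 11) ?body) s1 (length E * (50 * m + 60) + 20) (\<lambda>s'. ?I (length E) (nats s'))"
  proof (rule runs_For[where n = "length E" and T = "50 * m + 45" and I = ?I])
    fix f and s' :: state
    assume f: "f < length E" "nats s' 20 0 = f" and I: "?I f (nats s')"
      and fr: "\<And>a. a \<notin> insert 20 (nat_mods ?body) \<Longrightarrow> nats s' a = nats s1 a"
    have tab': "tables (nats s')" and st': "stored E (nats s')"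
      using tab1 st1 tables_cong[of "nats s'" "nats s1"] stored_cong[of "nats s'" "nats s1"] fr by simp_all
    have len: "nats s' 7 f = length (E ! f)" "nats s' 0 0 = m" using tab' st' f by (simp_all add: stored_def tables_def)
    show "runs ?body s' (50 * m + 45) (\<lambda>s''. ?I (Suc f) (nats s''))"
    proof (cases "length (E ! f) = m")
      case False
      then have "length (E ! f) < m" using le[of "E ! f"] f by simp
      then show ?thesis using len f I L_Suc[OF f(1)] by simp
    next
      case True
      have wr: "runs write_ranking s' (50 * m + 20) (\<lambda>s''. (\<forall>p<m. nats s'' 1 (length (L f) * m + Suc p) = E ! f ! p) \<and>
          (\<forall>p\<le>length (L f) * m. nats s'' 1 p = nats s' 1 p))"
        using tab' st' f L_le[of f] E[of "E ! f"] True I by (intro runs_write_ranking) simp_all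
      have "runs (Seq write_ranking (set_var 19 (Plus (var 19) (Num 1)))) s' (50 * m + 30) (\<lambda>s''. ?I (Suc f) (nats s''))"
      proof (rule runs_SeqI[OF wr])
        fix s'' :: state
        assume w: "(\<forall>p<m. nats s'' 1 (length (L f) * m + Suc p) = E ! f ! p) \<and>
            (\<forall>p\<le>length (L f) * m. nats s'' 1 p = nats s' 1 p)"
          and fr': "\<And>a. a \<notin> nat_mods write_ranking \<Longrightarrow> nats s'' a = nats s' a"
        have old: "nats s'' 1 (g * m + Suc p) = L f ! g ! p" if "g < length (L f)" "p < m" for g p
        proof -
          have "Suc g * m \<le> length (L f) * m" using that by (intro mult_right_mono) auto
          then have "g * m + Suc p \<le> length (L f) * m" using that by simp
          then show ?thesis using w I that by simp
        qed
        have LS: "L (Suc f) = L f @ [E ! f]" using L_Suc[OF f(1)] True by simp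
        have "nats s'' 1 (g * m + Suc p) = L (Suc f) ! g ! p" if "g < length (L (Suc f))" "p < m" for g p
          using that w old unfolding LS by (auto simp: nth_append less_Suc_eq)
        then show "runs (set_var 19 (Plus (var 19) (Num 1))) s'' (50 * m + 30 - (50 * m + 20))
            (\<lambda>s''. ?I (Suc f) (nats s''))"
          using fr' I LS by simp
      qed simp
      then show ?thesis using len f True by (simp, elim runs_mono) simp
    qed
  next
    show "?I 0 (nats s1)" by (simp add: L_def s1_def)
  next
    show "length E * (50 * m + 45 + acost (var 11) + 10) + acost (var 11) + 7 \<le> length E * (50 * m + 60) + 20"
      by (simp add: algebra_simps)
  qed (use st1 in \<open>simp_all add: stored_def\<close>)
  have "runs (Seq (For 20 (var 11) ?body) (Assign 1 (Num 0) (var 19))) s1 (length E * (50 * m + 60) + 30)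
    (\<lambda>s'. has_output s' (filter (\<lambda>P. length P = m) E))"
  proof (rule runs_SeqI[OF loop])
    fix s' :: state
    assume I: "?I (length E) (nats s')"
    have "L (length E) = filter (\<lambda>P. length P = m) E" by (simp add: L_def)
    then show "runs (Assign 1 (Num 0) (var 19)) s' (length E * (50 * m + 60) + 30 - (length E * (50 * m + 60) + 20))
        (\<lambda>s'. has_output s' (filter (\<lambda>P. length P = m) E))"
      using I by (auto intro!: has_outputI[where m = m])
  qed simp
  then show ?thesis unfolding write_rankings_def s1_def by (simp, elim runs_mono) simp
qed

end

section \<open>The complete program, started on the input\<close>

definition prepare :: com where
  "prepare = Seq make_tables (Seq count_votes count_r)"

definition search_and_write :: com where
  "search_and_write = Seq (set_var 11 (Num 1)) (Seq search_loop write_rankings)"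

text \<open>
  Without candidates the votes are empty lists, so that their number is not bounded by the size of the
  input and they must not be counted.  Entry 2 of the input is then 1 if \<open>r > 0\<close> and 0 otherwise.
\<close>

definition kemeny_program :: com where
  "kemeny_program = If (Less (Num 0) num_cands)
     (Seq prepare (If (Less (Num 0) (var 10)) search_and_write Skip))
     (Assign 1 (Num 0) (Cell 0 (Num 2)))"

lemma mods_prepare [simp]:
  "nat_mods prepare = {2, 3, 4, 5, 10, 15, 16, 21}" "real_mods prepare = {}"
  by (auto simp: prepare_def)

lemma length_input_word:
  "(\<And>v. v \<in> set vs \<Longrightarrow> length v = length cs) \<Longrightarrow>
    length (input_word cs vs r) = 2 + length cs + length vs * length cs + r"
  using length_concat_uniform[of vs "length cs"] by (simp add: input_word_def)

lemma input_state_nats: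
  fixes cs :: "nat list" and vs :: "nat list list" and lam :: real and r :: nat
  defines "h \<equiv> nats (input_state cs vs lam r)" and "m \<equiv> length cs" and "n \<equiv> length vs"
  assumes vs: "\<And>v. v \<in> set vs \<Longrightarrow> length v = length cs"
  shows "h 0 0 = m" "h 0 1 = n" "i < m \<Longrightarrow> h 0 (2 + i) = cs ! i"
    "j < n \<Longrightarrow> a < m \<Longrightarrow> h 0 (2 + m + (j * m + a)) = vs ! j ! a"
    "i < r \<Longrightarrow> h 0 (2 + m + (n * m + i)) = 1" "h 0 (2 + m + (n * m + r)) = 0"
    "b \<noteq> 0 \<Longrightarrow> h b p = 0"
proof -
  let ?w = "input_word cs vs r"
  have lc: "length (concat vs) = n * m" using length_concat_uniform[of vs m] vs by (simp add: m_def n_def)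
  have len: "length ?w = 2 + m + n * m + r" using length_input_word[of vs cs r] vs by (simp add: m_def n_def)
  have h: "h 0 p = ?w ! p" if "p < length ?w" for p using that by (simp add: h_def input_state_def)
  have w: "?w ! (2 + p) = (cs @ concat vs @ replicate r 1) ! p" for p by (simp add: input_word_def)
  show "h 0 0 = m" using h[of 0] len by (simp add: input_word_def m_def)
  show "h 0 1 = n" using h[of 1] len by (simp add: input_word_def n_def)
  show "i < m \<Longrightarrow> h 0 (2 + i) = cs ! i" using h[of "2 + i"] len w[of i] by (simp add: m_def nth_append)
  show "h 0 (2 + m + (j * m + a)) = vs ! j ! a" if "j < n" "a < m"
  proof -
    have "Suc j * m \<le> n * m" using that by (intro mult_right_mono) auto
    then have less: "j * m + a < n * m" using that by simp
    then show ?thesis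
      using h[of "2 + (m + (j * m + a))"] len w[of "m + (j * m + a)"] lc concat_nth_uniform[of vs m j a] that vs
      by (simp add: m_def n_def nth_append add.assoc)
  qed
  show "i < r \<Longrightarrow> h 0 (2 + m + (n * m + i)) = 1"
    using h[of "2 + (m + (n * m + i))"] len w[of "m + (n * m + i)"] lc
    by (simp add: m_def n_def nth_append add.assoc)
  show "h 0 (2 + m + (n * m + r)) = 0" using len by (simp add: h_def input_state_def)
  show "b \<noteq> 0 \<Longrightarrow> h b p = 0" by (simp add: h_def input_state_def)
qed

lemma runs_prepare:
  fixes cs :: "nat list" and vs :: "nat list list" and lam :: real and r :: nat
  defines "s \<equiv> input_state cs vs lam r" and "m \<equiv> length cs" and "n \<equiv> length vs"
  assumes cs: "distinct cs" and vs: "\<And>v. v \<in> set vs \<Longrightarrow> distinct v \<and> set v = set cs"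
  shows "runs prepare s (50 * (m + n) + 200 * (m + 1) * (m + 1) * (n + 1) + 30 * r + 100) (\<lambda>s'.
    (\<forall>i\<le>m + n. nats s' 3 i = i * m \<and> nats s' 4 i = 2 ^ i) \<and>
    (\<forall>y<m. \<forall>c<m. nats s' 2 (y * m + c) = length (filter (\<lambda>v. before v (cs ! y) (cs ! c)) vs)) \<and>
    nats s' 10 0 = r)"
proof -
  have len: "length v = length cs" if "v \<in> set vs" for v
    using vs[OF that] cs distinct_card by metis
  note h = input_state_nats[where cs = cs and vs = vs and lam = lam and r = r, OF len, folded s_def m_def n_def]
  have t1: "runs make_tables s (50 * (m + n) + 20) (\<lambda>s'. \<forall>i \<le> m + n. nats s' 3 i = i * m \<and> nats s' 4 i = 2 ^ i)"
    by (rule runs_make_tables) (use h in simp_all)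
  show ?thesis unfolding prepare_def
  proof (rule runs_SeqI[OF t1])
    fix s1 :: state
    assume s1: "\<forall>i \<le> m + n. nats s1 3 i = i * m \<and> nats s1 4 i = 2 ^ i"
      and "\<And>a. a \<notin> nat_mods make_tables \<Longrightarrow> nats s1 a = nats s a"
    then have fr1: "nats s1 a = nats s a" if "a \<notin> {3, 4, 16}" for a using that by simp
    have t2: "runs count_votes s1 (200 * (m + 1) * (m + 1) * (n + 1))
      (\<lambda>s'. \<forall>y<m. \<forall>c<m. nats s' 2 (y * m + c) = length (filter (\<lambda>v. before v (cs ! y) (cs ! c)) vs))"
      by (rule runs_count_votes) (use s1 fr1 h cs vs in \<open>simp_all add: m_def n_def\<close>)
    show "runs (Seq count_votes count_r) s1
      (50 * (m + n) + 200 * (m + 1) * (m + 1) * (n + 1) + 30 * r + 100 - (50 * (m + n) + 20)) (\<lambda>s'.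
      (\<forall>i\<le>m + n. nats s' 3 i = i * m \<and> nats s' 4 i = 2 ^ i) \<and>
      (\<forall>y<m. \<forall>c<m. nats s' 2 (y * m + c) = length (filter (\<lambda>v. before v (cs ! y) (cs ! c)) vs)) \<and>
      nats s' 10 0 = r)"
    proof (rule runs_SeqI[OF t2])
      fix s2 :: state
      assume s2: "\<forall>y<m. \<forall>c<m. nats s2 2 (y * m + c) = length (filter (\<lambda>v. before v (cs ! y) (cs ! c)) vs)"
        and "\<And>a. a \<notin> nat_mods count_votes \<Longrightarrow> nats s2 a = nats s1 a"
      then have fr2: "nats s2 a = nats s1 a" if "a \<notin> {2, 5, 15, 16, 21}" for a using that by simp
      have t3: "runs count_r s2 (30 * r + 20) (\<lambda>s'. nats s' 10 0 = r)"
        by (rule runs_count_r[where m = m and n = n and b = "n * m"]) (use s1 fr1 fr2 h in simp_all)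
      show "runs count_r s2 (50 * (m + n) + 200 * (m + 1) * (m + 1) * (n + 1) + 30 * r + 100 -
          (50 * (m + n) + 20) - 200 * (m + 1) * (m + 1) * (n + 1)) (\<lambda>s'.
        (\<forall>i\<le>m + n. nats s' 3 i = i * m \<and> nats s' 4 i = 2 ^ i) \<and>
        (\<forall>y<m. \<forall>c<m. nats s' 2 (y * m + c) = length (filter (\<lambda>v. before v (cs ! y) (cs ! c)) vs)) \<and>
        nats s' 10 0 = r)"
        by (rule runs_conseq[OF t3]) (use s1 s2 fr2 in simp_all)
    qed simp
  qed simp
qed

context aggregation
begin

lemma runs_search_and_write:
  fixes lam :: real
  defines "B \<equiv> nat \<lfloor>lam * real (k_OPT (set cs) (mset vs))\<rfloor>"
  assumes tab: "tables (nats s)" and off: "\<And>i. i \<le> m + n \<Longrightarrow> nats s 3 i = i * m"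
    and zero: "\<And>a i. a \<in> {6, 7, 8, 9, 12} \<Longrightarrow> nats s a i = 0"
    and re: "reals s 1 0 = 0" "reals s 0 0 = lam" and lam: "1 \<le> lam"
    and M: "\<And>E k e i. k \<le> Suc B \<Longrightarrow> search_inv E k e i \<Longrightarrow> length E \<le> M"
  shows "runs search_and_write s (Suc B * (M * (m * (120 * m + 50 * M + 320) + 60) + 60) + M * (50 * m + 60) + 60)
    (\<lambda>s'. \<exists>L. has_output s' L \<and> correct_output (set cs) (mset vs) lam r L)"
proof -
  define s1 where "s1 = s\<lparr>nats := upd (nats s) 11 0 1\<rparr>"
  let ?kO = "k_OPT (set cs) (mset vs)"
  \<comment> \<open>\<open>stored [[]]\<close> speaks about entry 1 of array 3, which the tables
    must therefore contain.\<close>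
  have "1 \<le> m + n" using V_ne by (cases vs) auto
  have tab1: "tables (nats s1)" using tab tables_cong[of "nats s1" "nats s"] by (simp add: s1_def)
  \<comment> \<open>Zeroed memory already represents the empty prefix; only the number of prefixes
    has to be set.\<close>
  have "code [] = 0" "cost [] = 0" by (simp_all add: code_def)
  then have st1: "stored [[]] (nats s1)"
    using off zero \<open>1 \<le> m + n\<close> unfolding stored_def s1_def
    by (auto simp: position_def intro: order_trans)
  have loop: "runs search_loop s1 (Suc B * (M * (m * (120 * m + 50 * M + 320) + 60) + 60) + 10)
    (\<lambda>s'. tables (nats s') \<and> (\<exists>E k. search_inv E k 0 0 \<and> stored E (nats s') \<and> k \<le> Suc B \<and>
       lam * real ?kO < real k))"
  proof -
    have "length E \<le> M" if "k \<le> B" "search_inv E k e i" for E k e i using that M le_SucI by blast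
    then show ?thesis unfolding B_def
      by (intro runs_search_loop[OF tab1 st1]) (use zero re lam in \<open>simp_all add: s1_def\<close>)
  qed
  have "runs (Seq search_loop write_rankings) s1
    (Suc B * (M * (m * (120 * m + 50 * M + 320) + 60) + 60) + M * (50 * m + 60) + 50)
    (\<lambda>s'. \<exists>L. has_output s' L \<and> correct_output (set cs) (mset vs) lam r L)"
  proof (rule runs_SeqI[OF loop])
    fix s2 :: state
    assume "tables (nats s2) \<and> (\<exists>E k. search_inv E k 0 0 \<and> stored E (nats s2) \<and> k \<le> Suc B \<and>
       lam * real ?kO < real k)"
    then obtain E k where E: "tables (nats s2)" "search_inv E k 0 0" "stored E (nats s2)" "k \<le> Suc B"
      "lam * real ?kO < real k" by blast
    have "length E \<le> M" using M E by blast
    then have le: "length E * (50 * m + 60) \<le> M * (50 * m + 60)" by (rule mult_right_mono) simp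
    have "\<And>P. P \<in> set E \<Longrightarrow> valid P" using E(2) unfolding search_inv_def by blast
    then have "runs write_rankings s2 (length E * (50 * m + 60) + 40)
        (\<lambda>s'. has_output s' (filter (\<lambda>P. length P = m) E))"
      using E by (intro runs_write_rankings)
    moreover have "correct_output (set cs) (mset vs) lam r (filter (\<lambda>P. length P = m) E)"
      using search_correct[OF E(2) E(4)[unfolded B_def] E(5)] lam distinct_card[OF cs(2)] by simp
    ultimately show "runs write_rankings s2
      (Suc B * (M * (m * (120 * m + 50 * M + 320) + 60) + 60) + M * (50 * m + 60) + 50 -
       (Suc B * (M * (m * (120 * m + 50 * M + 320) + 60) + 60) + 10))
      (\<lambda>s'. \<exists>L. has_output s' L \<and> correct_output (set cs) (mset vs) lam r L)"
      by (elim runs_conseq) (use le in auto)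
  qed simp
  then show ?thesis unfolding search_and_write_def s1_def by (simp, elim runs_mono) simp
qed

end

section \<open>The time bound\<close>

text \<open>Since \<open>exp 1 <= 3 <= (16 / 9) ^ 2\<close>, the logarithm of \<open>16 / 9\<close>
  is at least \<open>1 / 2\<close>, and
  \<open>x + 1 <= 2 * (1 + x / 2) <= 2 * exp (x / 2)\<close>.\<close>

lemma powr_absorb_linear: "0 \<le> x \<Longrightarrow> 9 ^ nat \<lfloor>x\<rfloor> * (x + 1) \<le> 2 * 16 powr x" for x :: real
proof -
  assume x: "0 \<le> x"
  have "(9::real) ^ nat \<lfloor>x\<rfloor> = 9 powr real (nat \<lfloor>x\<rfloor>)" by (simp add: powr_realpow)
  also have "\<dots> \<le> 9 powr x" using x by (intro powr_mono) auto
  finally have 1: "(9::real) ^ nat \<lfloor>x\<rfloor> \<le> 9 powr x" .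
  have "exp (1 / 2) ^ 2 = exp (1::real)" by (simp add: exp_of_nat_mult[symmetric])
  also have "\<dots> \<le> 3" by (rule exp_le)
  also have "\<dots> \<le> (16 / 9) ^ 2" by (simp add: power2_eq_square)
  finally have "exp (1 / 2) \<le> (16 / 9 :: real)" by (rule power2_le_imp_le) simp
  then have ln: "1 / 2 \<le> ln (16 / 9 :: real)" by (subst ln_ge_iff) simp_all
  have "x + 1 \<le> 2 * (1 + x * (1 / 2))" using x by simp
  also have "\<dots> \<le> 2 * exp (x * (1 / 2))" by (intro mult_left_mono exp_ge_add_one_self) simp
  also have "\<dots> \<le> 2 * exp (x * ln (16 / 9))" 
    by (rule mult_left_mono[OF iffD2[OF exp_le_cancel_iff mult_left_mono[OF ln x]]]) simp
  also have "exp (x * ln (16 / 9)) = (16 / 9) powr x" by (simp add: powr_def)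
  finally have 2: "x + 1 \<le> 2 * (16 / 9) powr x" .
  have "9 ^ nat \<lfloor>x\<rfloor> * (x + 1) \<le> 9 powr x * (2 * (16 / 9) powr x)" using 1 2 x by (intro mult_mono) auto
  also have "\<dots> = 2 * (9 * (16 / 9)) powr x" by (subst powr_mult) auto
  finally show ?thesis by simp
qed

text \<open>With \<open>M <= Y\<close>, a pass takes at most \<open>610 * z * Y ^ 2\<close> and the
  output \<open>170 * z * Y ^ 2\<close>, where \<open>z * Y ^ 2 = 4 * z ^ 7 * X ^ 2\<close>; so
  \<open>3120 = 4 * (610 + 170)\<close>. At most \<open>z * (x + 1)\<close> passes raise the
  exponent to 8. Finally \<open>6680 = 440 + 2 * 3120\<close>, where 440 covers the preparation and
  2 stems from \<open>powr_absorb_linear\<close>.\<close>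

lemma time_bound:
  fixes m n r z B :: nat and x :: real
  defines "M \<equiv> r * (n * (2 * (m + 1) * 3 ^ nat \<lfloor>x\<rfloor>))"
  assumes z: "m + 1 \<le> z" "n + 1 \<le> z" "r + 1 \<le> z" and x: "0 \<le> x" and B: "real (Suc B) \<le> real n * (x + 1)"
  shows "real (50 * (m + n) + 200 * (m + 1) * (m + 1) * (n + 1) + 30 * r + 100 +
      (Suc B * (M * (m * (120 * m + 50 * M + 320) + 60) + 60) + M * (50 * m + 60) + 60) + 10)
    \<le> 16 powr x * real (6680 * z ^ 8)"
proof -
  define X :: nat where "X = 3 ^ nat \<lfloor>x\<rfloor>"
  define Y where "Y = 2 * z ^ 3 * X"
  have z1: "1 \<le> z" and X1: "1 \<le> X" using z by (simp_all add: X_def)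
  have zY: "z \<le> Y"
  proof -
    have "z ^ 1 * 1 \<le> z ^ 3 * X" using z1 X1 by (intro mult_mono power_increasing) auto
    then show ?thesis by (simp add: Y_def)
  qed
  then have Y1: "1 \<le> Y" using z1 by simp
  have MY: "M \<le> Y"
  proof -
    have "M \<le> z * (z * (2 * z * X))"
      unfolding M_def X_def[symmetric] using z by (intro mult_mono) auto
    then show ?thesis by (simp add: Y_def power3_eq_cube mult_ac)
  qed
  have one: "1 \<le> z * Y" using mult_le_mono[OF z1 Y1] by simp
  then have zYY: "1 \<le> z * Y * Y" using mult_le_mono[OF _ Y1] by force
  have inner: "m * (120 * m + 50 * M + 320) + 60 \<le> 550 * (z * Y)"
  proof -
    have "120 * m + 50 * M + 320 \<le> 490 * Y" using z zY MY Y1 by linarith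
    then have "m * (120 * m + 50 * M + 320) \<le> z * (490 * Y)" using z by (intro mult_mono) auto
    then show ?thesis using one by linarith
  qed
  have pass: "M * (m * (120 * m + 50 * M + 320) + 60) + 60 \<le> 610 * (z * Y * Y)"
  proof -
    have "M * (m * (120 * m + 50 * M + 320) + 60) \<le> Y * (550 * (z * Y))"
      using MY inner by (intro mult_mono) auto
    then show ?thesis using zYY by (simp add: mult_ac)
  qed
  have final: "M * (50 * m + 60) + 60 \<le> 170 * (z * Y * Y)"
  proof -
    have "M * (50 * m + 60) \<le> Y * (110 * z)" using MY z by (intro mult_mono) linarith+
    also have "\<dots> = 110 * (z * Y) * 1" by simp
    also have "\<dots> \<le> 110 * (z * Y) * Y" using Y1 by (intro mult_left_mono) auto
    finally show ?thesis using zYY by (simp add: mult_ac)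
  qed
  have pre: "50 * (m + n) + 200 * (m + 1) * (m + 1) * (n + 1) + 30 * r + 110 \<le> 440 * z ^ 8"
  proof -
    have "(m + 1) * (m + 1) * (n + 1) \<le> z * z * z" using z by (intro mult_mono) auto
    then have "200 * ((m + 1) * (m + 1) * (n + 1)) \<le> 200 * (z * z * z)" by (rule mult_left_mono) simp
    then have "200 * (m + 1) * (m + 1) * (n + 1) \<le> 200 * z ^ 3"
      by (simp only: power3_eq_cube mult.assoc)
    moreover have "z \<le> z ^ 8" "z ^ 3 \<le> z ^ 8"
      using power_increasing[of 1 8 z] power_increasing[of 3 8 z] z1 by simp_all
    moreover have "50 * (m + n) + 30 * r + 110 \<le> 240 * z" using z z1 by (simp add: algebra_simps)
    \<comment> \<open>With the nonlinear terms generalised to variables the rest is linear.\<close>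
    moreover have "p \<le> 200 * z3 \<Longrightarrow> z \<le> z8 \<Longrightarrow> z3 \<le> z8 \<Longrightarrow> a + b + 110 \<le> 240 * z \<Longrightarrow>
        a + p + b + 110 \<le> 440 * z8" for p z3 z8 a b :: nat by linarith
    ultimately show ?thesis by blast
  qed
  have "Suc B * (M * (m * (120 * m + 50 * M + 320) + 60) + 60) \<le> Suc B * (610 * (z * Y * Y))"
    using pass by (rule mult_left_mono) simp
  moreover have "170 * (z * Y * Y) \<le> Suc B * (170 * (z * Y * Y))" by simp
  moreover have "Suc B * (610 * (z * Y * Y)) + Suc B * (170 * (z * Y * Y)) = Suc B * (3120 * z ^ 7 * X ^ 2)"
  proof -
    have "z ^ 7 = z * z ^ 3 * z ^ 3" using power_add[of z 1 6] power_add[of z 3 3] by simp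
    then have "z * Y * Y = 4 * z ^ 7 * X ^ 2" by (simp add: Y_def power2_eq_square mult_ac)
    then show ?thesis by simp
  qed
  moreover have "p + 110 \<le> z8 \<Longrightarrow> t \<le> 170 * w \<Longrightarrow> u \<le> b1 \<Longrightarrow> 170 * w \<le> b2 \<Longrightarrow> b1 + b2 = b \<Longrightarrow>
      p + 100 + (u + t) + 10 \<le> z8 + b" for p z8 t w u b1 b2 b :: nat by linarith
  note this[OF pre final]
  ultimately have "50 * (m + n) + 200 * (m + 1) * (m + 1) * (n + 1) + 30 * r + 100 +
      (Suc B * (M * (m * (120 * m + 50 * M + 320) + 60) + 60) + (M * (50 * m + 60) + 60)) + 10 \<le>
      440 * z ^ 8 + Suc B * (3120 * z ^ 7 * X ^ 2)"
    by blast
  then have "real (50 * (m + n) + 200 * (m + 1) * (m + 1) * (n + 1) + 30 * r + 100 +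
      (Suc B * (M * (m * (120 * m + 50 * M + 320) + 60) + 60) + M * (50 * m + 60) + 60) + 10) \<le>
      real (440 * z ^ 8 + Suc B * (3120 * z ^ 7 * X ^ 2))"
    by (simp only: of_nat_le_iff add.assoc)
  also have "\<dots> = 440 * real z ^ 8 + real (Suc B) * (3120 * real z ^ 7 * real X ^ 2)"
    by (simp only: of_nat_add of_nat_mult of_nat_power of_nat_numeral)
  also have "real (Suc B) * (3120 * real z ^ 7 * real X ^ 2) \<le>
      (real z * (x + 1)) * (3120 * real z ^ 7 * real X ^ 2)"
  proof (rule mult_right_mono)
    have "real n * (x + 1) \<le> real z * (x + 1)" using z x by (intro mult_right_mono) auto
    then show "real (Suc B) \<le> real z * (x + 1)" using B by linarith
  qed simp
  also have "(real z * (x + 1)) * (3120 * real z ^ 7 * real X ^ 2) = 3120 * real z ^ 8 * (9 ^ nat \<lfloor>x\<rfloor> * (x + 1))"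
  proof -
    have "real X ^ 2 = 9 ^ nat \<lfloor>x\<rfloor>" by (simp add: X_def power2_eq_square power_mult_distrib[symmetric])
    moreover have "real z ^ 8 = real z * real z ^ 7" using power_Suc[of "real z" 7] by simp
    ultimately show ?thesis by (simp add: mult_ac)
  qed
  also have "\<dots> \<le> 3120 * real z ^ 8 * (2 * 16 powr x)"
    using powr_absorb_linear[OF x] by (intro mult_left_mono) auto
  also have "440 * real z ^ 8 + 3120 * real z ^ 8 * (2 * 16 powr x) \<le> 16 powr x * real (6680 * z ^ 8)"
  proof -
    have "1 \<le> (16::real) powr x" using x by (simp add: ge_one_powr_ge_zero)
    then have "440 * real z ^ 8 * 1 \<le> 440 * real z ^ 8 * 16 powr x" by (intro mult_left_mono) auto
    then show ?thesis by (simp add: algebra_simps)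
  qed
  finally show ?thesis by (simp only: add_left_mono)
qed

lemma avg_KT_nonneg: "1 \<le> size V \<Longrightarrow> 0 \<le> avg_KT V"
  unfolding avg_KT_def by (intro divide_nonneg_nonneg mult_nonneg_nonneg of_nat_0_le_iff) auto

text \<open>The empty list is the only ranking, and no vote orders any pair. It has to be output
  once unless \<open>r = 0\<close>.\<close>

lemma correct_output_no_candidates:
  assumes "kemeny_instance {} V lam r"
  shows "correct_output {} V lam r (replicate (min r 1) [])"
proof -
  have "v = []" if "v \<in># V" for v using assms that by (auto simp: kemeny_instance_def)
  moreover have "V \<noteq> {#}" using assms by (auto simp: kemeny_instance_def)
  ultimately have "respects_unanimity V []" unfolding respects_unanimity_def by fastforce
  moreover have "kemeny_score V [] = 0" by (simp add: kemeny_score_def d_KT_def)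
  moreover have "0 \<le> lam * real (k_OPT {} V)" using assms by (simp add: kemeny_instance_def)
  ultimately have A: "{Q \<in> K {} V (lam * real (k_OPT {} V)). respects_unanimity V Q} = {[]}"
    unfolding K_def by auto
  show ?thesis
  proof (cases "r = 0")
    case False
    then have "min r 1 = 1" by simp
    then show ?thesis unfolding correct_output_iff A by (simp add: One_nat_def)
  qed (simp add: correct_output_iff A)
qed

lemma runs_kemeny_program:
  fixes cs :: "nat list" and vs :: "nat list list" and lam :: real and r :: nat
  assumes inst: "kemeny_instance (set cs) (mset vs) lam r" and dist: "distinct cs"
  shows "\<exists>T. runs kemeny_program (input_state cs vs lam r) T
      (\<lambda>s. \<exists>L. has_output s L \<and> correct_output (set cs) (mset vs) lam r L) \<and>
    real T \<le> 16 powr (lam * avg_KT (mset vs)) * real (6680 * input_size cs vs r ^ 8)"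
proof -
  let ?m = "length cs" and ?n = "length vs" and ?s = "input_state cs vs lam r" and ?x = "lam * avg_KT (mset vs)"
  let ?R = "\<lambda>s. \<exists>L. has_output s L \<and> correct_output (set cs) (mset vs) lam r L"
  let ?z = "input_size cs vs r"
  have lam: "1 \<le> lam" and n2: "2 \<le> ?n" and perm: "set vs \<subseteq> permutations_of_set (set cs)"
    using inst by (simp_all add: kemeny_instance_def)
  have vs: "distinct v \<and> set v = set cs" if "v \<in> set vs" for v
    using perm that by (auto simp: permutations_of_set_def)
  have len: "length v = ?m" if "v \<in> set vs" for v
    using vs[OF that] distinct_card[of v] distinct_card[OF dist] by simp
  have d0: "0 \<le> avg_KT (mset vs)" using n2 by (intro avg_KT_nonneg) simp
  then have x0: "0 \<le> ?x" using lam by simp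
  have z: "?z = 3 + ?m + ?n * ?m + r" using length_input_word[OF len, of vs r] by (simp add: input_size_def)
  note h = input_state_nats[where cs = cs and vs = vs and lam = lam and r = r, OF len]
  show ?thesis
  proof (cases "?m = 0")
    case True
    have w: "nats ?s 0 2 = min r 1" using h(5)[of 0] h(6) True by (cases r) simp_all
    have "has_output s (replicate (min r 1) [])" if "nats s 1 0 = min r 1" for s
      using that by (intro has_outputI[where m = 0]) auto
    moreover have "correct_output (set cs) (mset vs) lam r (replicate (min r 1) [])"
      using correct_output_no_candidates[of "mset vs" lam r] inst True by simp
    ultimately have R: "?R s" if "nats s 1 0 = min r 1" for s using that by blast
    have A: "runs (Assign 1 (Num 0) (Cell 0 (Num 2))) ?s 10 ?R"
      unfolding runs_Assign by (intro conjI R) (use w in simp_all)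
    have b: "\<not> bval (Less (Num 0) num_cands) ?s" using h(1) True by simp
    have "runs kemeny_program ?s 20 ?R"
      unfolding kemeny_program_def by (simp only: runs_If b if_False) (intro conjI runs_mono[OF A]; simp)
    moreover have "real 20 \<le> 16 powr ?x * real (6680 * ?z ^ 8)"
    proof -
      have "1 ^ 8 \<le> ?z ^ 8" unfolding z by (rule power_mono) auto
      then have "20 \<le> 6680 * ?z ^ 8" by simp
      then have "1 * real 20 \<le> 16 powr ?x * real (6680 * ?z ^ 8)"
        using x0 by (intro mult_mono) (simp_all only: of_nat_le_iff, simp_all add: ge_one_powr_ge_zero)
      then show ?thesis by simp
    qed
    ultimately show ?thesis by blast
  next
    case False
    define D B M where "D = nat \<lfloor>?x\<rfloor>" and "B = nat \<lfloor>lam * real (k_OPT (set cs) (mset vs))\<rfloor>"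
      and "M = r * (?n * (2 * (?m + 1) * 3 ^ D))"
    define T1 T2 where "T1 = 50 * (?m + ?n) + 200 * (?m + 1) * (?m + 1) * (?n + 1) + 30 * r + 100"
      and "T2 = Suc B * (M * (?m * (120 * ?m + 50 * M + 320) + 60) + 60) + M * (50 * ?m + 60) + 60"
    interpret election "set cs" "mset vs"
      using perm n2 by unfold_locales auto
    have kO: "lam * real (k_OPT (set cs) (mset vs)) \<le> ?x * (real ?n - 1)"
      using k_OPT_le_avg n2 lam by (simp add: mult.assoc mult_left_mono)
    have rB: "real B \<le> ?x * (real ?n - 1)"
    proof -
      have "0 \<le> lam * real (k_OPT (set cs) (mset vs))" using lam by simp
      then show ?thesis using kO unfolding B_def by linarith
    qed
    have "real (Suc B) \<le> real ?n * (?x + 1)"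
    proof -
      have "?x * (real ?n - 1) \<le> ?x * real ?n" using x0 by (intro mult_left_mono) auto
      then show ?thesis using rB n2 by (simp add: algebra_simps)
    qed
    \<comment> \<open>With at least one candidate, every vote contributes to the size of the
      input.\<close>
    moreover have "?n \<le> ?n * ?m" using False by (simp add: Suc_le_eq)
    then have "?m + 1 \<le> ?z" "?n + 1 \<le> ?z" "r + 1 \<le> ?z" unfolding z by linarith+
    ultimately have time: "real (T1 + T2 + 10) \<le> 16 powr ?x * real (6680 * ?z ^ 8)"
      unfolding T1_def T2_def M_def D_def using x0 by (intro time_bound)
    note prep = runs_prepare[where cs = cs and vs = vs and lam = lam and r = r, OF dist vs, folded T1_def]
    have "runs (Seq prepare (If (Less (Num 0) (var 10)) search_and_write Skip)) ?s (T1 + T2 + 5) ?R"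
    proof (rule runs_SeqI[OF prep])
      fix s1 :: state
      assume s1: "(\<forall>i\<le>?m + ?n. nats s1 3 i = i * ?m \<and> nats s1 4 i = 2 ^ i) \<and>
        (\<forall>y<?m. \<forall>c<?m. nats s1 2 (y * ?m + c) = length (filter (\<lambda>v. before v (cs ! y) (cs ! c)) vs)) \<and>
        nats s1 10 0 = r"
        and fr: "\<And>a. a \<notin> nat_mods prepare \<Longrightarrow> nats s1 a = nats ?s a"
        and rf: "\<And>a. a \<notin> real_mods prepare \<Longrightarrow> reals s1 a = reals ?s a"
      show "runs (If (Less (Num 0) (var 10)) search_and_write Skip) s1 (T1 + T2 + 5 - T1) ?R"
      proof (cases "r = 0")
        case True
        \<comment> \<open>The untouched output array already announces zero rankings.\<close>
        have "has_output s1 []" using fr h(7)[of 1 0] by (intro has_outputI[where m = 0]) simp_all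
        moreover have "correct_output (set cs) (mset vs) lam r []" using True by (simp add: correct_output_iff)
        ultimately have "?R s1" by blast
        then show ?thesis using True s1 by (simp add: T2_def)
      next
        case r: False
        interpret aggregation cs vs r
          using dist r by unfold_locales auto
        have tab: "tables (nats s1)"
          unfolding tables_def pref_def using s1 fr h by (simp add: mset_filter[symmetric] del: mset_filter)
        have M: "length E \<le> M" if "k \<le> Suc B" "search_inv E k e i" for E k e i
        proof -
          \<comment> \<open>The final \<open>k\<close> may be \<open>B + 1\<close>. This strict
            bound, with \<open>n - 1\<close> instead of \<open>n\<close>, keeps even that
            \<open>k\<close> below \<open>n * Suc D\<close>, as \<open>length_search_le\<close>
            requires.\<close>
          have "real B < real (Suc D * (?n - 1))"
          proof -
            have "?x < real (Suc D)" unfolding D_def using x0 by linarith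
            then have "?x * (real ?n - 1) < real (Suc D) * (real ?n - 1)"
              using n2 by (intro mult_strict_right_mono) auto
            moreover have "real (Suc D * (?n - 1)) = real (Suc D) * (real ?n - 1)"
              using n2 unfolding of_nat_mult by (simp add: of_nat_diff)
            ultimately show ?thesis using rB by linarith
          qed
          then have "k \<le> Suc D * (?n - 1)" using that(1) by (simp only: of_nat_less_iff)
          also have "\<dots> < Suc D * ?n" using n2 by (intro mult_strict_left_mono) auto
          finally have "k < size (mset vs) * Suc D" by (simp add: mult.commute)
          then show ?thesis
            using length_search_le[OF that(2)] distinct_card[OF dist] by (simp add: M_def)
        qed
        have "runs search_and_write s1 T2 ?R"
          unfolding T2_def B_def
        proof (rule runs_search_and_write[OF tab])
          show "reals s1 1 0 = 0" "reals s1 0 0 = lam" using rf by (simp_all add: input_state_def)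
          show "nats s1 a i = 0" if "a \<in> {6, 7, 8, 9, 12}" for a i
            using that fr[of a] h(7)[of a] by auto
        qed (use s1 lam M in \<open>auto simp: B_def\<close>)
        then show ?thesis using r s1 by simp
      qed
    next
      show "T1 \<le> T1 + T2 + 5" by simp
    qed
    then have "runs kemeny_program ?s (T1 + T2 + 10) ?R"
      unfolding kemeny_program_def using False h(1) by (simp add: ac_simps)
    then show ?thesis using time by blast
  qed
qed

theorem theorem6:
  shows "\<exists>(prog :: com) (q :: nat poly).
    \<forall>(C :: nat set) (V :: nat list multiset) (lam :: real) (r :: nat)
      (cs :: nat list) (vs :: nat list list).
      kemeny_instance C V lam r \<and> set cs = C \<and> distinct cs \<and> mset vs = V \<longrightarrow>
      (\<exists>t s L. exec prog (input_state cs vs lam r) t s \<and>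
         has_output s L \<and> correct_output C V lam r L \<and>
         real t \<le> 16 powr (lam * avg_KT V) * real (poly q (input_size cs vs r)))"
proof (rule exI[of _ kemeny_program], rule exI[of _ "monom 6680 8"], intro allI impI)
  fix C :: "nat set" and V :: "nat list multiset" and lam :: real and r :: nat
    and cs :: "nat list" and vs :: "nat list list"
  assume *: "kemeny_instance C V lam r \<and> set cs = C \<and> distinct cs \<and> mset vs = V"
  then obtain T where T: "runs kemeny_program (input_state cs vs lam r) T
      (\<lambda>s. \<exists>L. has_output s L \<and> correct_output C V lam r L)"
    "real T \<le> 16 powr (lam * avg_KT V) * real (6680 * input_size cs vs r ^ 8)"
    using runs_kemeny_program[of cs vs lam r] by blast
  from T(1) obtain t s L where t: "exec kemeny_program (input_state cs vs lam r) t s" "t \<le> T"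
    "has_output s L" "correct_output C V lam r L" unfolding runs_def by blast
  have "real t \<le> real T" using t(2) by simp
  also have "real T \<le> 16 powr (lam * avg_KT V) * real (poly (monom 6680 8) (input_size cs vs r))"
    using T(2) by (simp only: poly_monom)
  finally show "\<exists>t s L. exec kemeny_program (input_state cs vs lam r) t s \<and>
         has_output s L \<and> correct_output C V lam r L \<and>
         real t \<le> 16 powr (lam * avg_KT V) * real (poly (monom 6680 8) (input_size cs vs r))"
    using t by blast
qed

end
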